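(* Let $X$ be a compact connected Riemann surface of genus at least $2$ and let $x\in X$ be a fixed point. Let $(F,\psi:F\otimes F\to M)$ be an orthogonal bundle over $X$ of rank $r=2n$. Let $S_x\subset F_x$ be an isotropic subspace of dimension $n$. Set $Q_x=F_x/S_x$, and let $$0\to E\to F\to Q_x\to 0$$ be the short exact sequence, where $F\to F_x\to Q_x$ is the natural projection. Then $E$ inherits a natural orthogonal structure $\varphi:E\otimes E\to L$, where $L=M(-x):=M\otimes_{\mathcal{O}_X}\mathcal{O}_X(-x)$.
   Context: An orthogonal bundle on $X$ is a pair $(F,\psi)$, where $F$ is a holomorphic vector bundle on $X$ and $\psi:F\otimes F\to M$ is a symmetric and nondegenerate (on every fiber) holomorphic homomorphism with values in a holomorphic line bundle $M$ on $X$; such a $\psi$ is called an orthogonal structure on $F$ with values in $M$. $F_x$ denotes the fiber of $F$ at $x$. A subspace $S_x\subset F_x$ is isotropic if the restriction of $\psi_x$ to $S_x\otimes S_x$ is identically zero. In the exact sequence, $Q_x$ is viewed as a skyscraper sheaf supported at $x$. *)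

theory Defs
  imports
    "HOL-Complex_Analysis.Complex_Analysis"
    "HOL-Homology.Homology"
    "HOL-Algebra.Module"
    "HOL-Algebra.AbelCoset"
    "HOL-Algebra.Generated_Groups"
begin

section \<open>Riemann surfaces\<close>

record 'x surface =
  points :: "'x topology"
  charts :: "('x set \<times> ('x \<Rightarrow> complex)) set"

abbreviation open_in :: "'x surface \<Rightarrow> 'x set \<Rightarrow> bool"
  where "open_in X U \<equiv> openin (points X) U"

definition riemann_surface :: "'x surface \<Rightarrow> bool" where
  "riemann_surface X \<longleftrightarrow>
     Hausdorff_space (points X) \<and>
     (\<Union>(U, z)\<in>charts X. U) = topspace (points X) \<and>
     (\<forall>(U, z)\<in>charts X. open_in X U \<and> open (z ` U) \<and>
        homeomorphic_map (subtopology (points X) U) (top_of_set (z ` U)) z) \<and>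
     (\<forall>(U, z)\<in>charts X. \<forall>(V, w)\<in>charts X.
        (w \<circ> inv_into U z) holomorphic_on z ` (U \<inter> V))"

definition has_genus :: "'x surface \<Rightarrow> nat \<Rightarrow> bool" where
  "has_genus X g \<longleftrightarrow>
     homology_group 1 (points X) \<cong> free_Abelian_group {..<2 * g}"

definition holomorphic_function :: "'x surface \<Rightarrow> 'x set \<Rightarrow> ('x \<Rightarrow> complex) \<Rightarrow> bool" where
  "holomorphic_function X U f \<longleftrightarrow>
     (\<forall>(V, z)\<in>charts X. (f \<circ> inv_into V z) holomorphic_on z ` (U \<inter> V))"

text \<open>Sections of the structure sheaf over \<open>U\<close> are extensional functions, so that
  sections are equal as soon as they agree on \<open>U\<close>.\<close>

definition structure_sheaf :: "'x surface \<Rightarrow> 'x set \<Rightarrow> ('x \<Rightarrow> complex) ring" where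
  "structure_sheaf X U =
     \<lparr>carrier = {f \<in> extensional U. holomorphic_function X U f},
      monoid.mult = (\<lambda>f g. \<lambda>y\<in>U. f y * g y),
      one = (\<lambda>y\<in>U. 1),
      zero = (\<lambda>y\<in>U. 0),
      add = (\<lambda>f g. \<lambda>y\<in>U. f y + g y)\<rparr>"

definition complex_field :: "complex ring" where
  "complex_field = \<lparr>carrier = UNIV, monoid.mult = (*), one = 1, zero = 0, add = (+)\<rparr>"


section \<open>Modules\<close>

text \<open>The module record of HOL-Algebra extends that of rings; its multiplication and
  unit play no role for a module.\<close>

definition make_module ::
  "'m set \<Rightarrow> ('m \<Rightarrow> 'm \<Rightarrow> 'm) \<Rightarrow> 'm \<Rightarrow> ('a \<Rightarrow> 'm \<Rightarrow> 'm) \<Rightarrow> ('a, 'm) module" where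
  "make_module C p z sm =
     \<lparr>carrier = C, monoid.mult = undefined, one = undefined, zero = z, add = p,
      smult = sm\<rparr>"

definition module_hom ::
  "('a, 'r) ring_scheme \<Rightarrow> ('a, 'm, 'u) module_scheme \<Rightarrow> ('a, 'n, 'v) module_scheme
    \<Rightarrow> ('m \<Rightarrow> 'n) set" where
  "module_hom R M N =
     {h \<in> carrier M \<rightarrow> carrier N.
        (\<forall>s\<in>carrier M. \<forall>t\<in>carrier M. h (s \<oplus>\<^bsub>M\<^esub> t) = h s \<oplus>\<^bsub>N\<^esub> h t) \<and>
        (\<forall>a\<in>carrier R. \<forall>s\<in>carrier M. h (a \<odot>\<^bsub>M\<^esub> s) = a \<odot>\<^bsub>N\<^esub> h s)}"

definition has_dimension :: "('a, 'r) ring_scheme \<Rightarrow> ('a, 'v, 'u) module_scheme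
    \<Rightarrow> 'v set \<Rightarrow> nat \<Rightarrow> bool" where
  "has_dimension K V S n \<longleftrightarrow>
     (\<exists>b. b ` {..<n} \<subseteq> S \<and>
        (\<forall>v\<in>S. \<exists>!c. c \<in> {..<n} \<rightarrow>\<^sub>E carrier K \<and> v = (\<Oplus>\<^bsub>V\<^esub>i\<in>{..<n}. c i \<odot>\<^bsub>V\<^esub> b i)))"

definition quotient_module ::
  "('a, 'm, 'u) module_scheme \<Rightarrow> 'm set \<Rightarrow> ('a, 'm set) module" where
  "quotient_module M S =
     make_module (a_rcosets\<^bsub>M\<^esub> S) (set_add M) S
       (\<lambda>a A. \<Union>v\<in>A. S +>\<^bsub>M\<^esub> (a \<odot>\<^bsub>M\<^esub> v))"

text \<open>\<open>M \<otimes>\<^sub>R N\<close> is the free abelian group on the pairs \<open>(m, n)\<close> modulo the subgroup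
  generated by the bilinearity relations; its elements are cosets of that subgroup.\<close>

abbreviation formal_tensors ::
  "('a, 'm, 'u) module_scheme \<Rightarrow> ('a, 'n, 'v) module_scheme \<Rightarrow> (('m \<times> 'n) \<Rightarrow>\<^sub>0 int) monoid"
  where "formal_tensors M N \<equiv> free_Abelian_group (carrier M \<times> carrier N)"

definition tensor_relations ::
  "('a, 'r) ring_scheme \<Rightarrow> ('a, 'm, 'u) module_scheme \<Rightarrow> ('a, 'n, 'v) module_scheme
    \<Rightarrow> (('m \<times> 'n) \<Rightarrow>\<^sub>0 int) set" where
  "tensor_relations R M N = generate (formal_tensors M N)
     ({frag_of (m \<oplus>\<^bsub>M\<^esub> m', n) - frag_of (m, n) - frag_of (m', n) | m m' n.
         m \<in> carrier M \<and> m' \<in> carrier M \<and> n \<in> carrier N} \<union>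
      {frag_of (m, n \<oplus>\<^bsub>N\<^esub> n') - frag_of (m, n) - frag_of (m, n') | m n n'.
         m \<in> carrier M \<and> n \<in> carrier N \<and> n' \<in> carrier N} \<union>
      {frag_of (a \<odot>\<^bsub>M\<^esub> m, n) - frag_of (m, a \<odot>\<^bsub>N\<^esub> n) | a m n.
         a \<in> carrier R \<and> m \<in> carrier M \<and> n \<in> carrier N})"

definition tensor_class ::
  "('a, 'r) ring_scheme \<Rightarrow> ('a, 'm, 'u) module_scheme \<Rightarrow> ('a, 'n, 'v) module_scheme
    \<Rightarrow> (('m \<times> 'n) \<Rightarrow>\<^sub>0 int) \<Rightarrow> (('m \<times> 'n) \<Rightarrow>\<^sub>0 int) set" where
  "tensor_class R M N c = tensor_relations R M N #>\<^bsub>formal_tensors M N\<^esub> c"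

definition tensor_module ::
  "('a, 'r) ring_scheme \<Rightarrow> ('a, 'm, 'u) module_scheme \<Rightarrow> ('a, 'n, 'v) module_scheme
    \<Rightarrow> ('a, (('m \<times> 'n) \<Rightarrow>\<^sub>0 int) set) module" where
  "tensor_module R M N =
     make_module
       (rcosets\<^bsub>formal_tensors M N\<^esub> (tensor_relations R M N))
       (set_mult (formal_tensors M N))
       (tensor_relations R M N)
       (\<lambda>a C. \<Union>c\<in>C. tensor_class R M N
          (frag_extend (\<lambda>(m, n). frag_of (a \<odot>\<^bsub>M\<^esub> m, n)) c))"


section \<open>Sheaves of modules over the structure sheaf\<close>

record ('x, 'm) msheaf =
  sec :: "'x set \<Rightarrow> ('x \<Rightarrow> complex, 'm) module"
  res :: "'x set \<Rightarrow> 'x set \<Rightarrow> 'm \<Rightarrow> 'm"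

definition module_presheaf :: "'x surface \<Rightarrow> ('x, 'm) msheaf \<Rightarrow> bool" where
  "module_presheaf X F \<longleftrightarrow>
     (\<forall>U. open_in X U \<longrightarrow> Module.module (structure_sheaf X U) (sec F U)) \<and>
     (\<forall>U V. open_in X U \<and> open_in X V \<and> V \<subseteq> U \<longrightarrow>
        res F U V \<in> carrier (sec F U) \<rightarrow> carrier (sec F V) \<and>
        (\<forall>s\<in>carrier (sec F U). \<forall>t\<in>carrier (sec F U).
           res F U V (s \<oplus>\<^bsub>sec F U\<^esub> t) = res F U V s \<oplus>\<^bsub>sec F V\<^esub> res F U V t) \<and>
        (\<forall>f\<in>carrier (structure_sheaf X U). \<forall>s\<in>carrier (sec F U).
           res F U V (f \<odot>\<^bsub>sec F U\<^esub> s) = restrict f V \<odot>\<^bsub>sec F V\<^esub> res F U V s)) \<and>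
     (\<forall>U. open_in X U \<longrightarrow> (\<forall>s\<in>carrier (sec F U). res F U U s = s)) \<and>
     (\<forall>U V W. open_in X U \<and> open_in X V \<and> open_in X W \<and> W \<subseteq> V \<and> V \<subseteq> U \<longrightarrow>
        (\<forall>s\<in>carrier (sec F U). res F V W (res F U V s) = res F U W s))"

definition module_sheaf :: "'x surface \<Rightarrow> ('x, 'm) msheaf \<Rightarrow> bool" where
  "module_sheaf X F \<longleftrightarrow>
     module_presheaf X F \<and>
     (\<forall>\<U>. (\<forall>U\<in>\<U>. open_in X U) \<longrightarrow>
        (\<forall>s\<in>carrier (sec F (\<Union>\<U>)). \<forall>t\<in>carrier (sec F (\<Union>\<U>)).
           (\<forall>U\<in>\<U>. res F (\<Union>\<U>) U s = res F (\<Union>\<U>) U t) \<longrightarrow> s = t) \<and>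
        (\<forall>\<sigma>. (\<forall>U\<in>\<U>. \<sigma> U \<in> carrier (sec F U)) \<and>
           (\<forall>U\<in>\<U>. \<forall>V\<in>\<U>. res F U (U \<inter> V) (\<sigma> U) = res F V (U \<inter> V) (\<sigma> V)) \<longrightarrow>
           (\<exists>s\<in>carrier (sec F (\<Union>\<U>)). \<forall>U\<in>\<U>. res F (\<Union>\<U>) U s = \<sigma> U)))"

definition sheaf_hom ::
  "'x surface \<Rightarrow> ('x, 'm) msheaf \<Rightarrow> ('x, 'n) msheaf \<Rightarrow> ('x set \<Rightarrow> 'm \<Rightarrow> 'n) \<Rightarrow> bool" where
  "sheaf_hom X F G h \<longleftrightarrow>
     (\<forall>U. open_in X U \<longrightarrow> h U \<in> module_hom (structure_sheaf X U) (sec F U) (sec G U)) \<and>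
     (\<forall>U V. open_in X U \<and> open_in X V \<and> V \<subseteq> U \<longrightarrow>
        (\<forall>s\<in>carrier (sec F U). h V (res F U V s) = res G U V (h U s)))"

definition kernel_sheaf ::
  "('x, 'm) msheaf \<Rightarrow> ('x, 'n) msheaf \<Rightarrow> ('x set \<Rightarrow> 'm \<Rightarrow> 'n) \<Rightarrow> ('x, 'm) msheaf" where
  "kernel_sheaf F G h =
     \<lparr>sec = (\<lambda>U. (sec F U)\<lparr>carrier := {s \<in> carrier (sec F U). h U s = \<zero>\<^bsub>sec G U\<^esub>}\<rparr>),
      res = res F\<rparr>"

text \<open>A frame over \<open>U\<close> is an isomorphism of the restriction of \<open>F\<close> to \<open>U\<close> with the free
  module of rank \<open>r\<close>, given by the images of the standard basis.\<close>

definition frame_over ::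
  "'x surface \<Rightarrow> nat \<Rightarrow> ('x, 'm) msheaf \<Rightarrow> 'x set \<Rightarrow> (nat \<Rightarrow> 'm) \<Rightarrow> bool" where
  "frame_over X r F U e \<longleftrightarrow>
     e ` {..<r} \<subseteq> carrier (sec F U) \<and>
     (\<forall>V. open_in X V \<and> V \<subseteq> U \<longrightarrow>
        (\<forall>s\<in>carrier (sec F V). \<exists>!c. c \<in> {..<r} \<rightarrow>\<^sub>E carrier (structure_sheaf X V) \<and>
           s = (\<Oplus>\<^bsub>sec F V\<^esub>i\<in>{..<r}. c i \<odot>\<^bsub>sec F V\<^esub> res F U V (e i))))"

text \<open>Holomorphic vector bundles are identified with their sheaves of holomorphic sections,
  that is, with locally free sheaves of finite rank.\<close>

definition vector_bundle :: "'x surface \<Rightarrow> nat \<Rightarrow> ('x, 'm) msheaf \<Rightarrow> bool" where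
  "vector_bundle X r F \<longleftrightarrow>
     module_sheaf X F \<and>
     (\<forall>y\<in>topspace (points X). \<exists>U e. open_in X U \<and> y \<in> U \<and> frame_over X r F U e)"

abbreviation line_bundle :: "'x surface \<Rightarrow> ('x, 'm) msheaf \<Rightarrow> bool" where
  "line_bundle X M \<equiv> vector_bundle X 1 M"


section \<open>Tensor products of sheaves\<close>

definition germ ::
  "'x surface \<Rightarrow> ('x, 'm) msheaf \<Rightarrow> 'x \<Rightarrow> 'x set \<Rightarrow> 'm \<Rightarrow> ('x set \<times> 'm) set" where
  "germ X P y U s =
     {(V, t). open_in X V \<and> y \<in> V \<and> t \<in> carrier (sec P V) \<and>
        (\<exists>W. open_in X W \<and> y \<in> W \<and> W \<subseteq> U \<inter> V \<and> res P U W s = res P V W t)}"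

definition germ_add ::
  "'x surface \<Rightarrow> ('x, 'm) msheaf \<Rightarrow> 'x
    \<Rightarrow> ('x set \<times> 'm) set \<Rightarrow> ('x set \<times> 'm) set \<Rightarrow> ('x set \<times> 'm) set" where
  "germ_add X P y A B =
     (\<Union>(U, s)\<in>A. \<Union>(V, t)\<in>B.
        germ X P y (U \<inter> V) (res P U (U \<inter> V) s \<oplus>\<^bsub>sec P (U \<inter> V)\<^esub> res P V (U \<inter> V) t))"

definition germ_smult ::
  "'x surface \<Rightarrow> ('x, 'm) msheaf \<Rightarrow> 'x \<Rightarrow> 'x set
    \<Rightarrow> ('x \<Rightarrow> complex) \<Rightarrow> ('x set \<times> 'm) set \<Rightarrow> ('x set \<times> 'm) set" where
  "germ_smult X P y U f A =
     (\<Union>(V, t)\<in>A.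
        germ X P y (U \<inter> V) (restrict f (U \<inter> V) \<odot>\<^bsub>sec P (U \<inter> V)\<^esub> res P V (U \<inter> V) t))"

definition sheafification ::
  "'x surface \<Rightarrow> ('x, 'm) msheaf \<Rightarrow> ('x, 'x \<Rightarrow> ('x set \<times> 'm) set) msheaf" where
  "sheafification X P =
     \<lparr>sec = (\<lambda>U. make_module
        {\<sigma> \<in> extensional U. \<forall>y\<in>U. \<exists>V s. open_in X V \<and> y \<in> V \<and> V \<subseteq> U \<and>
           s \<in> carrier (sec P V) \<and> (\<forall>z\<in>V. \<sigma> z = germ X P z V s)}
        (\<lambda>\<sigma> \<tau>. \<lambda>y\<in>U. germ_add X P y (\<sigma> y) (\<tau> y))
        (\<lambda>y\<in>U. germ X P y U \<zero>\<^bsub>sec P U\<^esub>)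
        (\<lambda>f \<sigma>. \<lambda>y\<in>U. germ_smult X P y U f (\<sigma> y))),
      res = (\<lambda>U V \<sigma>. restrict \<sigma> V)\<rparr>"

definition tensor_presheaf ::
  "'x surface \<Rightarrow> ('x, 'm) msheaf \<Rightarrow> ('x, 'n) msheaf \<Rightarrow> ('x, (('m \<times> 'n) \<Rightarrow>\<^sub>0 int) set) msheaf"
  where
  "tensor_presheaf X F G =
     \<lparr>sec = (\<lambda>U. tensor_module (structure_sheaf X U) (sec F U) (sec G U)),
      res = (\<lambda>U V C. \<Union>c\<in>C. tensor_class (structure_sheaf X V) (sec F V) (sec G V)
        (frag_extend (\<lambda>(s, t). frag_of (res F U V s, res G U V t)) c))\<rparr>"

type_synonym ('x, 'm, 'n) tensor_section = "'x \<Rightarrow> ('x set \<times> (('m \<times> 'n) \<Rightarrow>\<^sub>0 int) set) set"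

definition tensor_sheaf ::
  "'x surface \<Rightarrow> ('x, 'm) msheaf \<Rightarrow> ('x, 'n) msheaf
    \<Rightarrow> ('x, ('x, 'm, 'n) tensor_section) msheaf" where
  "tensor_sheaf X F G = sheafification X (tensor_presheaf X F G)"

definition pure_tensor ::
  "'x surface \<Rightarrow> ('x, 'm) msheaf \<Rightarrow> ('x, 'n) msheaf
    \<Rightarrow> 'x set \<Rightarrow> 'm \<Rightarrow> 'n \<Rightarrow> ('x, 'm, 'n) tensor_section" where
  "pure_tensor X F G U s t = (\<lambda>y\<in>U. germ X (tensor_presheaf X F G) y U
     (tensor_class (structure_sheaf X U) (sec F U) (sec G U) (frag_of (s, t))))"


section \<open>Fibers\<close>

text \<open>The fiber of \<open>F\<close> at \<open>y\<close> is the stalk at \<open>y\<close> modulo its product with the maximal ideal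
  of germs of functions vanishing at \<open>y\<close>.  Its elements are classes of local sections
  near \<open>y\<close>, two such sections being identified if, on some neighbourhood \<open>W\<close> of \<open>y\<close>, their
  difference is a finite sum of products \<open>f \<odot> u\<close> with \<open>f\<close> vanishing at \<open>y\<close>.\<close>

definition vanishing_span ::
  "'x surface \<Rightarrow> ('x, 'm) msheaf \<Rightarrow> 'x \<Rightarrow> 'x set \<Rightarrow> 'm set" where
  "vanishing_span X F y W =
     generate (add_monoid (sec F W))
       {f \<odot>\<^bsub>sec F W\<^esub> u | f u.
          f \<in> carrier (structure_sheaf X W) \<and> f y = 0 \<and> u \<in> carrier (sec F W)}"

definition at_point ::
  "'x surface \<Rightarrow> ('x, 'm) msheaf \<Rightarrow> 'x \<Rightarrow> 'x set \<Rightarrow> 'm \<Rightarrow> ('x set \<times> 'm) set" where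
  "at_point X F y U s =
     {(V, t). open_in X V \<and> y \<in> V \<and> t \<in> carrier (sec F V) \<and>
        (\<exists>W. open_in X W \<and> y \<in> W \<and> W \<subseteq> U \<inter> V \<and>
           res F U W s \<ominus>\<^bsub>sec F W\<^esub> res F V W t \<in> vanishing_span X F y W)}"

definition fiber ::
  "'x surface \<Rightarrow> ('x, 'm) msheaf \<Rightarrow> 'x \<Rightarrow> (complex, ('x set \<times> 'm) set) module" where
  "fiber X F y =
     make_module
       {at_point X F y U s | U s. open_in X U \<and> y \<in> U \<and> s \<in> carrier (sec F U)}
       (\<lambda>A B. \<Union>(U, s)\<in>A. \<Union>(V, t)\<in>B. at_point X F y (U \<inter> V)
          (res F U (U \<inter> V) s \<oplus>\<^bsub>sec F (U \<inter> V)\<^esub> res F V (U \<inter> V) t))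
       (at_point X F y (topspace (points X)) \<zero>\<^bsub>sec F (topspace (points X))\<^esub>)
       (\<lambda>a A. \<Union>(U, s)\<in>A. at_point X F y U ((\<lambda>z\<in>U. a) \<odot>\<^bsub>sec F U\<^esub> s))"

text \<open>The bilinear map \<open>F\<^sub>y \<times> F\<^sub>y \<rightarrow> M\<^sub>y\<close> induced by \<open>\<psi> : F \<otimes> F \<rightarrow> M\<close>; all choices of
  representatives give the same class, of which the union is taken.\<close>

definition fiber_form ::
  "'x surface \<Rightarrow> ('x, 'f) msheaf \<Rightarrow> ('x, 'm) msheaf
    \<Rightarrow> ('x set \<Rightarrow> ('x, 'f, 'f) tensor_section \<Rightarrow> 'm)
    \<Rightarrow> 'x \<Rightarrow> ('x set \<times> 'f) set \<Rightarrow> ('x set \<times> 'f) set \<Rightarrow> ('x set \<times> 'm) set" where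
  "fiber_form X F M \<psi> y v w =
     (\<Union>(U, s)\<in>v. \<Union>(V, t)\<in>w. at_point X M y (U \<inter> V)
        (\<psi> (U \<inter> V) (pure_tensor X F F (U \<inter> V) (res F U (U \<inter> V) s) (res F V (U \<inter> V) t))))"


section \<open>Orthogonal bundles\<close>

definition orthogonal_structure ::
  "'x surface \<Rightarrow> ('x, 'f) msheaf \<Rightarrow> ('x, 'm) msheaf
    \<Rightarrow> ('x set \<Rightarrow> ('x, 'f, 'f) tensor_section \<Rightarrow> 'm) \<Rightarrow> bool" where
  "orthogonal_structure X F M \<psi> \<longleftrightarrow>
     sheaf_hom X (tensor_sheaf X F F) M \<psi> \<and>
     (\<forall>U. open_in X U \<longrightarrow> (\<forall>s\<in>carrier (sec F U). \<forall>t\<in>carrier (sec F U).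
        \<psi> U (pure_tensor X F F U s t) = \<psi> U (pure_tensor X F F U t s))) \<and>
     (\<forall>y\<in>topspace (points X). \<forall>v\<in>carrier (fiber X F y).
        (\<forall>w\<in>carrier (fiber X F y). fiber_form X F M \<psi> y v w = \<zero>\<^bsub>fiber X M y\<^esub>) \<longrightarrow>
        v = \<zero>\<^bsub>fiber X F y\<^esub>)"

definition orthogonal_bundle ::
  "'x surface \<Rightarrow> nat \<Rightarrow> ('x, 'f) msheaf \<Rightarrow> ('x, 'm) msheaf
    \<Rightarrow> ('x set \<Rightarrow> ('x, 'f, 'f) tensor_section \<Rightarrow> 'm) \<Rightarrow> bool" where
  "orthogonal_bundle X r F M \<psi> \<longleftrightarrow>
     vector_bundle X r F \<and> line_bundle X M \<and> orthogonal_structure X F M \<psi>"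

definition isotropic ::
  "'x surface \<Rightarrow> ('x, 'f) msheaf \<Rightarrow> ('x, 'm) msheaf
    \<Rightarrow> ('x set \<Rightarrow> ('x, 'f, 'f) tensor_section \<Rightarrow> 'm)
    \<Rightarrow> 'x \<Rightarrow> ('x set \<times> 'f) set set \<Rightarrow> bool" where
  "isotropic X F M \<psi> y S \<longleftrightarrow>
     (\<forall>v\<in>S. \<forall>w\<in>S. fiber_form X F M \<psi> y v w = \<zero>\<^bsub>fiber X M y\<^esub>)"


section \<open>The Hecke transformation and the twist by a point\<close>

definition skyscraper :: "'x \<Rightarrow> (complex, 'v) module \<Rightarrow> ('x, 'v) msheaf" where
  "skyscraper x Q =
     \<lparr>sec = (\<lambda>U. make_module (if x \<in> U then carrier Q else {\<zero>\<^bsub>Q\<^esub>}) (add Q) \<zero>\<^bsub>Q\<^esub>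
        (\<lambda>f q. if x \<in> U then f x \<odot>\<^bsub>Q\<^esub> q else \<zero>\<^bsub>Q\<^esub>)),
      res = (\<lambda>U V q. if x \<in> V then q else \<zero>\<^bsub>Q\<^esub>)\<rparr>"

definition fiber_quotient_sheaf ::
  "'x surface \<Rightarrow> ('x, 'f) msheaf \<Rightarrow> 'x \<Rightarrow> ('x set \<times> 'f) set set
    \<Rightarrow> ('x, ('x set \<times> 'f) set set) msheaf" where
  "fiber_quotient_sheaf X F x S = skyscraper x (quotient_module (fiber X F x) S)"

definition fiber_projection ::
  "'x surface \<Rightarrow> ('x, 'f) msheaf \<Rightarrow> 'x \<Rightarrow> ('x set \<times> 'f) set set
    \<Rightarrow> 'x set \<Rightarrow> 'f \<Rightarrow> ('x set \<times> 'f) set set" where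
  "fiber_projection X F x S U s =
     (if x \<in> U then S +>\<^bsub>fiber X F x\<^esub> at_point X F x U s
      else \<zero>\<^bsub>quotient_module (fiber X F x) S\<^esub>)"

definition hecke_transform ::
  "'x surface \<Rightarrow> ('x, 'f) msheaf \<Rightarrow> 'x \<Rightarrow> ('x set \<times> 'f) set set \<Rightarrow> ('x, 'f) msheaf" where
  "hecke_transform X F x S =
     kernel_sheaf F (fiber_quotient_sheaf X F x S) (fiber_projection X F x S)"

text \<open>\<open>\<O>\<^sub>X(-x)\<close> as the ideal sheaf of functions vanishing at \<open>x\<close>.\<close>

definition point_ideal_sheaf :: "'x surface \<Rightarrow> 'x \<Rightarrow> ('x, 'x \<Rightarrow> complex) msheaf" where
  "point_ideal_sheaf X x =
     \<lparr>sec = (\<lambda>U. make_module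
        {f \<in> carrier (structure_sheaf X U). x \<in> U \<longrightarrow> f x = 0}
        (add (structure_sheaf X U)) \<zero>\<^bsub>structure_sheaf X U\<^esub>
        (monoid.mult (structure_sheaf X U))),
      res = (\<lambda>U V f. restrict f V)\<rparr>"

definition twist ::
  "'x surface \<Rightarrow> ('x, 'm) msheaf \<Rightarrow> 'x
    \<Rightarrow> ('x, ('x, 'm, 'x \<Rightarrow> complex) tensor_section) msheaf" where
  "twist X M x = tensor_sheaf X M (point_ideal_sheaf X x)"

text \<open>The natural map \<open>M(-x) \<rightarrow> M\<close>, \<open>m \<otimes> f \<mapsto> f \<odot> m\<close>.  It is determined on all sections by
  its values on pure tensors.\<close>

definition twist_inclusion ::
  "'x surface \<Rightarrow> ('x, 'm) msheaf \<Rightarrow> 'x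
    \<Rightarrow> ('x set \<Rightarrow> ('x, 'm, 'x \<Rightarrow> complex) tensor_section \<Rightarrow> 'm) \<Rightarrow> bool" where
  "twist_inclusion X M x j \<longleftrightarrow>
     sheaf_hom X (twist X M x) M j \<and>
     (\<forall>U. open_in X U \<longrightarrow>
        (\<forall>m\<in>carrier (sec M U). \<forall>f\<in>carrier (sec (point_ideal_sheaf X x) U).
           j U (pure_tensor X M (point_ideal_sheaf X x) U m f) = f \<odot>\<^bsub>sec M U\<^esub> m))"

text \<open>Compatibility of \<open>\<phi>\<close> on \<open>E \<subseteq> F\<close> with \<open>\<psi>\<close>: the composite \<open>E \<otimes> E \<rightarrow> M(-x) \<rightarrow> M\<close> equals
  \<open>E \<otimes> E \<rightarrow> F \<otimes> F \<rightarrow> M\<close>; it suffices to compare them on pure tensors.\<close>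

definition inherited_from ::
  "'x surface \<Rightarrow> ('x, 'f) msheaf \<Rightarrow> ('x, 'f) msheaf
    \<Rightarrow> ('x set \<Rightarrow> ('x, 'f, 'f) tensor_section \<Rightarrow> 'm)
    \<Rightarrow> ('x set \<Rightarrow> 'l \<Rightarrow> 'm)
    \<Rightarrow> ('x set \<Rightarrow> ('x, 'f, 'f) tensor_section \<Rightarrow> 'l) \<Rightarrow> bool" where
  "inherited_from X F E \<psi> j \<phi> \<longleftrightarrow>
     (\<forall>U. open_in X U \<longrightarrow> (\<forall>s\<in>carrier (sec E U). \<forall>t\<in>carrier (sec E U).
        j U (\<phi> U (pure_tensor X E E U s t)) = \<psi> U (pure_tensor X F F U s t)))"

end

theory Submission
  imports "Jordan_Normal_Form.Determinant" Defs
begin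

text \<open>Choose a frame \<open>e\<^sub>1, \<dots>, e\<^sub>2\<^sub>n\<close> of \<open>F\<close> near \<open>x\<close> whose first \<open>n\<close> members span \<open>S\<close> at \<open>x\<close>, a
  frame \<open>l\<close> of \<open>M\<close> and a local parameter \<open>\<zeta>\<close> at \<open>x\<close>.  Then \<open>e\<^sub>1, \<dots>, e\<^sub>n, \<zeta>e\<^sub>n\<^sub>+\<^sub>1, \<dots>, \<zeta>e\<^sub>2\<^sub>n\<close> is a
  frame of \<open>E\<close>, and \<open>M \<otimes> \<O>(-x)\<close> is the subsheaf of sections of \<open>M\<close> vanishing at \<open>x\<close>, with frame
  \<open>\<zeta>l\<close>.  As \<open>S\<close> is isotropic, the Gram matrix of \<open>\<psi>\<close> has the blocks \<open>[\<zeta>A, B; C, D]\<close> with \<open>C\<close> the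
  transpose of \<open>B\<close>, and \<open>B\<close> is invertible at \<open>x\<close> because \<open>\<psi>\<close> is nondegenerate.  In the new frames
  \<open>\<psi>\<close> has the Gram matrix \<open>\<zeta>[A, B; C, \<zeta>D]\<close>; so it takes values in \<open>M(-x)\<close>, where it is given by
  \<open>[A, B; C, \<zeta>D]\<close>, which at \<open>x\<close> becomes \<open>[A, B; C, 0]\<close> and is invertible.  Away from \<open>x\<close>
  nothing changes.\<close>

section \<open>Holomorphic functions and local parameters\<close>

text \<open>The obstacle is that \<open>F \<otimes> F\<close> and \<open>M(-x)\<close> are
  sheafifications of presheaves of cosets of formal sums, so their sections cannot be computed with
  directly. Morphisms out of them are controlled by their values on pure tensors. Everything else is
  reduced to the numbers \<open>val y V s i\<close>, the coordinates of a section at a point: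
  equality of sections, classes in a fiber, frames and nondegeneracy become statements about complex
  numbers or holomorphic functions. One notion, \<open>modification\<close>, covers both
  \<open>E\<close> (with \<open>K = {n..<n + n}\<close>, where \<open>j\<close> is the identity) and
  \<open>M(-x)\<close> (with \<open>K = {0}\<close>, where \<open>j\<close> is multiplication out of
  the tensor). The new form is not defined by a formula in frames: it is the old form on
  \<open>E\<close>, pulled back through the injection of \<open>M(-x)\<close> into \<open>M\<close>.
  So it is global from the start, and frames serve only to test nondegeneracy. At \<open>x\<close>
  itself the factor \<zeta> cannot be divided out of an equation between numbers; it is cancelled on
  a neighbourhood, between holomorphic functions, and the result is evaluated at \<open>x\<close>
  afterwards.\<close>

locale surface_charts =
  fixes X :: "'x surface"
  assumes riemann_surface: "riemann_surface X"
begin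

abbreviation hol :: "'x set \<Rightarrow> ('x \<Rightarrow> complex) set"
  where "hol U \<equiv> carrier (structure_sheaf X U)"

lemma hol_iff: "f \<in> hol U \<longleftrightarrow> f \<in> extensional U \<and> holomorphic_function X U f"
  by (simp add: structure_sheaf_def)

lemma structure_sheaf_ops [simp]:
  "f \<otimes>\<^bsub>structure_sheaf X U\<^esub> g = (\<lambda>y\<in>U. f y * g y)"
  "f \<oplus>\<^bsub>structure_sheaf X U\<^esub> g = (\<lambda>y\<in>U. f y + g y)"
  "\<one>\<^bsub>structure_sheaf X U\<^esub> = (\<lambda>y\<in>U. 1)"
  "\<zero>\<^bsub>structure_sheaf X U\<^esub> = (\<lambda>y\<in>U. 0)"
  by (simp_all add: structure_sheaf_def)

lemma chart:
  assumes "(V, z) \<in> charts X"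
  shows "open_in X V" "open (z ` V)" "inj_on z V"
    "homeomorphic_map (subtopology (points X) V) (top_of_set (z ` V)) z"
proof -
  have "\<forall>(U, z)\<in>charts X. open_in X U \<and> open (z ` U) \<and>
      homeomorphic_map (subtopology (points X) U) (top_of_set (z ` U)) z"
    using riemann_surface unfolding riemann_surface_def by (elim conjE)
  from bspec[OF this assms]
  show o: "open_in X V" "open (z ` V)"
    and h: "homeomorphic_map (subtopology (points X) V) (top_of_set (z ` V)) z"
    by simp_all
  have "topspace (subtopology (points X) V) = V"
    using openin_subset[OF o(1)] by (simp add: Int_absorb1)
  then show "inj_on z V"
    using homeomorphic_imp_injective_map[OF h] by simp
qed

lemma chart_image_open:
  assumes "(V, z) \<in> charts X" "open_in X U" "U \<subseteq> V"
  shows "open (z ` U)"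
proof -
  have "openin (subtopology (points X) V) U"
    using assms(2,3) by (simp add: openin_open_subtopology chart(1)[OF assms(1)])
  then have "openin (top_of_set (z ` V)) (z ` U)"
    using homeomorphic_map_openness_eq[OF chart(4)[OF assms(1)], of U] by simp
  then show ?thesis
    by (rule openin_open_trans) (rule chart(2)[OF assms(1)])
qed

lemma chart_inv [simp]:
  assumes "(V, z) \<in> charts X" "y \<in> V"
  shows "inv_into V z (z y) = y"
  using assms chart(3) by (simp add: inv_into_f_f)

lemma transition_holomorphic:
  assumes "(V, z) \<in> charts X" "(W, w) \<in> charts X"
  shows "(z \<circ> inv_into W w) holomorphic_on w ` (W \<inter> V)"
proof -
  have "\<forall>(U, z)\<in>charts X. \<forall>(V, w)\<in>charts X. (w \<circ> inv_into U z) holomorphic_on z ` (U \<inter> V)"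
    using riemann_surface unfolding riemann_surface_def by (elim conjE)
  from bspec[OF this assms(2)] have "\<forall>(V, z)\<in>charts X. (z \<circ> inv_into W w) holomorphic_on w ` (W \<inter> V)"
    by simp
  from bspec[OF this assms(1)] show ?thesis by simp
qed

lemma chart_at:
  assumes "y \<in> topspace (points X)"
  obtains V z where "(V, z) \<in> charts X" "y \<in> V"
proof -
  have "(\<Union>(U, z)\<in>charts X. U) = topspace (points X)"
    using riemann_surface unfolding riemann_surface_def by (elim conjE)
  then show ?thesis using assms that by blast
qed

text \<open>Points are closed because the surface is Hausdorff. This is what allows the domain of a
  frame to be shrunk so that it avoids \<open>x\<close>.\<close>

lemma open_in_delete:
  assumes "open_in X U" shows "open_in X (U - {y})"
proof -
  have "t1_space (points X)"
    using riemann_surface unfolding riemann_surface_def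
    by (intro Hausdorff_imp_t1_space) (elim conjE)
  then show ?thesis
    using assms openin_subset[OF assms] by (cases "y \<in> U")
      (auto simp: t1_space_closedin_singleton intro!: openin_diff)
qed

section \<open>The ring of holomorphic functions on an open set\<close>

lemma holomorphic_functionD:
  "holomorphic_function X U f \<Longrightarrow> (V, z) \<in> charts X \<Longrightarrow>
    (f \<circ> inv_into V z) holomorphic_on z ` (U \<inter> V)"
  unfolding holomorphic_function_def by (drule (1) bspec) simp

lemma holomorphic_functionI:
  "(\<And>V z. (V, z) \<in> charts X \<Longrightarrow> (f \<circ> inv_into V z) holomorphic_on z ` (U \<inter> V)) \<Longrightarrow>
    holomorphic_function X U f"
  unfolding holomorphic_function_def by blast

lemma holomorphic_function_cong:
  assumes "\<And>y. y \<in> U \<Longrightarrow> f y = g y"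
  shows "holomorphic_function X U f \<longleftrightarrow> holomorphic_function X U g"
proof -
  have "(f \<circ> inv_into V z) holomorphic_on z ` (U \<inter> V) \<longleftrightarrow>
      (g \<circ> inv_into V z) holomorphic_on z ` (U \<inter> V)" if "(V, z) \<in> charts X" for V z
    by (rule holomorphic_cong) (use assms that in auto)
  then show ?thesis unfolding holomorphic_function_def by (intro ball_cong) auto
qed

text \<open>As a simp rule this dissolves membership in \<open>hol\<close>; proofs that want to keep
  facts in the form \<open>f \<in> hol U\<close> therefore delete it locally.\<close>

lemma restrict_hol_iff [simp]: "restrict f U \<in> hol U \<longleftrightarrow> holomorphic_function X U f"
  using holomorphic_function_cong[of U "restrict f U" f] by (simp add: hol_iff)

lemma holomorphic_function_subset:
  "holomorphic_function X U f \<Longrightarrow> V \<subseteq> U \<Longrightarrow> holomorphic_function X V f"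
  by (rule holomorphic_functionI, rule holomorphic_on_subset, erule (1) holomorphic_functionD) auto

lemma hol_holomorphic: "f \<in> hol U \<Longrightarrow> holomorphic_function X U f"
  by (simp add: hol_iff)

lemma hol_restrict [simp]: "f \<in> hol U \<Longrightarrow> V \<subseteq> U \<Longrightarrow> restrict f V \<in> hol V"
  unfolding restrict_hol_iff by (rule holomorphic_function_subset[OF hol_holomorphic])

lemma hol_ext: "f \<in> hol U \<Longrightarrow> g \<in> hol U \<Longrightarrow> (\<And>y. y \<in> U \<Longrightarrow> f y = g y) \<Longrightarrow> f = g"
  by (auto simp: hol_iff intro: extensionalityI)

lemma restrict_hol_id [simp]: "f \<in> hol U \<Longrightarrow> restrict f U = f"
  by (simp add: hol_iff extensional_restrict)

lemma holomorphic_function_const: "holomorphic_function X U (\<lambda>y. a)"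
  by (rule holomorphic_functionI) (simp add: o_def)

lemma holomorphic_function_add:
  "holomorphic_function X U f \<Longrightarrow> holomorphic_function X U g
    \<Longrightarrow> holomorphic_function X U (\<lambda>y. f y + g y)"
  by (rule holomorphic_functionI)
    (use holomorphic_on_add[OF holomorphic_functionD holomorphic_functionD] in \<open>simp add: o_def\<close>)

lemma holomorphic_function_mult:
  "holomorphic_function X U f \<Longrightarrow> holomorphic_function X U g
    \<Longrightarrow> holomorphic_function X U (\<lambda>y. f y * g y)"
  by (rule holomorphic_functionI)
    (use holomorphic_on_mult[OF holomorphic_functionD holomorphic_functionD] in \<open>simp add: o_def\<close>)

lemma holomorphic_function_sum:
  "(\<And>i. i \<in> I \<Longrightarrow> holomorphic_function X U (f i))
    \<Longrightarrow> holomorphic_function X U (\<lambda>y. \<Sum>i\<in>I. f i y)"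
  by (induction I rule: infinite_finite_induct)
    (auto intro: holomorphic_function_const holomorphic_function_add)

lemma hol_zero: "(\<lambda>y\<in>U. 0) \<in> hol U" and hol_const: "(\<lambda>y\<in>U. a) \<in> hol U"
  unfolding restrict_hol_iff by (rule holomorphic_function_const)+

lemma hol_mult: "f \<in> hol U \<Longrightarrow> g \<in> hol U \<Longrightarrow> (\<lambda>y\<in>U. f y * g y) \<in> hol U"
  and hol_add: "f \<in> hol U \<Longrightarrow> g \<in> hol U \<Longrightarrow> (\<lambda>y\<in>U. f y + g y) \<in> hol U"
  unfolding restrict_hol_iff
  by (simp_all add: holomorphic_function_mult holomorphic_function_add hol_holomorphic)

lemma hol_sum: "(\<And>i. i \<in> I \<Longrightarrow> f i \<in> hol U) \<Longrightarrow> (\<lambda>y\<in>U. \<Sum>i\<in>I. f i y) \<in> hol U"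
  unfolding restrict_hol_iff by (simp add: holomorphic_function_sum hol_holomorphic)

lemma cring_structure_sheaf: "cring (structure_sheaf X U)"
proof (rule cringI)
  show "abelian_group (structure_sheaf X U)"
  proof (rule abelian_groupI)
    fix f assume f: "f \<in> hol U"
    show "\<exists>g\<in>hol U. g \<oplus>\<^bsub>structure_sheaf X U\<^esub> f = \<zero>\<^bsub>structure_sheaf X U\<^esub>"
      by (rule bexI[OF _ hol_mult[OF hol_const[where a = "- 1"] f]])
        (simp add: restrict_def fun_eq_iff)
    show "\<zero>\<^bsub>structure_sheaf X U\<^esub> \<oplus>\<^bsub>structure_sheaf X U\<^esub> f = f"
      using hol_add[OF hol_zero f] f by (intro hol_ext[where U = U]) (simp_all del: restrict_hol_iff)
  qed (simp_all add: hol_add hol_zero del: restrict_hol_iff, auto intro!: restrict_ext)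
  show "comm_monoid (structure_sheaf X U)"
  proof (rule comm_monoidI)
    fix f assume f: "f \<in> hol U"
    show "\<one>\<^bsub>structure_sheaf X U\<^esub> \<otimes>\<^bsub>structure_sheaf X U\<^esub> f = f"
      using hol_mult[OF hol_const f] f by (intro hol_ext[where U = U]) (simp_all del: restrict_hol_iff)
  qed (simp_all add: hol_mult hol_const del: restrict_hol_iff, auto intro!: restrict_ext)
qed (simp add: algebra_simps cong: restrict_cong)

section \<open>Functions read in a chart, and local parameters\<close>

lemma hol_chart_comp:
  assumes c: "(V, z) \<in> charts X" and U: "open_in X U" "U \<subseteq> V" and H: "H holomorphic_on z ` U"
  shows "(\<lambda>y\<in>U. H (z y)) \<in> hol U"
  unfolding restrict_hol_iff
proof (rule holomorphic_functionI)
  fix W w assume w: "(W, w) \<in> charts X"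
  have "(H \<circ> (z \<circ> inv_into W w)) holomorphic_on w ` (U \<inter> W)"
  proof (rule holomorphic_on_compose_gen[OF _ H])
    show "(z \<circ> inv_into W w) holomorphic_on w ` (U \<inter> W)"
      using transition_holomorphic[OF c w] U by (rule_tac holomorphic_on_subset) auto
    show "(z \<circ> inv_into W w) ` w ` (U \<inter> W) \<subseteq> z ` U"
      using w by auto
  qed
  then show "((\<lambda>y. H (z y)) \<circ> inv_into W w) holomorphic_on w ` (U \<inter> W)"
    by (simp add: o_def)
qed

lemma hol_chart_pullback:
  assumes c: "(V, z) \<in> charts X" and U: "U \<subseteq> V" and f: "f \<in> hol U"
  shows "(f \<circ> inv_into V z) holomorphic_on z ` U"
  using holomorphic_functionD[OF hol_holomorphic[OF f] c] U by (simp add: Int_absorb2)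

text \<open>A coordinate centred at \<open>x\<close>, described by its divisibility properties
  instead of by a chart. Division and cancellation are demanded over every open subset, whether or
  not it contains \<open>x\<close>, because frames are tested on all of them. Cancellation is a
  clause of its own since \<zeta> vanishes at \<open>x\<close>, so values there do not cancel
  pointwise.\<close>

definition local_parameter :: "'x \<Rightarrow> 'x set \<Rightarrow> ('x \<Rightarrow> complex) \<Rightarrow> bool" where
  "local_parameter x U \<zeta> \<longleftrightarrow> open_in X U \<and> x \<in> U \<and> \<zeta> \<in> hol U \<and> \<zeta> x = 0 \<and>
     (\<forall>y\<in>U. \<zeta> y = 0 \<longrightarrow> y = x) \<and>
     (\<forall>V f. open_in X V \<and> V \<subseteq> U \<and> f \<in> hol V \<and> (x \<in> V \<longrightarrow> f x = 0) \<longrightarrow>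
        (\<exists>h\<in>hol V. \<forall>y\<in>V. f y = \<zeta> y * h y)) \<and>
     (\<forall>V f g. open_in X V \<and> V \<subseteq> U \<and> f \<in> hol V \<and> g \<in> hol V \<and>
        (\<forall>y\<in>V. \<zeta> y * f y = \<zeta> y * g y) \<longrightarrow> (\<forall>y\<in>V. f y = g y))"

text \<open>The parameter is a chart minus its value at \<open>x\<close>. Division is the removable
  singularity of the difference quotient; cancellation holds away from \<open>x\<close> pointwise
  and extends to \<open>x\<close> by continuity.\<close>

lemma local_parameter_exists:
  assumes "open_in X U" "x \<in> U"
  obtains W \<zeta> where "W \<subseteq> U" "local_parameter x W \<zeta>"
proof -
  have "x \<in> topspace (points X)" using assms openin_subset by blast
  then obtain C z where c: "(C, z) \<in> charts X" and x: "x \<in> C" by (rule chart_at)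
  define W where "W = U \<inter> C"
  have W: "open_in X W" "W \<subseteq> C" "x \<in> W"
    using assms c chart(1) x by (auto simp: W_def openin_Int)
  define \<zeta> where "\<zeta> = (\<lambda>y\<in>W. z y - z x)"
  have zeta_hol: "\<zeta> \<in> hol W"
    unfolding \<zeta>_def by (rule hol_chart_comp[OF c W(1,2)]) (auto intro: holomorphic_intros)
  have zeta0: "\<zeta> y = 0 \<Longrightarrow> y = x" if "y \<in> W" for y
    using that W chart(3)[OF c] by (auto simp: \<zeta>_def inj_on_def)
  have div: "\<exists>h\<in>hol V. \<forall>y\<in>V. f y = \<zeta> y * h y"
    if V: "open_in X V" "V \<subseteq> W" and f: "f \<in> hol V" and fx: "x \<in> V \<longrightarrow> f x = 0" for V f
  proof -
    define F where "F = f \<circ> inv_into C z"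
    have F: "F holomorphic_on z ` V"
      unfolding F_def using hol_chart_pullback[OF c _ f] V W by auto
    have op: "open (z ` V)" using chart_image_open[OF c V(1)] V W by auto
    have VC: "V \<subseteq> C" using V W by blast
    have Fz: "F (z y) = f y" if "y \<in> V" for y
      using that VC c by (simp add: F_def subsetD)
    have inj: "z y = z x \<Longrightarrow> y = x" if "y \<in> V" for y
      using that VC x chart(3)[OF c] by (auto simp: inj_on_def)
    \<comment> \<open>The difference quotient at \<open>z x\<close>, with the derivative as its
      value at the centre; \<open>pole_lemma\<close> says that it is holomorphic.\<close>
    define H where "H p = (if p = z x then deriv F (z x) else (F p - F (z x)) / (p - z x))" for p
    define H' where "H' = (if x \<in> V then H else (\<lambda>p. F p / (p - z x)))"
    have "H' holomorphic_on z ` V"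
    proof (cases "x \<in> V")
      case True
      have "H holomorphic_on z ` V"
        unfolding H_def by (rule pole_lemma[OF F]) (use op True in \<open>auto simp: interior_open\<close>)
      then show ?thesis using True by (simp add: H'_def)
    next
      case False
      then have "z y \<noteq> z x" if "y \<in> V" for y using inj that by blast
      then have "(\<lambda>p. F p / (p - z x)) holomorphic_on z ` V"
        by (intro holomorphic_intros F) auto
      then show ?thesis using False by (simp add: H'_def)
    qed
    then have "(\<lambda>y\<in>V. H' (z y)) \<in> hol V"
      by (rule hol_chart_comp[OF c V(1) VC])
    moreover have "f y = \<zeta> y * (\<lambda>y\<in>V. H' (z y)) y" if y: "y \<in> V" for y
      using y fx Fz[OF y] Fz[of x] inj[OF y] V
      by (cases "y = x") (auto simp: H'_def H_def \<zeta>_def subset_iff)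
    ultimately show ?thesis by blast
  qed
  have canc: "f y = g y"
    if V: "open_in X V" "V \<subseteq> W" and f: "f \<in> hol V" and g: "g \<in> hol V"
      and eq: "\<forall>y\<in>V. \<zeta> y * f y = \<zeta> y * g y" and y: "y \<in> V" for V f g y
  proof (cases "y = x")
    case False
    then show ?thesis using eq y zeta0[of y] V by auto
  next
    case True
    have VC: "V \<subseteq> C" using V W by blast
    have op: "open (z ` V)" using chart_image_open[OF c V(1)] VC by auto
    \<comment> \<open>\<open>D\<close> is continuous at \<open>z x\<close> and zero on a punctured
      neighbourhood, where \<zeta> is nonzero and cancels. Its limit is therefore both
      \<open>D (z x)\<close> and 0.\<close>
    define D where "D = (\<lambda>p. (f \<circ> inv_into C z) p - (g \<circ> inv_into C z) p)"
    have "D holomorphic_on z ` V"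
      unfolding D_def by (intro holomorphic_on_diff hol_chart_pullback[OF c VC] f g)
    then have "isCont D (z x)"
      using op y True continuous_on_eq_continuous_at holomorphic_on_imp_continuous_on by blast
    then have lim: "D \<midarrow>z x\<rightarrow> D (z x)" by (simp add: isCont_def)
    have "\<forall>\<^sub>F p in at (z x). p \<in> z ` V - {z x}"
      using op y True by (intro eventually_at_in_open) auto
    then have "\<forall>\<^sub>F p in at (z x). D p = 0"
    proof (rule eventually_mono)
      fix p assume "p \<in> z ` V - {z x}"
      then obtain v where v: "v \<in> V" "p = z v" "v \<noteq> x" by blast
      then have "\<zeta> v \<noteq> 0" using zeta0[of v] V by auto
      then have "f v = g v" using eq v by auto
      then show "D p = 0" using v VC c by (simp add: D_def subset_iff)
    qed
    then have "D \<midarrow>z x\<rightarrow> 0" by (simp add: tendsto_eventually)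
    with lim have "D (z x) = 0" using LIM_unique by blast
    then show ?thesis using True y c x by (simp add: D_def)
  qed
  have "local_parameter x W \<zeta>"
    unfolding local_parameter_def
  proof (intro conjI)
    show "\<zeta> x = 0" using W by (simp add: \<zeta>_def)
    show "\<forall>y\<in>W. \<zeta> y = 0 \<longrightarrow> y = x" using zeta0 by blast
    show "\<forall>V f. open_in X V \<and> V \<subseteq> W \<and> f \<in> hol V \<and> (x \<in> V \<longrightarrow> f x = 0) \<longrightarrow>
        (\<exists>h\<in>hol V. \<forall>y\<in>V. f y = \<zeta> y * h y)"
      by (intro allI impI, elim conjE) (rule div)
    show "\<forall>V f g. open_in X V \<and> V \<subseteq> W \<and> f \<in> hol V \<and> g \<in> hol V \<and>
        (\<forall>y\<in>V. \<zeta> y * f y = \<zeta> y * g y) \<longrightarrow> (\<forall>y\<in>V. f y = g y)"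
      by (intro allI impI ballI, elim conjE) (rule canc)
  qed (fact W zeta_hol)+
  then show ?thesis by (rule that[of W, rotated]) (simp add: W_def)
qed

lemma local_parameterD:
  assumes "local_parameter x W \<zeta>"
  shows "open_in X W" "x \<in> W" "\<zeta> \<in> hol W" "\<zeta> x = 0"
  by (rule assms[unfolded local_parameter_def, THEN conjunct1]
      assms[unfolded local_parameter_def, THEN conjunct2, THEN conjunct1]
      assms[unfolded local_parameter_def, THEN conjunct2, THEN conjunct2, THEN conjunct1]
      assms[unfolded local_parameter_def, THEN conjunct2, THEN conjunct2, THEN conjunct2, THEN conjunct1])+

lemma local_parameter_divides:
  assumes "local_parameter x W \<zeta>" "open_in X V" "V \<subseteq> W" "f \<in> hol V" "x \<in> V \<longrightarrow> f x = 0"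
  shows "\<exists>h\<in>hol V. \<forall>y\<in>V. f y = \<zeta> y * h y"
proof -
  have "\<forall>V f. open_in X V \<and> V \<subseteq> W \<and> f \<in> hol V \<and> (x \<in> V \<longrightarrow> f x = 0) \<longrightarrow>
        (\<exists>h\<in>hol V. \<forall>y\<in>V. f y = \<zeta> y * h y)"
    using assms(1) unfolding local_parameter_def by (elim conjE)
  from this[THEN spec, THEN spec, THEN mp, OF conjI[OF assms(2) conjI[OF assms(3) conjI[OF assms(4,5)]]]]
  show ?thesis .
qed

lemma local_parameter_cancels:
  assumes "local_parameter x W \<zeta>" "open_in X V" "V \<subseteq> W" "f \<in> hol V" "g \<in> hol V"
    "\<forall>y\<in>V. \<zeta> y * f y = \<zeta> y * g y"
  shows "\<forall>y\<in>V. f y = g y"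
proof -
  have "\<forall>V f g. open_in X V \<and> V \<subseteq> W \<and> f \<in> hol V \<and> g \<in> hol V \<and>
        (\<forall>y\<in>V. \<zeta> y * f y = \<zeta> y * g y) \<longrightarrow> (\<forall>y\<in>V. f y = g y)"
    using assms(1) unfolding local_parameter_def by (elim conjE)
  from this[THEN spec, THEN spec, THEN spec, THEN mp,
      OF conjI[OF assms(2) conjI[OF assms(3) conjI[OF assms(4) conjI[OF assms(5,6)]]]]]
  show ?thesis .
qed

end

section \<open>Tensor products of modules\<close>

text \<open>The effect of \<open>f \<otimes> g\<close> on formal sums. Scalar multiplication and
  restriction of tensors are both of this shape on representatives.\<close>

abbreviation frag_map :: "('a \<Rightarrow> 'c) \<Rightarrow> ('b \<Rightarrow> 'd) \<Rightarrow> (('a \<times> 'b) \<Rightarrow>\<^sub>0 int) \<Rightarrow> (('c \<times> 'd) \<Rightarrow>\<^sub>0 int)"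
  where "frag_map f g \<equiv> frag_extend (\<lambda>(m, n). frag_of (f m, g n))"

lemma frag_map_keys:
  assumes "Poly_Mapping.keys c \<subseteq> A \<times> B" "f \<in> A \<rightarrow> A'" "g \<in> B \<rightarrow> B'"
  shows "Poly_Mapping.keys (frag_map f g c) \<subseteq> A' \<times> B'"
proof -
  have "Poly_Mapping.keys (frag_map f g c) \<subseteq> (\<Union>p\<in>Poly_Mapping.keys c. Poly_Mapping.keys (case p of (m, n) \<Rightarrow> frag_of (f m, g n)))"
    by (rule keys_frag_extend)
  also have "\<dots> \<subseteq> A' \<times> B'"
  proof (rule UN_least)
    fix p assume "p \<in> Poly_Mapping.keys c"
    then have "p \<in> A \<times> B" using assms(1) by (rule_tac subsetD)
    then show "Poly_Mapping.keys (case p of (m, n) \<Rightarrow> frag_of (f m, g n)) \<subseteq> A' \<times> B'"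
      using assms(2,3) by (cases p) (simp add: Pi_iff)
  qed
  finally show ?thesis .
qed

locale tensor_pair = M: Module.module R M + N: Module.module R N
  for R :: "('a, 'r) ring_scheme" and M :: "('a, 'm, 'u) module_scheme"
    and N :: "('a, 'n, 'v) module_scheme"
begin

abbreviation "formal \<equiv> {c. Poly_Mapping.keys c \<subseteq> carrier M \<times> carrier N}"
abbreviation "relations \<equiv> tensor_relations R M N"
abbreviation "cls \<equiv> tensor_class R M N"
abbreviation "T \<equiv> tensor_module R M N"
abbreviation "pure m n \<equiv> cls (frag_of (m, n))"

lemma carrier_formal: "carrier (formal_tensors M N) = formal"
  by auto

lemma formal_diff: "c \<in> formal \<Longrightarrow> d \<in> formal \<Longrightarrow> c - d \<in> formal"
  using keys_diff[of c d] by blast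

lemma formal_add: "c \<in> formal \<Longrightarrow> d \<in> formal \<Longrightarrow> c + d \<in> formal"
  using Poly_Mapping.keys_add[of c d] by blast

lemma formal_zero: "0 \<in> formal" by simp

lemma formal_of: "m \<in> carrier M \<Longrightarrow> n \<in> carrier N \<Longrightarrow> frag_of (m, n) \<in> formal"
  by simp

lemma relations_subgroup: "subgroup relations (formal_tensors M N)"
  unfolding tensor_relations_def
proof (rule group.generate_is_subgroup[OF group_free_Abelian_group], unfold carrier_formal, intro Un_least subsetI)
qed (elim CollectE exE conjE, hypsubst, intro formal_diff formal_of M.M.a_closed N.M.a_closed
    M.smult_closed N.smult_closed, assumption+)+

lemma relations_formal: "r \<in> relations \<Longrightarrow> r \<in> formal"
  using subgroup.subset[OF relations_subgroup] unfolding carrier_formal by (rule subsetD)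

lemma relations_zero: "0 \<in> relations"
  using subgroup.one_closed[OF relations_subgroup] by simp

lemma relations_add: "r \<in> relations \<Longrightarrow> s \<in> relations \<Longrightarrow> r + s \<in> relations"
  using subgroup.m_closed[OF relations_subgroup, of r s] by simp

lemma relations_minus: "r \<in> relations \<Longrightarrow> - r \<in> relations"
  using subgroup.m_inv_closed[OF relations_subgroup, of r] relations_formal[of r] by simp

lemma relations_diff: "r \<in> relations \<Longrightarrow> s \<in> relations \<Longrightarrow> r - s \<in> relations"
  using relations_add[OF _ relations_minus, of r s] by simp

lemma relations_intros:
  "m \<in> carrier M \<Longrightarrow> m' \<in> carrier M \<Longrightarrow> n \<in> carrier N
    \<Longrightarrow> frag_of (m \<oplus>\<^bsub>M\<^esub> m', n) - frag_of (m, n) - frag_of (m', n) \<in> relations"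
  "m \<in> carrier M \<Longrightarrow> n \<in> carrier N \<Longrightarrow> n' \<in> carrier N
    \<Longrightarrow> frag_of (m, n \<oplus>\<^bsub>N\<^esub> n') - frag_of (m, n) - frag_of (m, n') \<in> relations"
  "a \<in> carrier R \<Longrightarrow> m \<in> carrier M \<Longrightarrow> n \<in> carrier N
    \<Longrightarrow> frag_of (a \<odot>\<^bsub>M\<^esub> m, n) - frag_of (m, a \<odot>\<^bsub>N\<^esub> n) \<in> relations"
  unfolding tensor_relations_def by (rule generate.incl, blast)+

text \<open>Rewrites the induction for \<open>generate\<close> from multiplicative group notation
  into sums and negatives of formal sums, with one case for each kind of bilinearity
  relation.\<close>

lemma relations_induct [consumes 1, case_names zero left right scalar add minus]:
  assumes "r \<in> relations"
    and "P 0"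
    and "\<And>m m' n. m \<in> carrier M \<Longrightarrow> m' \<in> carrier M \<Longrightarrow> n \<in> carrier N
      \<Longrightarrow> P (frag_of (m \<oplus>\<^bsub>M\<^esub> m', n) - frag_of (m, n) - frag_of (m', n))"
    and "\<And>m n n'. m \<in> carrier M \<Longrightarrow> n \<in> carrier N \<Longrightarrow> n' \<in> carrier N
      \<Longrightarrow> P (frag_of (m, n \<oplus>\<^bsub>N\<^esub> n') - frag_of (m, n) - frag_of (m, n'))"
    and "\<And>a m n. a \<in> carrier R \<Longrightarrow> m \<in> carrier M \<Longrightarrow> n \<in> carrier N
      \<Longrightarrow> P (frag_of (a \<odot>\<^bsub>M\<^esub> m, n) - frag_of (m, a \<odot>\<^bsub>N\<^esub> n))"
    and add: "\<And>r s. r \<in> relations \<Longrightarrow> s \<in> relations \<Longrightarrow> P r \<Longrightarrow> P s \<Longrightarrow> P (r + s)"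
    and minus: "\<And>r. r \<in> relations \<Longrightarrow> P r \<Longrightarrow> P (- r)"
  shows "P r"
proof -
  let ?G = "{frag_of (m \<oplus>\<^bsub>M\<^esub> m', n) - frag_of (m, n) - frag_of (m', n) | m m' n.
         m \<in> carrier M \<and> m' \<in> carrier M \<and> n \<in> carrier N} \<union>
      {frag_of (m, n \<oplus>\<^bsub>N\<^esub> n') - frag_of (m, n) - frag_of (m, n') | m n n'.
         m \<in> carrier M \<and> n \<in> carrier N \<and> n' \<in> carrier N} \<union>
      {frag_of (a \<odot>\<^bsub>M\<^esub> m, n) - frag_of (m, a \<odot>\<^bsub>N\<^esub> n) | a m n.
         a \<in> carrier R \<and> m \<in> carrier M \<and> n \<in> carrier N}"
  have gen: "h \<in> ?G \<Longrightarrow> P h" for h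
    by (elim UnE CollectE exE conjE; hypsubst; (rule assms(3) | rule assms(4) | rule assms(5)); assumption)
  have "r \<in> generate (formal_tensors M N) ?G"
    using assms(1) unfolding tensor_relations_def .
  then have "r \<in> relations \<and> P r"
  proof induction
    case one
    then show ?case using assms(2) relations_zero by simp
  next
    case (incl h)
    then show ?case using gen generate.incl[OF incl] unfolding tensor_relations_def by simp
  next
    case (inv h)
    then have "h \<in> relations" using generate.incl[OF inv] unfolding tensor_relations_def by simp
    then show ?case using minus[of h] gen[OF inv] relations_minus relations_formal[of h] by simp
  next
    case (eng h1 h2)
    then show ?case using add[of h1 h2] relations_add by simp
  qed
  then show ?thesis by simp
qed

lemma cls_eq: "cls c = {r + c | r. r \<in> relations}"
  unfolding tensor_class_def r_coset_def by auto

lemma cls_self: "c \<in> cls c"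
  unfolding cls_eq using relations_zero by (intro CollectI exI[of _ 0]) simp

lemma cls_eq_iff: "cls c = cls d \<longleftrightarrow> c - d \<in> relations"
proof
  assume "cls c = cls d"
  then have "c \<in> cls d" using cls_self[of c] by simp
  then show "c - d \<in> relations" unfolding cls_eq by auto
next
  assume cd: "c - d \<in> relations"
  show "cls c = cls d"
  proof (intro equalityI subsetI)
    fix x assume "x \<in> cls c"
    then obtain r where r: "r \<in> relations" "x = r + c" unfolding cls_eq by auto
    then have "x = (r + (c - d)) + d" by simp
    then show "x \<in> cls d" using relations_add[OF r(1) cd] unfolding cls_eq by blast
  next
    fix x assume "x \<in> cls d"
    then obtain r where r: "r \<in> relations" "x = r + d" unfolding cls_eq by auto
    then have "x = (r - (c - d)) + c" by simp
    then show "x \<in> cls c" using relations_diff[OF r(1) cd] unfolding cls_eq by blast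
  qed
qed

lemma T_carrier: "carrier T = cls ` formal"
  unfolding tensor_module_def make_module_def tensor_class_def RCOSETS_def
  by (simp add: carrier_formal[simplified]) blast

lemma T_carrierE:
  assumes "C \<in> carrier T"
  obtains c where "c \<in> formal" "C = cls c"
  using assms unfolding T_carrier by (elim imageE)

lemma T_zero: "\<zero>\<^bsub>T\<^esub> = cls 0"
  unfolding tensor_module_def make_module_def cls_eq by simp

lemma T_add: "cls c \<oplus>\<^bsub>T\<^esub> cls d = cls (c + d)"
proof -
  have "cls c \<oplus>\<^bsub>T\<^esub> cls d = {x + y | x y. x \<in> cls c \<and> y \<in> cls d}"
    unfolding tensor_module_def make_module_def set_mult_def by auto
  also have "\<dots> = cls (c + d)"
  proof (intro equalityI subsetI)
    fix z assume "z \<in> {x + y | x y. x \<in> cls c \<and> y \<in> cls d}"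
    then obtain r s where "r \<in> relations" "s \<in> relations" "z = (r + c) + (s + d)"
      unfolding cls_eq by auto
    then have "z = (r + s) + (c + d)" "r + s \<in> relations" by (auto intro: relations_add)
    then show "z \<in> cls (c + d)" unfolding cls_eq by blast
  next
    fix z assume "z \<in> cls (c + d)"
    then obtain r where r: "r \<in> relations" "z = r + (c + d)" unfolding cls_eq by auto
    have "r + c \<in> cls c" using r(1) unfolding cls_eq by blast
    moreover have "z = (r + c) + d" using r by simp
    ultimately show "z \<in> {x + y | x y. x \<in> cls c \<and> y \<in> cls d}" using cls_self[of d] by blast
  qed
  finally show ?thesis .
qed

lemma pure_carrier: "m \<in> carrier M \<Longrightarrow> n \<in> carrier N \<Longrightarrow> pure m n \<in> carrier T"
  unfolding T_carrier by (rule imageI) (rule formal_of)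

text \<open>The closure step is a difference, not a sum, because a free abelian group is generated
  from its basis by differences in \<open>frag_induction\<close>.\<close>

lemma T_induct [consumes 1, case_names zero pure diff]:
  assumes "C \<in> carrier T" and "P (cls 0)"
    and "\<And>m n. m \<in> carrier M \<Longrightarrow> n \<in> carrier N \<Longrightarrow> P (pure m n)"
    and "\<And>c d. c \<in> formal \<Longrightarrow> d \<in> formal \<Longrightarrow> P (cls c) \<Longrightarrow> P (cls d) \<Longrightarrow> P (cls (c - d))"
  shows "P C"
proof -
  obtain c where c: "c \<in> formal" "C = cls c" using assms(1) by (elim T_carrierE)
  from c(1) have "Poly_Mapping.keys c \<subseteq> carrier M \<times> carrier N" by simp
  then have "c \<in> formal \<and> P (cls c)"
  proof (induction c rule: frag_induction)
    case (one x) then show ?case using assms(3) by (cases x) simp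
  next
    case (diff a b)
    then show ?case using assms(4)[of a b] formal_diff[of a b] by blast
  qed (use assms(2) in simp)
  then show ?thesis using c by simp
qed

lemma pure_add_left: "m \<in> carrier M \<Longrightarrow> m' \<in> carrier M \<Longrightarrow> n \<in> carrier N
    \<Longrightarrow> pure (m \<oplus>\<^bsub>M\<^esub> m') n = pure m n \<oplus>\<^bsub>T\<^esub> pure m' n"
  unfolding T_add cls_eq_iff using relations_intros(1)[of m m' n] by (simp add: diff_diff_eq)

lemma pure_add_right: "m \<in> carrier M \<Longrightarrow> n \<in> carrier N \<Longrightarrow> n' \<in> carrier N
    \<Longrightarrow> pure m (n \<oplus>\<^bsub>N\<^esub> n') = pure m n \<oplus>\<^bsub>T\<^esub> pure m n'"
  unfolding T_add cls_eq_iff using relations_intros(2)[of m n n'] by (simp add: diff_diff_eq)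

lemma pure_smult_swap: "a \<in> carrier R \<Longrightarrow> m \<in> carrier M \<Longrightarrow> n \<in> carrier N
    \<Longrightarrow> pure (a \<odot>\<^bsub>M\<^esub> m) n = pure m (a \<odot>\<^bsub>N\<^esub> n)"
  unfolding cls_eq_iff by (rule relations_intros(3))

end

text \<open>Operations on tensor classes are defined as unions over all representatives; once
  relations go to relations, all representatives give one class and the union collapses. The
  hypothesis \<open>balanced\<close> is stated as membership in the relations because it must serve
  two cases: multiplication by a fixed scalar, and restriction, where the ring changes from
  \<open>R\<close> to \<open>R'\<close>.\<close>

lemma tensor_map_class:
  assumes "tensor_pair R M N" "tensor_pair R' M' N'"
    and f: "f \<in> carrier M \<rightarrow> carrier M'" and g: "g \<in> carrier N \<rightarrow> carrier N'"
    and f_add: "\<And>m m'. m \<in> carrier M \<Longrightarrow> m' \<in> carrier M \<Longrightarrow> f (m \<oplus>\<^bsub>M\<^esub> m') = f m \<oplus>\<^bsub>M'\<^esub> f m'"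
    and g_add: "\<And>n n'. n \<in> carrier N \<Longrightarrow> n' \<in> carrier N \<Longrightarrow> g (n \<oplus>\<^bsub>N\<^esub> n') = g n \<oplus>\<^bsub>N'\<^esub> g n'"
    and balanced: "\<And>a m n. a \<in> carrier R \<Longrightarrow> m \<in> carrier M \<Longrightarrow> n \<in> carrier N \<Longrightarrow>
      frag_of (f (a \<odot>\<^bsub>M\<^esub> m), g n) - frag_of (f m, g (a \<odot>\<^bsub>N\<^esub> n)) \<in> tensor_relations R' M' N'"
  shows "(\<Union>d\<in>tensor_class R M N c. tensor_class R' M' N' (frag_map f g d))
    = tensor_class R' M' N' (frag_map f g c)"
proof -
  interpret T: tensor_pair R M N by fact
  interpret T': tensor_pair R' M' N' by fact
  have rel: "frag_map f g r \<in> T'.relations" if "r \<in> T.relations" for r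
    using that
  proof (induction rule: T.relations_induct)
    case (left m m' n)
    then show ?case using f g T'.relations_intros(1)[of "f m" "f m'" "g n"]
      by (simp add: frag_extend_diff f_add Pi_iff)
  next
    case (right m n n')
    then show ?case using f g T'.relations_intros(2)[of "f m" "g n" "g n'"]
      by (simp add: frag_extend_diff g_add Pi_iff)
  next
    case (scalar a m n)
    then show ?case using balanced by (simp add: frag_extend_diff)
  next
    case (add r s)
    then show ?case by (simp add: frag_extend_add T'.relations_add)
  next
    case (minus r)
    then show ?case by (simp add: frag_extend_minus T'.relations_minus)
  qed (simp add: T'.relations_zero)
  have "T'.cls (frag_map f g d) = T'.cls (frag_map f g c)" if "d \<in> T.cls c" for d
  proof -
    obtain r where r: "r \<in> T.relations" "d = r + c" using \<open>d \<in> T.cls c\<close> unfolding T.cls_eq by blast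
    then show ?thesis unfolding T'.cls_eq_iff by (simp add: frag_extend_add rel)
  qed
  then show ?thesis using T.cls_self[of c] by blast
qed

section \<open>Module structure and universal property of the tensor product\<close>

context tensor_pair begin

lemma tensor_pair: "tensor_pair R M N" by (rule tensor_pair_axioms)

lemma T_smult:
  assumes "a \<in> carrier R"
  shows "a \<odot>\<^bsub>T\<^esub> cls c = cls (frag_map (\<lambda>m. a \<odot>\<^bsub>M\<^esub> m) (\<lambda>n. n) c)"
proof -
  have "a \<odot>\<^bsub>T\<^esub> cls c = (\<Union>d\<in>cls c. cls (frag_map (\<lambda>m. a \<odot>\<^bsub>M\<^esub> m) (\<lambda>n. n) d))"
    unfolding tensor_module_def make_module_def by simp
  also have "\<dots> = cls (frag_map (\<lambda>m. a \<odot>\<^bsub>M\<^esub> m) (\<lambda>n. n) c)"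
  proof (rule tensor_map_class[OF tensor_pair tensor_pair])
    fix b m n assume b: "b \<in> carrier R" "m \<in> carrier M" "n \<in> carrier N"
    have "a \<odot>\<^bsub>M\<^esub> (b \<odot>\<^bsub>M\<^esub> m) = b \<odot>\<^bsub>M\<^esub> (a \<odot>\<^bsub>M\<^esub> m)"
      using b assms M.smult_assoc1[symmetric] M.R.m_comm by simp
    then show "frag_of (a \<odot>\<^bsub>M\<^esub> (b \<odot>\<^bsub>M\<^esub> m), n) - frag_of (a \<odot>\<^bsub>M\<^esub> m, b \<odot>\<^bsub>N\<^esub> n) \<in> relations"
      using b assms relations_intros(3)[of b "a \<odot>\<^bsub>M\<^esub> m" n] by simp
  qed (use assms M.smult_r_distr in auto)
  finally show ?thesis .
qed

lemma pure_smult: "a \<in> carrier R \<Longrightarrow> a \<odot>\<^bsub>T\<^esub> pure m n = pure (a \<odot>\<^bsub>M\<^esub> m) n"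
  by (simp add: T_smult)

lemma smult_formal: "a \<in> carrier R \<Longrightarrow> c \<in> formal \<Longrightarrow> frag_map (\<lambda>m. a \<odot>\<^bsub>M\<^esub> m) (\<lambda>n. n) c \<in> formal"
  using frag_map_keys[of c "carrier M" "carrier N" "\<lambda>m. a \<odot>\<^bsub>M\<^esub> m" "carrier M" "\<lambda>n. n" "carrier N"]
  by (simp add: Pi_iff)

lemma T_module: "Module.module R T"
proof (rule moduleI)
  show "cring R" by (rule M.is_cring)
  show "abelian_group T"
  proof (rule abelian_groupI)
    fix A assume "A \<in> carrier T"
    then obtain a where a: "a \<in> formal" "A = cls a" by (elim T_carrierE)
    have "cls (0 - a) \<in> carrier T" unfolding T_carrier
      by (rule imageI) (rule formal_diff[OF formal_zero a(1)])
    moreover have "cls (0 - a) \<oplus>\<^bsub>T\<^esub> A = \<zero>\<^bsub>T\<^esub>" using a by (simp add: T_add T_zero)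
    ultimately show "\<exists>B\<in>carrier T. B \<oplus>\<^bsub>T\<^esub> A = \<zero>\<^bsub>T\<^esub>" by blast
  qed (auto simp: T_carrier T_zero T_add add_ac intro!: imageI Poly_Mapping.keys_add[THEN subset_trans])
  fix a x assume a: "a \<in> carrier R" and x: "x \<in> carrier T"
  obtain c where c: "c \<in> formal" "x = cls c" using x by (elim T_carrierE)
  show "a \<odot>\<^bsub>T\<^esub> x \<in> carrier T"
    unfolding c(2) T_smult[OF a] T_carrier by (rule imageI) (rule smult_formal[OF a c(1)])
  show "a \<odot>\<^bsub>T\<^esub> (x \<oplus>\<^bsub>T\<^esub> y) = a \<odot>\<^bsub>T\<^esub> x \<oplus>\<^bsub>T\<^esub> a \<odot>\<^bsub>T\<^esub> y" if "y \<in> carrier T" for y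
  proof -
    obtain d where d: "y = cls d" using \<open>y \<in> carrier T\<close> by (elim T_carrierE)
    show ?thesis unfolding c(2) d T_add T_smult[OF a] by (simp add: frag_extend_add)
  qed
  fix b assume b: "b \<in> carrier R"
  have k: "Poly_Mapping.keys c \<subseteq> carrier M \<times> carrier N" using c(1) by simp
  \<comment> \<open>Among the scalar laws this is the one that fails for formal sums and holds only
    modulo the relations: on a pure tensor the difference \<open>?D\<close> is an instance of
    additivity on the left. The other laws already hold for representatives.\<close>
  have "frag_map (\<lambda>m. (a \<oplus>\<^bsub>R\<^esub> b) \<odot>\<^bsub>M\<^esub> m) (\<lambda>n. n) c - (frag_map (\<lambda>m. a \<odot>\<^bsub>M\<^esub> m) (\<lambda>n. n) c
      + frag_map (\<lambda>m. b \<odot>\<^bsub>M\<^esub> m) (\<lambda>n. n) c) \<in> relations" (is "?D c \<in> _")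
    using k
  proof (induction c rule: frag_induction)
    case (one p)
    then show ?case using a b relations_intros(1)[of "a \<odot>\<^bsub>M\<^esub> fst p" "b \<odot>\<^bsub>M\<^esub> fst p" "snd p"]
      by (auto simp: M.smult_l_distr diff_diff_eq)
  next
    case (diff c d)
    have "?D (c - d) = ?D c - ?D d" by (simp add: frag_extend_diff)
    then show ?case using relations_diff[OF diff] by simp
  qed (simp add: relations_zero)
  then show "(a \<oplus>\<^bsub>R\<^esub> b) \<odot>\<^bsub>T\<^esub> x = a \<odot>\<^bsub>T\<^esub> x \<oplus>\<^bsub>T\<^esub> b \<odot>\<^bsub>T\<^esub> x"
    unfolding c(2) T_smult[OF a] T_smult[OF b] T_smult[OF M.R.a_closed[OF a b]] T_add cls_eq_iff .
  have "frag_map (\<lambda>m. (a \<otimes>\<^bsub>R\<^esub> b) \<odot>\<^bsub>M\<^esub> m) (\<lambda>n. n) c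
      = frag_map (\<lambda>m. a \<odot>\<^bsub>M\<^esub> m) (\<lambda>n. n) (frag_map (\<lambda>m. b \<odot>\<^bsub>M\<^esub> m) (\<lambda>n. n) c)"
    using k
    by (induction c rule: frag_induction) (auto simp: frag_extend_diff a b M.smult_assoc1)
  then show "(a \<otimes>\<^bsub>R\<^esub> b) \<odot>\<^bsub>T\<^esub> x = a \<odot>\<^bsub>T\<^esub> (b \<odot>\<^bsub>T\<^esub> x)"
    unfolding c(2) T_smult[OF a] T_smult[OF b] T_smult[OF M.R.m_closed[OF a b]] by simp
next
  fix x assume "x \<in> carrier T"
  then obtain c where c: "c \<in> formal" "x = cls c" by (elim T_carrierE)
  have k: "Poly_Mapping.keys c \<subseteq> carrier M \<times> carrier N" using c(1) by simp
  have "frag_map (\<lambda>m. \<one>\<^bsub>R\<^esub> \<odot>\<^bsub>M\<^esub> m) (\<lambda>n. n) c = c"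
    using k by (induction c rule: frag_induction) (auto simp: frag_extend_diff)
  then show "\<one>\<^bsub>R\<^esub> \<odot>\<^bsub>T\<^esub> x = x"
    unfolding c(2) T_smult[OF M.R.one_closed] by simp
qed

text \<open>Additivity of \<open>h\<close> and \<open>k\<close> is enough, without linearity,
  because a scalar can be absorbed into the first factor and pure tensors generate the tensor
  product as an abelian group.\<close>

lemma T_hom_unique:
  assumes "abelian_group H" "h \<in> carrier T \<rightarrow> carrier H" "k \<in> carrier T \<rightarrow> carrier H"
    and "\<And>A B. A \<in> carrier T \<Longrightarrow> B \<in> carrier T \<Longrightarrow> h (A \<oplus>\<^bsub>T\<^esub> B) = h A \<oplus>\<^bsub>H\<^esub> h B"
    and "\<And>A B. A \<in> carrier T \<Longrightarrow> B \<in> carrier T \<Longrightarrow> k (A \<oplus>\<^bsub>T\<^esub> B) = k A \<oplus>\<^bsub>H\<^esub> k B"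
    and "\<And>m n. m \<in> carrier M \<Longrightarrow> n \<in> carrier N \<Longrightarrow> h (pure m n) = k (pure m n)"
    and "C \<in> carrier T"
  shows "h C = k C"
proof -
  interpret H: abelian_group H by fact
  interpret T: Module.module R T by (rule T_module)
  have cancel: "h A = k A" if AB: "A \<in> carrier T" "B \<in> carrier T"
    "h (A \<oplus>\<^bsub>T\<^esub> B) = k (A \<oplus>\<^bsub>T\<^esub> B)" "h B = k B" for A B
    using AB assms(4)[of A B] assms(5)[of A B] assms(2,3) H.add.right_cancel[of "h B" "h A" "k A"]
    by (simp add: Pi_iff)
  have h0: "h \<zero>\<^bsub>T\<^esub> = \<zero>\<^bsub>H\<^esub>" if "h \<in> carrier T \<rightarrow> carrier H" "h (\<zero>\<^bsub>T\<^esub> \<oplus>\<^bsub>T\<^esub> \<zero>\<^bsub>T\<^esub>) = h \<zero>\<^bsub>T\<^esub> \<oplus>\<^bsub>H\<^esub> h \<zero>\<^bsub>T\<^esub>" for h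
    using that by (metis H.add.r_cancel_one' PiE T.M.l_zero T.M.zero_closed)
  show ?thesis using assms(7)
  proof (induction rule: T_induct)
    case zero
    then show ?case
      using h0[OF assms(2) assms(4)[OF T.M.zero_closed T.M.zero_closed]]
        h0[OF assms(3) assms(5)[OF T.M.zero_closed T.M.zero_closed]] by (simp flip: T_zero)
  next
    case (diff c d)
    have m: "cls (c - d) \<in> carrier T" "cls d \<in> carrier T"
      using diff(1,2) formal_diff unfolding T_carrier by (blast intro: imageI)+
    show ?case by (rule cancel[OF m]) (use diff in \<open>simp_all add: T_add\<close>)
  qed (rule assms(6))
qed

text \<open>The universal property of the free abelian group extends \<beta> to formal sums;
  bilinearity makes the extension vanish on the relations, so its value on a coset can be read off
  from any chosen element.\<close>

lemma T_lift:
  assumes H: "Module.module R H"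
    and b: "\<And>m n. m \<in> carrier M \<Longrightarrow> n \<in> carrier N \<Longrightarrow> \<beta> m n \<in> carrier H"
    and b_left: "\<And>m m' n. m \<in> carrier M \<Longrightarrow> m' \<in> carrier M \<Longrightarrow> n \<in> carrier N
      \<Longrightarrow> \<beta> (m \<oplus>\<^bsub>M\<^esub> m') n = \<beta> m n \<oplus>\<^bsub>H\<^esub> \<beta> m' n"
    and b_right: "\<And>m n n'. m \<in> carrier M \<Longrightarrow> n \<in> carrier N \<Longrightarrow> n' \<in> carrier N
      \<Longrightarrow> \<beta> m (n \<oplus>\<^bsub>N\<^esub> n') = \<beta> m n \<oplus>\<^bsub>H\<^esub> \<beta> m n'"
    and b_smult_left: "\<And>a m n. a \<in> carrier R \<Longrightarrow> m \<in> carrier M \<Longrightarrow> n \<in> carrier N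
      \<Longrightarrow> \<beta> (a \<odot>\<^bsub>M\<^esub> m) n = a \<odot>\<^bsub>H\<^esub> \<beta> m n"
    and b_smult_right: "\<And>a m n. a \<in> carrier R \<Longrightarrow> m \<in> carrier M \<Longrightarrow> n \<in> carrier N
      \<Longrightarrow> \<beta> m (a \<odot>\<^bsub>N\<^esub> n) = a \<odot>\<^bsub>H\<^esub> \<beta> m n"
  shows "\<exists>\<eta>\<in>module_hom R T H. \<forall>m\<in>carrier M. \<forall>n\<in>carrier N. \<eta> (pure m n) = \<beta> m n"
proof -
  interpret H: Module.module R H by fact
  interpret T: Module.module R T by (rule T_module)
  have "(\<lambda>(m, n). \<beta> m n) ` (carrier M \<times> carrier N) \<subseteq> carrier (add_monoid H)"
    using b by auto
  from comm_group.free_Abelian_group_universal[OF H.a_comm_group this]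
  obtain h where h: "h \<in> hom (formal_tensors M N) (add_monoid H)"
    and h_of': "\<And>p. p \<in> carrier M \<times> carrier N \<Longrightarrow> h (frag_of p) = (case p of (m, n) \<Rightarrow> \<beta> m n)"
    by blast
  have h_closed: "h c \<in> carrier H" if "c \<in> formal" for c
    using hom_in_carrier[OF h, of c] that by simp
  have h_add: "h (c + d) = h c \<oplus>\<^bsub>H\<^esub> h d" if "c \<in> formal" "d \<in> formal" for c d
    using hom_mult[OF h, of c d] that by simp
  have h_of: "h (frag_of (m, n)) = \<beta> m n" if "m \<in> carrier M" "n \<in> carrier N" for m n
    using h_of'[of "(m, n)"] that by simp
  have h_zero: "h 0 = \<zero>\<^bsub>H\<^esub>"
    using h_add[OF formal_zero formal_zero] h_closed[OF formal_zero]
    by (metis H.M.add.r_cancel_one' add_0)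
  have h_diff: "h (c - d) = h c \<ominus>\<^bsub>H\<^esub> h d" if "c \<in> formal" "d \<in> formal" for c d
  proof -
    have "h c = h (c - d) \<oplus>\<^bsub>H\<^esub> h d"
      using h_add[OF formal_diff[OF that] that(2)] by simp
    then show ?thesis using h_closed[OF formal_diff[OF that]] h_closed[OF that(2)]
      by (simp add: H.M.minus_eq H.M.a_assoc H.M.r_neg)
  qed
  have h_rel: "h r = \<zero>\<^bsub>H\<^esub>" if "r \<in> relations" for r
    using that
  proof (induction rule: relations_induct)
    case (left m m' n)
    then show ?case
      by (simp only: h_diff h_of b_left formal_of formal_diff M.M.a_closed)
        (simp add: b H.M.minus_eq H.M.a_ac H.M.r_neg H.M.r_neg1)
  next
    case (right m n n')
    then show ?case
      by (simp only: h_diff h_of b_right formal_of formal_diff N.M.a_closed)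
        (simp add: b H.M.minus_eq H.M.a_ac H.M.r_neg H.M.r_neg1)
  next
    case (scalar a m n)
    then show ?case
      by (simp only: h_diff h_of b_smult_left b_smult_right formal_of M.smult_closed N.smult_closed)
        (simp add: b H.M.minus_eq H.M.r_neg)
  next
    case (add r s)
    then show ?case by (simp only: h_add relations_formal) simp
  next
    case (minus r)
    then show ?case using h_diff[OF formal_zero relations_formal[of r]] h_zero
      by (simp add: H.M.minus_eq)
  qed (rule h_zero)
  define \<eta> where "\<eta> C = h (SOME c. c \<in> C)" for C
  have eta: "\<eta> (cls c) = h c" if "c \<in> formal" for c
  proof -
    have "(SOME d. d \<in> cls c) \<in> cls c" by (rule someI) (rule cls_self)
    then obtain r where "r \<in> relations" "(SOME d. d \<in> cls c) = r + c" unfolding cls_eq by blast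
    then show ?thesis unfolding \<eta>_def
      using h_add[OF relations_formal[of r] that] h_rel h_closed[OF that] by simp
  qed
  have eta_closed: "\<eta> \<in> carrier T \<rightarrow> carrier H"
    unfolding T_carrier using eta h_closed by auto
  have eta_add: "\<eta> (A \<oplus>\<^bsub>T\<^esub> B) = \<eta> A \<oplus>\<^bsub>H\<^esub> \<eta> B" if A: "A \<in> carrier T" and B: "B \<in> carrier T" for A B
  proof -
    obtain c where c: "c \<in> formal" "A = cls c" by (rule T_carrierE[OF A])
    obtain d where d: "d \<in> formal" "B = cls d" by (rule T_carrierE[OF B])
    show ?thesis
      unfolding c(2) d(2) T_add eta[OF formal_add[OF c(1) d(1)]] eta[OF c(1)] eta[OF d(1)]
      by (rule h_add[OF c(1) d(1)])
  qed
  \<comment> \<open>Both sides are additive in \<open>C\<close> and agree on pure tensors, so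
    linearity is an instance of uniqueness.\<close>
  have "\<eta> (a \<odot>\<^bsub>T\<^esub> C) = a \<odot>\<^bsub>H\<^esub> \<eta> C" if a: "a \<in> carrier R" and C: "C \<in> carrier T" for a C
  proof (rule T_hom_unique[where C = C and h = "\<lambda>C. \<eta> (a \<odot>\<^bsub>T\<^esub> C)" and k = "\<lambda>C. a \<odot>\<^bsub>H\<^esub> \<eta> C",
        OF H.abelian_group_axioms _ _ _ _ _ C])
    show "\<eta> (a \<odot>\<^bsub>T\<^esub> pure m n) = a \<odot>\<^bsub>H\<^esub> \<eta> (pure m n)" if "m \<in> carrier M" "n \<in> carrier N" for m n
      using that a by (simp add: pure_smult eta h_of b_smult_left)
  qed (use a eta_closed eta_add in \<open>simp_all add: Pi_iff T.smult_r_distr H.smult_r_distr\<close>)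
  then have "\<eta> \<in> module_hom R T H"
    unfolding module_hom_def using eta_closed eta_add by simp
  moreover have "\<forall>m\<in>carrier M. \<forall>n\<in>carrier N. \<eta> (pure m n) = \<beta> m n"
    using eta h_of by simp
  ultimately show ?thesis by blast
qed

end

section \<open>Presheaves and sheafification\<close>

locale presheaf = surface_charts X for X :: "'x surface" +
  fixes P :: "('x, 'm) msheaf"
  assumes presheaf: "module_presheaf X P"
begin

lemma sec_module: "open_in X U \<Longrightarrow> Module.module (structure_sheaf X U) (sec P U)"
  by (rule presheaf[unfolded module_presheaf_def, THEN conjunct1, THEN spec, THEN mp])

lemma res_axioms:
  assumes "open_in X U" "open_in X V" "V \<subseteq> U"
  shows "res P U V \<in> carrier (sec P U) \<rightarrow> carrier (sec P V) \<and>
        (\<forall>s\<in>carrier (sec P U). \<forall>t\<in>carrier (sec P U).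
           res P U V (s \<oplus>\<^bsub>sec P U\<^esub> t) = res P U V s \<oplus>\<^bsub>sec P V\<^esub> res P U V t) \<and>
        (\<forall>f\<in>hol U. \<forall>s\<in>carrier (sec P U).
           res P U V (f \<odot>\<^bsub>sec P U\<^esub> s) = restrict f V \<odot>\<^bsub>sec P V\<^esub> res P U V s)"
  by (rule presheaf[unfolded module_presheaf_def, THEN conjunct2, THEN conjunct1, THEN spec, THEN spec, THEN mp])
    (use assms in simp)

lemma res_closed:
  assumes "open_in X U" "open_in X V" "V \<subseteq> U" "s \<in> carrier (sec P U)"
  shows "res P U V s \<in> carrier (sec P V)"
  by (rule funcset_mem[OF res_axioms[OF assms(1-3), THEN conjunct1] assms(4)])

lemma res_add:
  assumes "open_in X U" "open_in X V" "V \<subseteq> U" "s \<in> carrier (sec P U)" "t \<in> carrier (sec P U)"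
  shows "res P U V (s \<oplus>\<^bsub>sec P U\<^esub> t) = res P U V s \<oplus>\<^bsub>sec P V\<^esub> res P U V t"
  using res_axioms[OF assms(1-3)] assms(4,5) by simp

lemma res_smult:
  assumes "open_in X U" "open_in X V" "V \<subseteq> U" "f \<in> hol U" "s \<in> carrier (sec P U)"
  shows "res P U V (f \<odot>\<^bsub>sec P U\<^esub> s) = restrict f V \<odot>\<^bsub>sec P V\<^esub> res P U V s"
  using res_axioms[OF assms(1-3)] assms(4,5) by simp

lemma res_id:
  assumes "open_in X U" "s \<in> carrier (sec P U)"
  shows "res P U U s = s"
proof -
  have "\<forall>U. open_in X U \<longrightarrow> (\<forall>s\<in>carrier (sec P U). res P U U s = s)"
    using presheaf unfolding module_presheaf_def by (elim conjE)
  then show ?thesis using assms by simp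
qed

lemma res_comp:
  assumes "open_in X U" "open_in X V" "open_in X W" "W \<subseteq> V" "V \<subseteq> U" "s \<in> carrier (sec P U)"
  shows "res P V W (res P U V s) = res P U W s"
proof -
  have "\<forall>U V W. open_in X U \<and> open_in X V \<and> open_in X W \<and> W \<subseteq> V \<and> V \<subseteq> U \<longrightarrow>
        (\<forall>s\<in>carrier (sec P U). res P V W (res P U V s) = res P U W s)"
    using presheaf unfolding module_presheaf_def by (elim conjE)
  then show ?thesis using assms by simp
qed

lemma sec_zero_closed: "open_in X U \<Longrightarrow> \<zero>\<^bsub>sec P U\<^esub> \<in> carrier (sec P U)"
  and sec_add_closed: "open_in X U \<Longrightarrow> s \<in> carrier (sec P U) \<Longrightarrow> t \<in> carrier (sec P U)
    \<Longrightarrow> s \<oplus>\<^bsub>sec P U\<^esub> t \<in> carrier (sec P U)"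
  and sec_smult_closed: "open_in X U \<Longrightarrow> f \<in> hol U \<Longrightarrow> s \<in> carrier (sec P U)
    \<Longrightarrow> f \<odot>\<^bsub>sec P U\<^esub> s \<in> carrier (sec P U)"
  using abelian_monoid.zero_closed abelian_monoid.a_closed module.smult_closed
  by (metis abelian_group_def module_def sec_module)+

lemma sec_group: "open_in X U \<Longrightarrow> abelian_group (sec P U)"
  using sec_module module_def by metis

lemma sec_zero_smult:
  assumes "open_in X U" "s \<in> carrier (sec P U)"
  shows "(\<lambda>y\<in>U. 0) \<odot>\<^bsub>sec P U\<^esub> s = \<zero>\<^bsub>sec P U\<^esub>"
  using module.smult_l_null[OF sec_module[OF assms(1)] assms(2)] by simp

text \<open>The presheaf axioms speak of sums and scalar multiples only, so zero is written as zero
  times zero and linearity is applied.\<close>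

lemma res_zero:
  assumes "open_in X U" "open_in X V" "V \<subseteq> U"
  shows "res P U V \<zero>\<^bsub>sec P U\<^esub> = \<zero>\<^bsub>sec P V\<^esub>"
proof -
  note z = sec_zero_closed[OF assms(1)]
  have "res P U V \<zero>\<^bsub>sec P U\<^esub> = res P U V ((\<lambda>y\<in>U. 0) \<odot>\<^bsub>sec P U\<^esub> \<zero>\<^bsub>sec P U\<^esub>)"
    using sec_zero_smult[OF assms(1) z] by simp
  also have "\<dots> = restrict (\<lambda>y\<in>U. 0) V \<odot>\<^bsub>sec P V\<^esub> res P U V \<zero>\<^bsub>sec P U\<^esub>"
    by (rule res_smult[OF assms hol_zero z])
  also have "restrict (\<lambda>y\<in>U. 0 :: complex) V = (\<lambda>y\<in>V. 0)"
    using assms(3) by (auto simp: restrict_def fun_eq_iff)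
  also have "(\<lambda>y\<in>V. 0) \<odot>\<^bsub>sec P V\<^esub> res P U V \<zero>\<^bsub>sec P U\<^esub> = \<zero>\<^bsub>sec P V\<^esub>"
    by (rule sec_zero_smult[OF assms(2) res_closed[OF assms z]])
  finally show ?thesis .
qed

definition section_over :: "'x set \<Rightarrow> 'm \<Rightarrow> bool" where
  "section_over U s \<longleftrightarrow> open_in X U \<and> s \<in> carrier (sec P U)"

lemma section_over_res: "section_over U s \<Longrightarrow> open_in X V \<Longrightarrow> V \<subseteq> U \<Longrightarrow> section_over V (res P U V s)"
  unfolding section_over_def by (simp add: res_closed)

lemma section_over_add: "section_over U s \<Longrightarrow> section_over U t \<Longrightarrow> section_over U (s \<oplus>\<^bsub>sec P U\<^esub> t)"
  unfolding section_over_def by (simp add: sec_add_closed)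

lemma germ_self: "section_over U s \<Longrightarrow> y \<in> U \<Longrightarrow> (U, s) \<in> germ X P y U s"
  unfolding germ_def section_over_def by auto

lemma mem_germ:
  assumes "(V, t) \<in> germ X P y U s"
  obtains W where "section_over V t" "y \<in> V" "open_in X W" "y \<in> W" "W \<subseteq> U" "W \<subseteq> V"
    "res P U W s = res P V W t"
  using assms unfolding germ_def section_over_def by auto

lemma germ_subset:
  assumes s: "section_over U s" and t: "section_over V t"
    and W: "open_in X W" "y \<in> W" "W \<subseteq> U" "W \<subseteq> V" "res P U W s = res P V W t"
  shows "germ X P y V t \<subseteq> germ X P y U s"
proof (rule subrelI)
  fix V' t' assume m: "(V', t') \<in> germ X P y V t"
  obtain W' where W': "section_over V' t'" "y \<in> V'" "open_in X W'" "y \<in> W'" "W' \<subseteq> V" "W' \<subseteq> V'"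
    "res P V W' t = res P V' W' t'" by (rule mem_germ[OF m])
  let ?W = "W \<inter> W'"
  have o: "open_in X ?W" using W W' by (simp add: openin_Int)
  have U: "open_in X U" "s \<in> carrier (sec P U)" "open_in X V" "t \<in> carrier (sec P V)"
    "open_in X V'" "t' \<in> carrier (sec P V')"
    using s t W'(1) unfolding section_over_def by auto
  have "res P U ?W s = res P W ?W (res P U W s)"
    by (rule res_comp[OF U(1) W(1) o _ W(3) U(2), symmetric]) simp
  also have "\<dots> = res P V ?W t"
    unfolding W(5) by (rule res_comp[OF U(3) W(1) o _ W(4) U(4)]) simp
  also have "\<dots> = res P W' ?W (res P V W' t)"
    by (rule res_comp[OF U(3) W'(3) o _ W'(5) U(4), symmetric]) simp
  also have "\<dots> = res P V' ?W t'"
    unfolding W'(7) by (rule res_comp[OF U(5) W'(3) o _ W'(6) U(6)]) simp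
  finally have eq: "res P U ?W s = res P V' ?W t'" .
  show "(V', t') \<in> germ X P y U s"
    unfolding germ_def using U W W' o eq by blast
qed

lemma germ_eqI:
  assumes "section_over U s" "section_over V t"
    and "open_in X W" "y \<in> W" "W \<subseteq> U" "W \<subseteq> V" "res P U W s = res P V W t"
  shows "germ X P y U s = germ X P y V t"
  by (rule equalityI) (rule germ_subset[OF assms(2,1,3,4,6,5) assms(7)[symmetric]], rule germ_subset[OF assms])

lemma germ_eqD:
  assumes "germ X P y U s = germ X P y V t" "section_over V t" "y \<in> V"
  obtains W where "open_in X W" "y \<in> W" "W \<subseteq> U" "W \<subseteq> V" "res P U W s = res P V W t"
proof -
  have "(V, t) \<in> germ X P y U s" unfolding assms(1) by (rule germ_self[OF assms(2,3)])
  then show ?thesis by (rule mem_germ) (rule that)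
qed

lemma germ_res:
  assumes "section_over U s" "open_in X V" "V \<subseteq> U" "y \<in> V"
  shows "germ X P y V (res P U V s) = germ X P y U s"
proof (rule germ_eqI[of _ _ _ _ V])
  show "section_over V (res P U V s)" by (rule section_over_res[OF assms(1-3)])
  then show "res P V V (res P U V s) = res P U V s"
    using assms(2) unfolding section_over_def by (simp add: res_id)
qed (use assms in auto)

text \<open>The operations on germs are unions over all representatives; this is how
  well-definedness is used. A germ is nonempty since it contains its own representative.\<close>

lemma UN_germ_eq:
  assumes "A \<noteq> {}" "\<And>p. p \<in> A \<Longrightarrow> f p = B"
  shows "(\<Union>p\<in>A. f p) = B"
  using assms by auto

text \<open>Any representatives of the two germs agree with \<open>s\<close> and \<open>t\<close> on
  a common neighbourhood of \<open>y\<close>, hence so do the sums, and all members of the union are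
  the same germ.\<close>

lemma germ_add_germ:
  assumes s: "section_over U s" and t: "section_over U t" and y: "y \<in> U"
  shows "germ_add X P y (germ X P y U s) (germ X P y U t) = germ X P y U (s \<oplus>\<^bsub>sec P U\<^esub> t)"
proof -
  have *: "germ X P y (U1 \<inter> U2) (res P U1 (U1 \<inter> U2) s1 \<oplus>\<^bsub>sec P (U1 \<inter> U2)\<^esub> res P U2 (U1 \<inter> U2) s2)
      = germ X P y U (s \<oplus>\<^bsub>sec P U\<^esub> t)"
    if m1: "(U1, s1) \<in> germ X P y U s" and m2: "(U2, s2) \<in> germ X P y U t" for U1 s1 U2 s2
  proof -
    obtain W1 where W1: "section_over U1 s1" "y \<in> U1" "open_in X W1" "y \<in> W1" "W1 \<subseteq> U" "W1 \<subseteq> U1"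
      "res P U W1 s = res P U1 W1 s1" by (rule mem_germ[OF m1])
    obtain W2 where W2: "section_over U2 s2" "y \<in> U2" "open_in X W2" "y \<in> W2" "W2 \<subseteq> U" "W2 \<subseteq> U2"
      "res P U W2 t = res P U2 W2 s2" by (rule mem_germ[OF m2])
    note [simp] = W1(1)[unfolded section_over_def] W2(1)[unfolded section_over_def]
      s[unfolded section_over_def] t[unfolded section_over_def]
    let ?I = "U1 \<inter> U2" and ?W = "W1 \<inter> W2"
    have o: "open_in X ?I" "open_in X ?W" using W1 W2 by (simp_all add: openin_Int)
    have sub: "?W \<subseteq> ?I" "?W \<subseteq> U" "?W \<subseteq> U1" "?W \<subseteq> U2" "?W \<subseteq> W1" "?W \<subseteq> W2" using W1 W2 by auto
    have e1: "res P U ?W s = res P U1 ?W s1"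
      using res_comp[of U W1 ?W s] res_comp[of U1 W1 ?W s1] W1 o sub by simp
    have e2: "res P U ?W t = res P U2 ?W s2"
      using res_comp[of U W2 ?W t] res_comp[of U2 W2 ?W s2] W2 o sub by simp
    show ?thesis
    proof (rule germ_eqI[of _ _ _ _ ?W])
      show "section_over ?I (res P U1 ?I s1 \<oplus>\<^bsub>sec P ?I\<^esub> res P U2 ?I s2)"
        by (intro section_over_add section_over_res[OF W1(1)] section_over_res[OF W2(1)] o) auto
      show "section_over U (s \<oplus>\<^bsub>sec P U\<^esub> t)" by (rule section_over_add[OF s t])
      have "res P ?I ?W (res P U1 ?I s1 \<oplus>\<^bsub>sec P ?I\<^esub> res P U2 ?I s2)
        = res P U1 ?W s1 \<oplus>\<^bsub>sec P ?W\<^esub> res P U2 ?W s2"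
        using o sub by (simp add: res_add res_comp res_closed)
      also have "\<dots> = res P U ?W (s \<oplus>\<^bsub>sec P U\<^esub> t)"
        using o sub by (simp add: res_add flip: e1 e2)
      finally show "res P ?I ?W (res P U1 ?I s1 \<oplus>\<^bsub>sec P ?I\<^esub> res P U2 ?I s2) = res P U ?W (s \<oplus>\<^bsub>sec P U\<^esub> t)" .
    qed (use W1 W2 o sub in auto)
  qed
  show ?thesis
    unfolding germ_add_def
  proof (rule UN_germ_eq)
    show "germ X P y U s \<noteq> {}" using germ_self[OF s y] by blast
    fix p assume p: "p \<in> germ X P y U s"
    show "(case p of (U1, s1) \<Rightarrow> \<Union>(U2, s2)\<in>germ X P y U t. germ X P y (U1 \<inter> U2)
        (res P U1 (U1 \<inter> U2) s1 \<oplus>\<^bsub>sec P (U1 \<inter> U2)\<^esub> res P U2 (U1 \<inter> U2) s2))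
      = germ X P y U (s \<oplus>\<^bsub>sec P U\<^esub> t)"
    proof (cases p)
      case (Pair U1 s1)
      show ?thesis unfolding Pair case_prod_conv
      proof (rule UN_germ_eq)
        show "germ X P y U t \<noteq> {}" using germ_self[OF t y] by blast
        fix q assume q: "q \<in> germ X P y U t"
        show "(case q of (U2, s2) \<Rightarrow> germ X P y (U1 \<inter> U2)
          (res P U1 (U1 \<inter> U2) s1 \<oplus>\<^bsub>sec P (U1 \<inter> U2)\<^esub> res P U2 (U1 \<inter> U2) s2))
          = germ X P y U (s \<oplus>\<^bsub>sec P U\<^esub> t)"
          using * p q Pair by (cases q) simp
      qed
    qed
  qed
qed

lemma germ_smult_germ:
  assumes f: "f \<in> hol U" and t: "section_over V t" and y: "y \<in> V" and V: "V \<subseteq> U" and U: "open_in X U"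
  shows "germ_smult X P y U f (germ X P y V t) = germ X P y V (restrict f V \<odot>\<^bsub>sec P V\<^esub> t)"
  unfolding germ_smult_def
proof (rule UN_germ_eq)
  show "germ X P y V t \<noteq> {}" using germ_self[OF t y] by blast
  fix p assume p: "p \<in> germ X P y V t"
  obtain V1 t1 where p1: "p = (V1, t1)" by (cases p)
  obtain W where W: "section_over V1 t1" "y \<in> V1" "open_in X W" "y \<in> W" "W \<subseteq> V" "W \<subseteq> V1"
    "res P V W t = res P V1 W t1" by (rule mem_germ[OF p[unfolded p1]])
  note [simp] = W(1)[unfolded section_over_def] t[unfolded section_over_def]
  let ?I = "U \<inter> V1"
  have o: "open_in X ?I" "open_in X V" using U W by (simp_all add: openin_Int)
  have sub: "W \<subseteq> ?I" "?I \<subseteq> V1" "?I \<subseteq> U" "W \<subseteq> U" using W V by auto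
  have r: "restrict (restrict f ?I) W = restrict f W" "restrict (restrict f V) W = restrict f W"
    using W sub by (simp_all add: Int_absorb1 Int_absorb2 Int_commute)
  have h: "restrict f ?I \<in> hol ?I" "restrict f V \<in> hol V"
    using hol_restrict[OF f] V by (simp_all del: restrict_hol_iff)
  show "(case p of (V1, t1) \<Rightarrow> germ X P y (U \<inter> V1) (restrict f (U \<inter> V1) \<odot>\<^bsub>sec P (U \<inter> V1)\<^esub> res P V1 (U \<inter> V1) t1))
    = germ X P y V (restrict f V \<odot>\<^bsub>sec P V\<^esub> t)"
    unfolding p1 case_prod_conv
  proof (rule germ_eqI[of _ _ _ _ W])
    show "section_over ?I (restrict f ?I \<odot>\<^bsub>sec P ?I\<^esub> res P V1 ?I t1)"
      unfolding section_over_def using o h sub by (simp add: sec_smult_closed res_closed del: restrict_hol_iff)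
    show "section_over V (restrict f V \<odot>\<^bsub>sec P V\<^esub> t)"
      unfolding section_over_def using o h by (simp add: sec_smult_closed del: restrict_hol_iff)
    show "res P ?I W (restrict f ?I \<odot>\<^bsub>sec P ?I\<^esub> res P V1 ?I t1) = res P V W (restrict f V \<odot>\<^bsub>sec P V\<^esub> t)"
      using o h sub W r by (simp add: res_smult res_comp res_closed del: restrict_hol_iff)
  qed (use W o sub in auto)
qed

abbreviation "PP \<equiv> sheafification X P"

definition to_sheaf :: "'x set \<Rightarrow> 'm \<Rightarrow> 'x \<Rightarrow> ('x set \<times> 'm) set"
  where "to_sheaf U s = (\<lambda>y\<in>U. germ X P y U s)"

lemma PP_ops:
  "\<sigma> \<oplus>\<^bsub>sec PP U\<^esub> \<tau> = (\<lambda>y\<in>U. germ_add X P y (\<sigma> y) (\<tau> y))"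
  "\<zero>\<^bsub>sec PP U\<^esub> = to_sheaf U \<zero>\<^bsub>sec P U\<^esub>"
  "f \<odot>\<^bsub>sec PP U\<^esub> \<sigma> = (\<lambda>y\<in>U. germ_smult X P y U f (\<sigma> y))"
  "res PP U V \<sigma> = restrict \<sigma> V"
  by (simp_all add: sheafification_def make_module_def to_sheaf_def)

text \<open>The working interface to the sheafification: sections are handled through local
  representatives, and the sets of pairs that form a germ stay hidden.\<close>

definition represents :: "('x \<Rightarrow> ('x set \<times> 'm) set) \<Rightarrow> 'x set \<Rightarrow> 'm \<Rightarrow> bool" where
  "represents \<sigma> V s \<longleftrightarrow> section_over V s \<and> (\<forall>z\<in>V. \<sigma> z = germ X P z V s)"

lemma PP_carrier:
  "\<sigma> \<in> carrier (sec PP U) \<longleftrightarrow> \<sigma> \<in> extensional U \<and> (\<forall>y\<in>U. \<exists>V s. y \<in> V \<and> V \<subseteq> U \<and> represents \<sigma> V s)"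
  unfolding sheafification_def make_module_def represents_def section_over_def by (simp add: conj_ac)

lemma represents_res:
  assumes "represents \<sigma> V s" "open_in X W" "W \<subseteq> V"
  shows "represents \<sigma> W (res P V W s)"
proof -
  have s: "section_over V s" and g: "\<forall>z\<in>V. \<sigma> z = germ X P z V s"
    using assms(1) unfolding represents_def by auto
  have "\<sigma> z = germ X P z W (res P V W s)" if "z \<in> W" for z
    using germ_res[OF s assms(2,3) that] g that assms(3) by auto
  then show ?thesis unfolding represents_def using section_over_res[OF s assms(2,3)] by simp
qed

text \<open>The extra neighbourhood \<open>N\<close> permits successive shrinking, so that two
  sections, or a section and the domain of a frame, can be treated on one open set.\<close>

lemma represents_at:
  assumes "\<sigma> \<in> carrier (sec PP U)" "y \<in> U" "open_in X N" "y \<in> N"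
  obtains V s where "open_in X V" "y \<in> V" "V \<subseteq> U" "V \<subseteq> N" "represents \<sigma> V s"
proof -
  obtain V s where V: "y \<in> V" "V \<subseteq> U" "represents \<sigma> V s"
    using assms(1,2) unfolding PP_carrier by metis
  have o: "open_in X (V \<inter> N)"
    using V(3) assms(3) unfolding represents_def section_over_def by (simp add: openin_Int)
  show ?thesis
    by (rule that[of "V \<inter> N" "res P V (V \<inter> N) s"])
      (use o V assms represents_res[OF V(3) o] in auto)
qed

lemma represents_add:
  assumes "represents \<sigma> V s" "represents \<tau> V t" "V \<subseteq> U"
  shows "represents (\<sigma> \<oplus>\<^bsub>sec PP U\<^esub> \<tau>) V (s \<oplus>\<^bsub>sec P V\<^esub> t)"
proof -
  have s: "section_over V s" "section_over V t"
    and g: "\<forall>z\<in>V. \<sigma> z = germ X P z V s" "\<forall>z\<in>V. \<tau> z = germ X P z V t"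
    using assms(1,2) unfolding represents_def by auto
  have "(\<sigma> \<oplus>\<^bsub>sec PP U\<^esub> \<tau>) z = germ X P z V (s \<oplus>\<^bsub>sec P V\<^esub> t)" if z: "z \<in> V" for z
  proof -
    have "(\<sigma> \<oplus>\<^bsub>sec PP U\<^esub> \<tau>) z = germ_add X P z (\<sigma> z) (\<tau> z)"
      using z assms(3) by (auto simp: PP_ops)
    then show ?thesis using g z germ_add_germ[OF s z] by simp
  qed
  then show ?thesis unfolding represents_def using section_over_add[OF s] by simp
qed

lemma represents_smult:
  assumes "represents \<sigma> V s" "V \<subseteq> U" "open_in X U" "f \<in> hol U"
  shows "represents (f \<odot>\<^bsub>sec PP U\<^esub> \<sigma>) V (restrict f V \<odot>\<^bsub>sec P V\<^esub> s)"
proof -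
  have s: "section_over V s" and g: "\<forall>z\<in>V. \<sigma> z = germ X P z V s"
    using assms(1) unfolding represents_def by auto
  have "(f \<odot>\<^bsub>sec PP U\<^esub> \<sigma>) z = germ X P z V (restrict f V \<odot>\<^bsub>sec P V\<^esub> s)" if z: "z \<in> V" for z
  proof -
    have "(f \<odot>\<^bsub>sec PP U\<^esub> \<sigma>) z = germ_smult X P z U f (\<sigma> z)"
      using z assms(2) by (auto simp: PP_ops)
    then show ?thesis using g z germ_smult_germ[OF assms(4) s z assms(2,3)] by simp
  qed
  moreover have "section_over V (restrict f V \<odot>\<^bsub>sec P V\<^esub> s)"
    using s hol_restrict[OF assms(4,2)] unfolding section_over_def
    by (simp add: sec_smult_closed del: restrict_hol_iff)
  ultimately show ?thesis unfolding represents_def by simp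
qed

lemma to_sheaf_represents:
  assumes "section_over U s"
  shows "represents (to_sheaf U s) U s"
  using assms unfolding represents_def to_sheaf_def by simp

lemma to_sheaf_eqI:
  assumes "\<sigma> \<in> extensional U" "represents \<sigma> U s"
  shows "\<sigma> = to_sheaf U s"
  using assms unfolding represents_def to_sheaf_def by (intro extensionalityI[of _ U]) auto

lemma to_sheaf_closed:
  assumes "section_over U s"
  shows "to_sheaf U s \<in> carrier (sec PP U)"
  unfolding PP_carrier
proof (intro conjI ballI)
  show "to_sheaf U s \<in> extensional U" by (simp add: to_sheaf_def)
  show "\<exists>V t. y \<in> V \<and> V \<subseteq> U \<and> represents (to_sheaf U s) V t" if "y \<in> U" for y
    by (intro exI[of _ U] exI[of _ s]) (use that to_sheaf_represents[OF assms] in simp)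
qed

lemma PP_zero_closed: "open_in X U \<Longrightarrow> \<zero>\<^bsub>sec PP U\<^esub> \<in> carrier (sec PP U)"
  unfolding PP_ops by (rule to_sheaf_closed) (simp add: section_over_def sec_zero_closed)

lemma PP_add_closed:
  assumes "open_in X U" "\<sigma> \<in> carrier (sec PP U)" "\<tau> \<in> carrier (sec PP U)"
  shows "\<sigma> \<oplus>\<^bsub>sec PP U\<^esub> \<tau> \<in> carrier (sec PP U)"
  unfolding PP_carrier
proof (intro conjI ballI)
  show "\<sigma> \<oplus>\<^bsub>sec PP U\<^esub> \<tau> \<in> extensional U" by (simp add: PP_ops)
  fix y assume y: "y \<in> U"
  obtain V s where V: "open_in X V" "y \<in> V" "V \<subseteq> U" "represents \<sigma> V s"
    by (rule represents_at[OF assms(2) y assms(1) y])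
  obtain W t where W: "open_in X W" "y \<in> W" "W \<subseteq> V" "represents \<tau> W t"
    by (rule represents_at[OF assms(3) y V(1,2)])
  have "represents (\<sigma> \<oplus>\<^bsub>sec PP U\<^esub> \<tau>) W (res P V W s \<oplus>\<^bsub>sec P W\<^esub> t)"
    by (rule represents_add[OF represents_res[OF V(4) W(1,3)] W(4)]) (use V W in auto)
  then show "\<exists>V t. y \<in> V \<and> V \<subseteq> U \<and> represents (\<sigma> \<oplus>\<^bsub>sec PP U\<^esub> \<tau>) V t"
    using V W by (meson subset_trans)
qed

lemma PP_smult_closed:
  assumes "open_in X U" "f \<in> hol U" "\<sigma> \<in> carrier (sec PP U)"
  shows "f \<odot>\<^bsub>sec PP U\<^esub> \<sigma> \<in> carrier (sec PP U)"
  unfolding PP_carrier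
proof (intro conjI ballI)
  show "f \<odot>\<^bsub>sec PP U\<^esub> \<sigma> \<in> extensional U" by (simp add: PP_ops)
  fix y assume y: "y \<in> U"
  obtain V s where V: "open_in X V" "y \<in> V" "V \<subseteq> U" "represents \<sigma> V s"
    by (rule represents_at[OF assms(3) y assms(1) y])
  show "\<exists>V t. y \<in> V \<and> V \<subseteq> U \<and> represents (f \<odot>\<^bsub>sec PP U\<^esub> \<sigma>) V t"
    using V represents_smult[OF V(4,3) assms(1,2)] by blast
qed

lemma PP_res_closed:
  assumes "open_in X V" "V \<subseteq> U" "\<sigma> \<in> carrier (sec PP U)"
  shows "res PP U V \<sigma> \<in> carrier (sec PP V)"
  unfolding PP_carrier
proof (intro conjI ballI)
  show "res PP U V \<sigma> \<in> extensional V" by (simp add: PP_ops)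
  fix y assume y: "y \<in> V"
  then have yU: "y \<in> U" using assms(2) by auto
  obtain W s where W: "open_in X W" "y \<in> W" "W \<subseteq> V" "represents \<sigma> W s"
    by (rule represents_at[OF assms(3) yU assms(1) y])
  have "represents (res PP U V \<sigma>) W s"
    using W(3,4) unfolding represents_def by (auto simp: PP_ops)
  then show "\<exists>W t. y \<in> W \<and> W \<subseteq> V \<and> represents (res PP U V \<sigma>) W t" using W by blast
qed

lemma to_sheaf_add:
  assumes "section_over U s" "section_over U t"
  shows "to_sheaf U (s \<oplus>\<^bsub>sec P U\<^esub> t) = to_sheaf U s \<oplus>\<^bsub>sec PP U\<^esub> to_sheaf U t"
  by (rule to_sheaf_eqI[symmetric])
    (use represents_add[OF to_sheaf_represents[OF assms(1)] to_sheaf_represents[OF assms(2)]]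
      in \<open>simp_all add: PP_ops\<close>)

lemma to_sheaf_smult:
  assumes "section_over U s" "f \<in> hol U"
  shows "to_sheaf U (f \<odot>\<^bsub>sec P U\<^esub> s) = f \<odot>\<^bsub>sec PP U\<^esub> to_sheaf U s"
  by (rule to_sheaf_eqI[symmetric])
    (use represents_smult[OF to_sheaf_represents[OF assms(1)], of U f] assms
      in \<open>simp_all add: PP_ops section_over_def\<close>)

lemma to_sheaf_res:
  assumes "section_over U s" "open_in X V" "V \<subseteq> U"
  shows "to_sheaf V (res P U V s) = res PP U V (to_sheaf U s)"
proof (rule to_sheaf_eqI[symmetric])
  show "represents (res PP U V (to_sheaf U s)) V (res P U V s)"
    using represents_res[OF to_sheaf_represents[OF assms(1)] assms(2,3)]
    unfolding represents_def by (simp add: PP_ops)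
qed (simp add: PP_ops)

end

section \<open>Sheaves in pointwise form\<close>

locale sheaf = surface_charts X for X :: "'x surface" +
  fixes H :: "('x, 'm) msheaf"
  assumes sheaf: "module_sheaf X H"

sublocale sheaf \<subseteq> presheaf X H
  by unfold_locales (rule sheaf[unfolded module_sheaf_def, THEN conjunct1])

context sheaf begin

lemma sheaf_axioms_cover:
  assumes "\<forall>U\<in>\<U>. open_in X U"
  shows "(\<forall>s\<in>carrier (sec H (\<Union>\<U>)). \<forall>t\<in>carrier (sec H (\<Union>\<U>)).
           (\<forall>U\<in>\<U>. res H (\<Union>\<U>) U s = res H (\<Union>\<U>) U t) \<longrightarrow> s = t)"
    "(\<forall>\<sigma>. (\<forall>U\<in>\<U>. \<sigma> U \<in> carrier (sec H U)) \<and>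
           (\<forall>U\<in>\<U>. \<forall>V\<in>\<U>. res H U (U \<inter> V) (\<sigma> U) = res H V (U \<inter> V) (\<sigma> V)) \<longrightarrow>
           (\<exists>s\<in>carrier (sec H (\<Union>\<U>)). \<forall>U\<in>\<U>. res H (\<Union>\<U>) U s = \<sigma> U))"
  by (rule sheaf[unfolded module_sheaf_def, THEN conjunct2, THEN spec, THEN mp, OF assms, THEN conjunct1],
      rule sheaf[unfolded module_sheaf_def, THEN conjunct2, THEN spec, THEN mp, OF assms, THEN conjunct2])

text \<open>The cover fed to the sheaf axiom consists of all open subsets on which \<open>s\<close>
  and \<open>t\<close> agree; the local hypothesis says that it exhausts \<open>U\<close>.\<close>

lemma separated:
  assumes U: "open_in X U" and s: "s \<in> carrier (sec H U)" and t: "t \<in> carrier (sec H U)"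
    and local: "\<And>y. y \<in> U \<Longrightarrow> \<exists>W. open_in X W \<and> y \<in> W \<and> W \<subseteq> U \<and> res H U W s = res H U W t"
  shows "s = t"
proof -
  define \<U> where "\<U> = {W. open_in X W \<and> W \<subseteq> U \<and> res H U W s = res H U W t}"
  have un: "\<Union>\<U> = U"
  proof (intro equalityI subsetI)
    fix y assume "y \<in> U"
    from local[OF this] show "y \<in> \<Union>\<U>" unfolding \<U>_def by blast
  qed (auto simp: \<U>_def)
  have o: "\<forall>W\<in>\<U>. open_in X W" by (simp add: \<U>_def)
  show ?thesis
    using sheaf_axioms_cover(1)[OF o] s t unfolding un by (simp add: \<U>_def)
qed

lemma glue:
  assumes o: "\<forall>W\<in>\<U>. open_in X W" and un: "\<Union>\<U> = U"
    and "\<forall>W\<in>\<U>. \<sigma> W \<in> carrier (sec H W)"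
    and "\<forall>V\<in>\<U>. \<forall>W\<in>\<U>. res H V (V \<inter> W) (\<sigma> V) = res H W (V \<inter> W) (\<sigma> W)"
  shows "\<exists>s\<in>carrier (sec H U). \<forall>W\<in>\<U>. res H U W s = \<sigma> W"
  using sheaf_axioms_cover(2)[OF o] assms(3,4) unfolding un by simp

end

lemma sheaf_homI:
  assumes "\<And>U s. open_in X U \<Longrightarrow> s \<in> carrier (sec F U) \<Longrightarrow> h U s \<in> carrier (sec G U)"
    and "\<And>U s t. open_in X U \<Longrightarrow> s \<in> carrier (sec F U) \<Longrightarrow> t \<in> carrier (sec F U)
      \<Longrightarrow> h U (s \<oplus>\<^bsub>sec F U\<^esub> t) = h U s \<oplus>\<^bsub>sec G U\<^esub> h U t"
    and "\<And>U f s. open_in X U \<Longrightarrow> f \<in> carrier (structure_sheaf X U) \<Longrightarrow> s \<in> carrier (sec F U)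
      \<Longrightarrow> h U (f \<odot>\<^bsub>sec F U\<^esub> s) = f \<odot>\<^bsub>sec G U\<^esub> h U s"
    and "\<And>U V s. open_in X U \<Longrightarrow> open_in X V \<Longrightarrow> V \<subseteq> U \<Longrightarrow> s \<in> carrier (sec F U)
      \<Longrightarrow> h V (res F U V s) = res G U V (h U s)"
  shows "sheaf_hom X F G h"
  unfolding sheaf_hom_def module_hom_def using assms by simp

lemma sheaf_homD:
  assumes "sheaf_hom X F G h" "open_in X U" "s \<in> carrier (sec F U)"
  shows "h U s \<in> carrier (sec G U)"
    and "t \<in> carrier (sec F U) \<Longrightarrow> h U (s \<oplus>\<^bsub>sec F U\<^esub> t) = h U s \<oplus>\<^bsub>sec G U\<^esub> h U t"
    and "f \<in> carrier (structure_sheaf X U) \<Longrightarrow> h U (f \<odot>\<^bsub>sec F U\<^esub> s) = f \<odot>\<^bsub>sec G U\<^esub> h U s"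
    and "open_in X V \<Longrightarrow> V \<subseteq> U \<Longrightarrow> h V (res F U V s) = res G U V (h U s)"
proof -
  have h: "h U \<in> module_hom (structure_sheaf X U) (sec F U) (sec G U)"
    using assms(1,2) unfolding sheaf_hom_def by simp
  show "h U s \<in> carrier (sec G U)"
    by (rule funcset_mem[OF _ assms(3)]) (use h in \<open>simp add: module_hom_def\<close>)
  show "t \<in> carrier (sec F U) \<Longrightarrow> h U (s \<oplus>\<^bsub>sec F U\<^esub> t) = h U s \<oplus>\<^bsub>sec G U\<^esub> h U t"
    "f \<in> carrier (structure_sheaf X U) \<Longrightarrow> h U (f \<odot>\<^bsub>sec F U\<^esub> s) = f \<odot>\<^bsub>sec G U\<^esub> h U s"
    using h assms(3) by (simp_all add: module_hom_def)
  show "open_in X V \<Longrightarrow> V \<subseteq> U \<Longrightarrow> h V (res F U V s) = res G U V (h U s)"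
    using assms unfolding sheaf_hom_def by simp
qed

section \<open>Extension of a presheaf morphism to the sheafification\<close>

locale presheaf_map = surface_charts X + P: presheaf X P + H: sheaf X H
  for X :: "'x surface" and P :: "('x, 'p) msheaf" and H :: "('x, 'h) msheaf" +
  fixes \<eta> :: "'x set \<Rightarrow> 'p \<Rightarrow> 'h"
  assumes eta_hom: "sheaf_hom X P H \<eta>"
begin

lemma eta:
  assumes "P.section_over U s"
  shows "\<eta> U s \<in> carrier (sec H U)"
    and "P.section_over U t \<Longrightarrow> \<eta> U (s \<oplus>\<^bsub>sec P U\<^esub> t) = \<eta> U s \<oplus>\<^bsub>sec H U\<^esub> \<eta> U t"
    and "f \<in> hol U \<Longrightarrow> \<eta> U (f \<odot>\<^bsub>sec P U\<^esub> s) = f \<odot>\<^bsub>sec H U\<^esub> \<eta> U s"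
    and "open_in X V \<Longrightarrow> V \<subseteq> U \<Longrightarrow> \<eta> V (res P U V s) = res H U V (\<eta> U s)"
  using assms sheaf_homD[OF eta_hom, of U s] unfolding P.section_over_def by simp_all

text \<open>Equal germs give equal restrictions near each point, hence equal images near each point;
  separatedness of the target \<open>H\<close> turns this into equality on the whole overlap,
  although the presheaf \<open>P\<close> may fail to be separated.\<close>

lemma represents_agree:
  assumes "P.represents \<sigma> V s" "P.represents \<sigma> V' s'"
  shows "res H V (V \<inter> V') (\<eta> V s) = res H V' (V \<inter> V') (\<eta> V' s')"
proof -
  have s: "P.section_over V s" "P.section_over V' s'" and o: "open_in X V" "open_in X V'"
    using assms unfolding P.represents_def P.section_over_def by auto
  let ?I = "V \<inter> V'"
  have oI: "open_in X ?I" using o by (rule openin_Int)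
  show ?thesis
  proof (rule H.separated[OF oI])
    show "res H V ?I (\<eta> V s) \<in> carrier (sec H ?I)" "res H V' ?I (\<eta> V' s') \<in> carrier (sec H ?I)"
      using o oI eta(1)[OF s(1)] eta(1)[OF s(2)] by (simp_all add: H.res_closed)
    fix y assume y: "y \<in> ?I"
    have "germ X P y V s = germ X P y V' s'"
      using assms y unfolding P.represents_def by auto
    then obtain W where W: "open_in X W" "y \<in> W" "W \<subseteq> V" "W \<subseteq> V'" "res P V W s = res P V' W s'"
      by (rule P.germ_eqD[OF _ s(2)]) (use y in auto)
    have "res H ?I W (res H V ?I (\<eta> V s)) = res H V W (\<eta> V s)"
      by (rule H.res_comp[OF o(1) oI W(1)]) (use W eta(1)[OF s(1)] in auto)
    also have "\<dots> = res H V' W (\<eta> V' s')"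
      using eta(4)[OF s(1) W(1,3)] eta(4)[OF s(2) W(1,4)] W(5) by simp
    also have "\<dots> = res H ?I W (res H V' ?I (\<eta> V' s'))"
      by (rule H.res_comp[OF o(2) oI W(1), symmetric]) (use W eta(1)[OF s(2)] in auto)
    finally show "\<exists>W. open_in X W \<and> y \<in> W \<and> W \<subseteq> ?I \<and>
        res H ?I W (res H V ?I (\<eta> V s)) = res H ?I W (res H V' ?I (\<eta> V' s'))"
      using W by (intro exI[of _ W]) simp
  qed
qed

text \<open>The condition speaks of all representatives over all subsets at once, so nothing depends
  on how the local representatives were chosen.\<close>

definition lifts_to :: "'x set \<Rightarrow> ('x \<Rightarrow> ('x set \<times> 'p) set) \<Rightarrow> 'h \<Rightarrow> bool" where
  "lifts_to U \<sigma> t \<longleftrightarrow> t \<in> carrier (sec H U) \<and>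
     (\<forall>V s. V \<subseteq> U \<longrightarrow> P.represents \<sigma> V s \<longrightarrow> res H U V t = \<eta> V s)"

text \<open>The images of the local representatives agree on overlaps by
  \<open>represents_agree\<close> and are glued in \<open>H\<close>, over the family of all subsets
  on which \<sigma> has a representative.\<close>

lemma lifts_to_exists:
  assumes U: "open_in X U" and \<sigma>: "\<sigma> \<in> carrier (sec P.PP U)"
  shows "\<exists>t. lifts_to U \<sigma> t"
proof -
  define \<U> where "\<U> = {V. V \<subseteq> U \<and> (\<exists>s. P.represents \<sigma> V s)}"
  define S where "S V = (SOME s. P.represents \<sigma> V s)" for V
  have S: "P.represents \<sigma> V (S V)" if "V \<in> \<U>" for V
    using that unfolding S_def \<U>_def by (auto intro: someI)
  have o: "\<forall>V\<in>\<U>. open_in X V"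
    using S unfolding P.represents_def P.section_over_def by blast
  have un: "\<Union>\<U> = U"
  proof (intro equalityI subsetI)
    fix y assume y: "y \<in> U"
    obtain V s where "open_in X V" "y \<in> V" "V \<subseteq> U" "V \<subseteq> U" "P.represents \<sigma> V s"
      by (rule P.represents_at[OF \<sigma> y U y])
    then show "y \<in> \<Union>\<U>" unfolding \<U>_def by blast
  qed (auto simp: \<U>_def)
  have "\<exists>t\<in>carrier (sec H U). \<forall>V\<in>\<U>. res H U V t = \<eta> V (S V)"
  proof (rule H.glue[OF o un])
    show "\<forall>W\<in>\<U>. \<eta> W (S W) \<in> carrier (sec H W)"
      using S eta(1) unfolding P.represents_def by simp
    show "\<forall>V\<in>\<U>. \<forall>W\<in>\<U>. res H V (V \<inter> W) (\<eta> V (S V)) = res H W (V \<inter> W) (\<eta> W (S W))"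
      by (intro ballI represents_agree[of \<sigma>] S)
  qed
  then obtain t where t: "t \<in> carrier (sec H U)" "\<And>V. V \<in> \<U> \<Longrightarrow> res H U V t = \<eta> V (S V)" by blast
  have "res H U V t = \<eta> V s" if V: "V \<subseteq> U" "P.represents \<sigma> V s" for V s
  proof -
    have VU: "V \<in> \<U>" using V unfolding \<U>_def by blast
    have c: "P.section_over V s" "P.section_over V (S V)" and oV: "open_in X V"
      using V(2) S[OF VU] unfolding P.represents_def P.section_over_def by auto
    have "\<eta> V (S V) = \<eta> V s"
      using represents_agree[OF S[OF VU] V(2)] eta(1)[OF c(1)] eta(1)[OF c(2)] oV by (simp add: H.res_id)
    then show ?thesis using t(2)[OF VU] by simp
  qed
  then show ?thesis using t(1) unfolding lifts_to_def by blast
qed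

lemma lifts_to_unique:
  assumes U: "open_in X U" and \<sigma>: "\<sigma> \<in> carrier (sec P.PP U)"
    and t: "lifts_to U \<sigma> t"
    and t': "t' \<in> carrier (sec H U)"
    and local: "\<And>y. y \<in> U \<Longrightarrow> \<exists>N. open_in X N \<and> y \<in> N \<and>
      (\<forall>V s. open_in X V \<longrightarrow> V \<subseteq> U \<longrightarrow> V \<subseteq> N \<longrightarrow> P.represents \<sigma> V s \<longrightarrow> res H U V t' = \<eta> V s)"
  shows "t = t'"
proof (rule H.separated[OF U _ t'])
  show "t \<in> carrier (sec H U)" using t unfolding lifts_to_def by simp
  fix y assume y: "y \<in> U"
  obtain N where N: "open_in X N" "y \<in> N"
    "\<And>V s. open_in X V \<Longrightarrow> V \<subseteq> U \<Longrightarrow> V \<subseteq> N \<Longrightarrow> P.represents \<sigma> V s \<Longrightarrow> res H U V t' = \<eta> V s"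
    using local[OF y] by blast
  obtain V s where V: "open_in X V" "y \<in> V" "V \<subseteq> U" "V \<subseteq> N" "P.represents \<sigma> V s"
    by (rule P.represents_at[OF \<sigma> y N(1,2)])
  have "res H U V t = res H U V t'"
    using N(3)[OF V(1,3,4,5)] t V(3,5) unfolding lifts_to_def by simp
  then show "\<exists>W. open_in X W \<and> y \<in> W \<and> W \<subseteq> U \<and> res H U W t = res H U W t'"
    using V by blast
qed

lemma represents_unique:
  assumes "P.represents \<sigma> V s" "P.represents \<sigma> V s'"
  shows "\<eta> V s = \<eta> V s'"
proof -
  have "P.section_over V s" "P.section_over V s'" "open_in X V"
    using assms unfolding P.represents_def P.section_over_def by auto
  then show ?thesis
    using represents_agree[OF assms] eta(1)[of V s] eta(1)[of V s'] by (simp add: H.res_id)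
qed

definition lift :: "'x set \<Rightarrow> ('x \<Rightarrow> ('x set \<times> 'p) set) \<Rightarrow> 'h" where
  "lift U \<sigma> = (SOME t. lifts_to U \<sigma> t)"

lemma lift:
  assumes "open_in X U" "\<sigma> \<in> carrier (sec P.PP U)"
  shows "lifts_to U \<sigma> (lift U \<sigma>)"
  unfolding lift_def using lifts_to_exists[OF assms] by (rule someI_ex)

lemma lift_closed:
  assumes "open_in X U" "\<sigma> \<in> carrier (sec P.PP U)"
  shows "lift U \<sigma> \<in> carrier (sec H U)"
  using lift[OF assms] unfolding lifts_to_def by simp

lemma lift_local:
  assumes "open_in X U" "\<sigma> \<in> carrier (sec P.PP U)" "V \<subseteq> U" "P.represents \<sigma> V s"
  shows "res H U V (lift U \<sigma>) = \<eta> V s"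
  using lift[OF assms(1,2)] assms(3,4) unfolding lifts_to_def by simp

text \<open>One good representative near each point suffices: smaller representatives have the same
  image as its restrictions.\<close>

lemma lift_eqI:
  assumes U: "open_in X U" and \<sigma>: "\<sigma> \<in> carrier (sec P.PP U)" and t: "t \<in> carrier (sec H U)"
    and local: "\<And>y. y \<in> U \<Longrightarrow> \<exists>V s. open_in X V \<and> y \<in> V \<and> V \<subseteq> U \<and> P.represents \<sigma> V s \<and> res H U V t = \<eta> V s"
  shows "lift U \<sigma> = t"
proof (rule lifts_to_unique[OF U \<sigma> lift[OF U \<sigma>] t])
  fix y assume "y \<in> U"
  then obtain V s where V: "open_in X V" "y \<in> V" "V \<subseteq> U" "P.represents \<sigma> V s" "res H U V t = \<eta> V s"
    using local by blast
  have "res H U W t = \<eta> W s'" if W: "open_in X W" "W \<subseteq> V" "P.represents \<sigma> W s'" for W s'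
  proof -
    have s: "P.section_over V s" using V(4) unfolding P.represents_def by simp
    have "res H U W t = res H V W (res H U V t)"
      by (rule H.res_comp[OF U V(1) W(1,2) V(3) t, symmetric])
    also have "\<dots> = \<eta> W (res P V W s)" unfolding V(5) by (rule eta(4)[OF s W(1,2), symmetric])
    also have "\<dots> = \<eta> W s'" by (rule represents_unique[OF P.represents_res[OF V(4) W(1,2)] W(3)])
    finally show ?thesis .
  qed
  then show "\<exists>N. open_in X N \<and> y \<in> N \<and>
      (\<forall>V s. open_in X V \<longrightarrow> V \<subseteq> U \<longrightarrow> V \<subseteq> N \<longrightarrow> P.represents \<sigma> V s \<longrightarrow> res H U V t = \<eta> V s)"
    using V(1,2) by blast
qed

lemma lift_to_sheaf:
  assumes "P.section_over U s"
  shows "lift U (P.to_sheaf U s) = \<eta> U s"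
proof (rule lift_eqI)
  show U: "open_in X U" using assms unfolding P.section_over_def by simp
  show "P.to_sheaf U s \<in> carrier (sec P.PP U)" by (rule P.to_sheaf_closed[OF assms])
  show c: "\<eta> U s \<in> carrier (sec H U)" by (rule eta(1)[OF assms])
  show "\<exists>V t. open_in X V \<and> y \<in> V \<and> V \<subseteq> U \<and> P.represents (P.to_sheaf U s) V t \<and>
      res H U V (\<eta> U s) = \<eta> V t" if "y \<in> U" for y
    by (intro exI[of _ U] exI[of _ s])
      (use U c that P.to_sheaf_represents[OF assms] in \<open>simp add: H.res_id\<close>)
qed

text \<open>By \<open>lift_eqI\<close> each identity is checked where the sections involved have
  representatives, and there it is the corresponding property of \<eta>.\<close>

lemma lift_hom: "sheaf_hom X P.PP H lift"
proof (rule sheaf_homI)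
  fix U \<sigma> assume U: "open_in X U" and \<sigma>: "\<sigma> \<in> carrier (sec P.PP U)"
  note l = lift_closed[OF U \<sigma>]
  show "lift U \<sigma> \<in> carrier (sec H U)" by fact
  show "lift U (\<sigma> \<oplus>\<^bsub>sec P.PP U\<^esub> \<tau>) = lift U \<sigma> \<oplus>\<^bsub>sec H U\<^esub> lift U \<tau>" if \<tau>: "\<tau> \<in> carrier (sec P.PP U)" for \<tau>
  proof (rule lift_eqI[OF U P.PP_add_closed[OF U \<sigma> \<tau>] H.sec_add_closed[OF U l lift_closed[OF U \<tau>]]])
    fix y assume y: "y \<in> U"
    obtain V' s' where V': "open_in X V'" "y \<in> V'" "V' \<subseteq> U" "V' \<subseteq> U" "P.represents \<sigma> V' s'"
      by (rule P.represents_at[OF \<sigma> y U y])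
    obtain V t where V: "open_in X V" "y \<in> V" "V \<subseteq> U" "V \<subseteq> V'" "P.represents \<tau> V t"
      by (rule P.represents_at[OF \<tau> y V'(1,2)])
    define s where "s = res P V' V s'"
    have s: "P.represents \<sigma> V s" unfolding s_def by (rule P.represents_res[OF V'(5) V(1,4)])
    have c: "P.section_over V s" "P.section_over V t" using s V(5) unfolding P.represents_def by auto
    have "res H U V (lift U \<sigma> \<oplus>\<^bsub>sec H U\<^esub> lift U \<tau>) = \<eta> V s \<oplus>\<^bsub>sec H V\<^esub> \<eta> V t"
      unfolding H.res_add[OF U V(1,3) l lift_closed[OF U \<tau>]] lift_local[OF U \<sigma> V(3) s]
        lift_local[OF U \<tau> V(3,5)] by (rule refl)
    also have "\<dots> = \<eta> V (s \<oplus>\<^bsub>sec P V\<^esub> t)" by (rule eta(2)[OF c, symmetric])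
    finally show "\<exists>V s. open_in X V \<and> y \<in> V \<and> V \<subseteq> U \<and> P.represents (\<sigma> \<oplus>\<^bsub>sec P.PP U\<^esub> \<tau>) V s \<and>
        res H U V (lift U \<sigma> \<oplus>\<^bsub>sec H U\<^esub> lift U \<tau>) = \<eta> V s"
      using P.represents_add[OF s V(5,3)] V by blast
  qed
  show "lift U (f \<odot>\<^bsub>sec P.PP U\<^esub> \<sigma>) = f \<odot>\<^bsub>sec H U\<^esub> lift U \<sigma>" if f: "f \<in> hol U" for f
  proof (rule lift_eqI[OF U P.PP_smult_closed[OF U f \<sigma>] H.sec_smult_closed[OF U f l]])
    fix y assume y: "y \<in> U"
    obtain V s where V: "open_in X V" "y \<in> V" "V \<subseteq> U" "V \<subseteq> U" "P.represents \<sigma> V s"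
      by (rule P.represents_at[OF \<sigma> y U y])
    have c: "P.section_over V s" using V(5) unfolding P.represents_def by auto
    have "res H U V (f \<odot>\<^bsub>sec H U\<^esub> lift U \<sigma>) = \<eta> V (restrict f V \<odot>\<^bsub>sec P V\<^esub> s)"
      unfolding H.res_smult[OF U V(1,3) f l] lift_local[OF U \<sigma> V(3,5)]
      by (rule eta(3)[OF c hol_restrict[OF f V(3)], symmetric])
    then show "\<exists>V s. open_in X V \<and> y \<in> V \<and> V \<subseteq> U \<and> P.represents (f \<odot>\<^bsub>sec P.PP U\<^esub> \<sigma>) V s \<and>
        res H U V (f \<odot>\<^bsub>sec H U\<^esub> lift U \<sigma>) = \<eta> V s"
      using P.represents_smult[OF V(5,3) U f] V by blast
  qed
  fix V assume V: "open_in X V" "V \<subseteq> U"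
  show "lift V (res P.PP U V \<sigma>) = res H U V (lift U \<sigma>)"
  proof (rule lift_eqI[OF V(1) P.PP_res_closed[OF V \<sigma>] H.res_closed[OF U V l]])
    fix y assume y: "y \<in> V"
    then have yU: "y \<in> U" using V(2) by auto
    obtain W s where W: "open_in X W" "y \<in> W" "W \<subseteq> U" "W \<subseteq> V" "P.represents \<sigma> W s"
      by (rule P.represents_at[OF \<sigma> yU V(1) y])
    have "P.represents (res P.PP U V \<sigma>) W s"
      using W(4,5) unfolding P.represents_def by (auto simp: P.PP_ops)
    moreover have "res H V W (res H U V (lift U \<sigma>)) = \<eta> W s"
      unfolding H.res_comp[OF U V(1) W(1,4) V(2) l] by (rule lift_local[OF U \<sigma> W(3,5)])
    ultimately show "\<exists>W s. open_in X W \<and> y \<in> W \<and> W \<subseteq> V \<and> P.represents (res P.PP U V \<sigma>) W s \<and>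
        res H V W (res H U V (lift U \<sigma>)) = \<eta> W s"
      using W by blast
  qed
qed

text \<open>Sections of the sheafification are determined by their germs, so injectivity of \<eta>
  over small open sets is all that is required. For tensors with the ideal of \<open>x\<close> it is
  available only inside the domain of a frame.\<close>

lemma lift_inj:
  assumes inj: "\<And>y. y \<in> topspace (points X) \<Longrightarrow> \<exists>N. open_in X N \<and> y \<in> N \<and>
      (\<forall>V. open_in X V \<longrightarrow> V \<subseteq> N \<longrightarrow> inj_on (\<eta> V) (carrier (sec P V)))"
    and U: "open_in X U" and \<sigma>: "\<sigma> \<in> carrier (sec P.PP U)" and \<tau>: "\<tau> \<in> carrier (sec P.PP U)"
    and eq: "lift U \<sigma> = lift U \<tau>"
  shows "\<sigma> = \<tau>"
proof (rule extensionalityI[of _ U])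
  show "\<sigma> \<in> extensional U" "\<tau> \<in> extensional U" using \<sigma> \<tau> unfolding P.PP_carrier by auto
  fix y assume y: "y \<in> U"
  then have "y \<in> topspace (points X)" using openin_subset[OF U] by auto
  from inj[OF this] obtain N where N: "open_in X N" "y \<in> N"
    and inj: "\<And>V. open_in X V \<Longrightarrow> V \<subseteq> N \<Longrightarrow> inj_on (\<eta> V) (carrier (sec P V))" by blast
  obtain V' s' where V': "open_in X V'" "y \<in> V'" "V' \<subseteq> U" "V' \<subseteq> N" "P.represents \<sigma> V' s'"
    by (rule P.represents_at[OF \<sigma> y N])
  obtain V t where V: "open_in X V" "y \<in> V" "V \<subseteq> U" "V \<subseteq> V'" "P.represents \<tau> V t"
    by (rule P.represents_at[OF \<tau> y V'(1,2)])
  define s where "s = res P V' V s'"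
  have s: "P.represents \<sigma> V s" unfolding s_def by (rule P.represents_res[OF V'(5) V(1,4)])
  have c: "s \<in> carrier (sec P V)" "t \<in> carrier (sec P V)"
    using s V(5) unfolding P.represents_def P.section_over_def by auto
  have "\<eta> V s = \<eta> V t"
    using lift_local[OF U \<sigma> V(3) s] lift_local[OF U \<tau> V(3,5)] eq by simp
  then have "s = t"
    by (rule inj_onD[OF inj[OF V(1) subset_trans[OF V(4) V'(4)]] _ c])
  then show "\<sigma> y = \<tau> y" using s V(2,5) unfolding P.represents_def by simp
qed

text \<open>Local preimages of \<open>t\<close> need not agree on overlaps as chosen, but local
  injectivity forces their germs to coincide, so the germs assemble to a section.\<close>

lemma lift_surj:
  assumes inj: "\<And>y. y \<in> topspace (points X) \<Longrightarrow> \<exists>N. open_in X N \<and> y \<in> N \<and>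
      (\<forall>V. open_in X V \<longrightarrow> V \<subseteq> N \<longrightarrow> inj_on (\<eta> V) (carrier (sec P V)))"
    and U: "open_in X U" and t: "t \<in> carrier (sec H U)"
    and local: "\<And>y. y \<in> U \<Longrightarrow> \<exists>V s. y \<in> V \<and> V \<subseteq> U \<and> P.section_over V s \<and> res H U V t = \<eta> V s"
  shows "\<exists>\<sigma>\<in>carrier (sec P.PP U). lift U \<sigma> = t"
proof -
  have "\<forall>y\<in>U. \<exists>p. y \<in> fst p \<and> fst p \<subseteq> U \<and> P.section_over (fst p) (snd p) \<and> res H U (fst p) t = \<eta> (fst p) (snd p)"
    using local by simp
  then obtain p where p: "\<And>y. y \<in> U \<Longrightarrow> y \<in> fst (p y) \<and> fst (p y) \<subseteq> U \<and>
      P.section_over (fst (p y)) (snd (p y)) \<and> res H U (fst (p y)) t = \<eta> (fst (p y)) (snd (p y))"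
    by metis
  define V where "V y = fst (p y)" for y
  define s where "s y = snd (p y)" for y
  have V: "y \<in> V y" "V y \<subseteq> U" "P.section_over (V y) (s y)" "res H U (V y) t = \<eta> (V y) (s y)"
    "open_in X (V y)" if "y \<in> U" for y
    using p[OF that] unfolding V_def s_def P.section_over_def by simp_all
  \<comment> \<open>At each point the germ of the preimage chosen for that very point; that a single
    preimage represents it on all of \<open>V y\<close> is the content of
    \<open>rep\<close>.\<close>
  define \<sigma> where "\<sigma> = (\<lambda>y\<in>U. germ X P y (V y) (s y))"
  have rep: "P.represents \<sigma> (V y) (s y)" if y: "y \<in> U" for y
    unfolding P.represents_def
  proof (intro conjI ballI V(3)[OF y])
    fix z assume z: "z \<in> V y"
    then have zU: "z \<in> U" using V(2)[OF y] by auto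
    then have "z \<in> topspace (points X)" using openin_subset[OF U] by auto
    from inj[OF this] obtain N where N: "open_in X N" "z \<in> N"
      and inj: "\<And>V. open_in X V \<Longrightarrow> V \<subseteq> N \<Longrightarrow> inj_on (\<eta> V) (carrier (sec P V))" by blast
    define W where "W = N \<inter> (V y \<inter> V z)"
    have W: "open_in X W" "W \<subseteq> N" "W \<subseteq> V y" "W \<subseteq> V z" "z \<in> W"
      using N V(1,5)[OF y] V(1,5)[OF zU] z unfolding W_def by (auto intro: openin_Int)
    have "\<eta> W (res P (V y) W (s y)) = res H U W t"
      unfolding eta(4)[OF V(3)[OF y] W(1,3)] V(4)[OF y, symmetric]
      by (rule H.res_comp[OF U V(5)[OF y] W(1,3) V(2)[OF y] t])
    moreover have "\<eta> W (res P (V z) W (s z)) = res H U W t"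
      unfolding eta(4)[OF V(3)[OF zU] W(1,4)] V(4)[OF zU, symmetric]
      by (rule H.res_comp[OF U V(5)[OF zU] W(1,4) V(2)[OF zU] t])
    ultimately have "\<eta> W (res P (V y) W (s y)) = \<eta> W (res P (V z) W (s z))" by simp
    then have "res P (V y) W (s y) = res P (V z) W (s z)"
    proof (rule inj_onD[OF inj[OF W(1,2)]])
      show "res P (V y) W (s y) \<in> carrier (sec P W)" "res P (V z) W (s z) \<in> carrier (sec P W)"
        using P.section_over_res[OF V(3)[OF y] W(1,3)] P.section_over_res[OF V(3)[OF zU] W(1,4)]
        unfolding P.section_over_def by auto
    qed
    then have "germ X P z (V y) (s y) = germ X P z (V z) (s z)"
      by (rule P.germ_eqI[OF V(3)[OF y] V(3)[OF zU] W(1,5,3,4)])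
    then show "\<sigma> z = germ X P z (V y) (s y)" using zU by (simp add: \<sigma>_def)
  qed
  have \<sigma>: "\<sigma> \<in> carrier (sec P.PP U)"
    unfolding P.PP_carrier
  proof (intro conjI ballI)
    show "\<sigma> \<in> extensional U" by (simp add: \<sigma>_def)
    show "\<exists>V s. y \<in> V \<and> V \<subseteq> U \<and> P.represents \<sigma> V s" if "y \<in> U" for y
      using rep[OF that] V(1,2)[OF that] by blast
  qed
  have "lift U \<sigma> = t"
  proof (rule lift_eqI[OF U \<sigma> t])
    show "\<exists>V s. open_in X V \<and> y \<in> V \<and> V \<subseteq> U \<and> P.represents \<sigma> V s \<and> res H U V t = \<eta> V s" if "y \<in> U" for y
      using rep[OF that] V[OF that] by blast
  qed
  then show ?thesis using \<sigma> by blast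
qed

end

section \<open>Tensor products of sheaves\<close>

locale presheaf_pair = surface_charts X + F: presheaf X F + G: presheaf X G
  for X :: "'x surface" and F :: "('x, 'f) msheaf" and G :: "('x, 'g) msheaf"
begin

abbreviation "TP \<equiv> tensor_presheaf X F G"
abbreviation "formal U \<equiv> {c. Poly_Mapping.keys c \<subseteq> carrier (sec F U) \<times> carrier (sec G U)}"
abbreviation "tcls U \<equiv> tensor_class (structure_sheaf X U) (sec F U) (sec G U)"
abbreviation "tpure U s t \<equiv> tcls U (frag_of (s, t))"
abbreviation "tres U V \<equiv> frag_map (res F U V) (res G U V)"

lemma TP_sec: "sec TP U = tensor_module (structure_sheaf X U) (sec F U) (sec G U)"
  by (simp add: tensor_presheaf_def)

lemma tensor_pair: "open_in X U \<Longrightarrow> tensor_pair (structure_sheaf X U) (sec F U) (sec G U)"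
  by (intro tensor_pair.intro F.sec_module G.sec_module)

text \<open>An instance of \<open>tensor_map_class\<close> with both maps restrictions. The
  balancing condition holds because restricting a multiple restricts the scalar as well.\<close>

lemma TP_res:
  assumes U: "open_in X U" "open_in X V" "V \<subseteq> U"
  shows "res TP U V (tcls U c) = tcls V (tres U V c)"
proof -
  interpret V: tensor_pair "structure_sheaf X V" "sec F V" "sec G V" by (rule tensor_pair[OF U(2)])
  have "res TP U V (tcls U c) = (\<Union>d\<in>tcls U c. tcls V (tres U V d))"
    by (simp add: tensor_presheaf_def)
  also have "\<dots> = tcls V (tres U V c)"
  proof (rule tensor_map_class[OF tensor_pair[OF U(1)] tensor_pair[OF U(2)]])
    fix a m n assume a: "a \<in> hol U" and m: "m \<in> carrier (sec F U)" and n: "n \<in> carrier (sec G U)"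
    show "frag_of (res F U V (a \<odot>\<^bsub>sec F U\<^esub> m), res G U V n)
      - frag_of (res F U V m, res G U V (a \<odot>\<^bsub>sec G U\<^esub> n)) \<in> V.relations"
      unfolding F.res_smult[OF U a m] G.res_smult[OF U a n]
      by (rule V.relations_intros(3)[OF hol_restrict[OF a U(3)] F.res_closed[OF U m] G.res_closed[OF U n]])
  qed (simp_all add: U F.res_closed G.res_closed F.res_add G.res_add)
  finally show ?thesis .
qed

lemma tres_formal:
  assumes U: "open_in X U" "open_in X V" "V \<subseteq> U" and c: "c \<in> formal U"
  shows "tres U V c \<in> formal V"
  unfolding mem_Collect_eq
  by (rule frag_map_keys[of c "carrier (sec F U)" "carrier (sec G U)"])
    (use assms in \<open>simp_all add: F.res_closed G.res_closed\<close>)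

lemma TP_carrierE:
  assumes "open_in X U" "C \<in> carrier (sec TP U)"
  obtains c where "c \<in> formal U" "C = tcls U c"
  using tensor_pair.T_carrierE[OF tensor_pair[OF assms(1)] assms(2)[unfolded TP_sec]] by metis

lemma TP_carrierI: "open_in X U \<Longrightarrow> c \<in> formal U \<Longrightarrow> tcls U c \<in> carrier (sec TP U)"
  unfolding TP_sec tensor_pair.T_carrier[OF tensor_pair] by (rule imageI)

text \<open>Apart from the module laws, every axiom is an identity between formal sums, checked on
  generators.\<close>

lemma TP_presheaf: "module_presheaf X TP"
  unfolding module_presheaf_def
proof (intro conjI allI impI)
  fix U assume U: "open_in X U"
  show "Module.module (structure_sheaf X U) (sec TP U)"
    unfolding TP_sec by (rule tensor_pair.T_module[OF tensor_pair[OF U]])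
next
  fix U V assume "open_in X U \<and> open_in X V \<and> V \<subseteq> U"
  then have U: "open_in X U" "open_in X V" "V \<subseteq> U" by auto
  interpret U: tensor_pair "structure_sheaf X U" "sec F U" "sec G U" by (rule tensor_pair[OF U(1)])
  interpret V: tensor_pair "structure_sheaf X V" "sec F V" "sec G V" by (rule tensor_pair[OF U(2)])
  show "res TP U V \<in> carrier (sec TP U) \<rightarrow> carrier (sec TP V)"
  proof (rule funcsetI)
    fix C assume "C \<in> carrier (sec TP U)"
    then obtain c where c: "c \<in> formal U" "C = tcls U c" by (rule TP_carrierE[OF U(1)])
    show "res TP U V C \<in> carrier (sec TP V)"
      unfolding c(2) TP_res[OF U] by (rule TP_carrierI[OF U(2) tres_formal[OF U c(1)]])
  qed
  show "\<forall>C\<in>carrier (sec TP U). \<forall>D\<in>carrier (sec TP U).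
      res TP U V (C \<oplus>\<^bsub>sec TP U\<^esub> D) = res TP U V C \<oplus>\<^bsub>sec TP V\<^esub> res TP U V D"
  proof (intro ballI)
    fix C D assume CD: "C \<in> carrier (sec TP U)" "D \<in> carrier (sec TP U)"
    obtain c where c: "c \<in> formal U" "C = tcls U c" by (rule TP_carrierE[OF U(1) CD(1)])
    obtain d where d: "d \<in> formal U" "D = tcls U d" by (rule TP_carrierE[OF U(1) CD(2)])
    show "res TP U V (C \<oplus>\<^bsub>sec TP U\<^esub> D) = res TP U V C \<oplus>\<^bsub>sec TP V\<^esub> res TP U V D"
      unfolding c(2) d(2) TP_sec U.T_add TP_res[OF U] V.T_add frag_extend_add by (rule refl)
  qed
  show "\<forall>f\<in>hol U. \<forall>C\<in>carrier (sec TP U).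
      res TP U V (f \<odot>\<^bsub>sec TP U\<^esub> C) = restrict f V \<odot>\<^bsub>sec TP V\<^esub> res TP U V C"
  proof (intro ballI)
    fix f C assume f: "f \<in> hol U" and C: "C \<in> carrier (sec TP U)"
    obtain c where c: "c \<in> formal U" "C = tcls U c" by (rule TP_carrierE[OF U(1) C])
    from c(1) have "Poly_Mapping.keys c \<subseteq> carrier (sec F U) \<times> carrier (sec G U)" by simp
    then have "tres U V (frag_map (\<lambda>m. f \<odot>\<^bsub>sec F U\<^esub> m) (\<lambda>n. n) c)
      = frag_map (\<lambda>m. restrict f V \<odot>\<^bsub>sec F V\<^esub> m) (\<lambda>n. n) (tres U V c)"
      by (induction c rule: frag_induction) (auto simp: frag_extend_diff F.res_smult[OF U f] simp del: restrict_apply)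
    then show "res TP U V (f \<odot>\<^bsub>sec TP U\<^esub> C) = restrict f V \<odot>\<^bsub>sec TP V\<^esub> res TP U V C"
      unfolding c(2) TP_sec U.T_smult[OF f] TP_res[OF U] V.T_smult[OF hol_restrict[OF f U(3)]] by simp
  qed
next
  fix U assume U: "open_in X U"
  show "\<forall>C\<in>carrier (sec TP U). res TP U U C = C"
  proof
    fix C assume "C \<in> carrier (sec TP U)"
    then obtain c where c: "c \<in> formal U" "C = tcls U c" by (rule TP_carrierE[OF U])
    from c(1) have "Poly_Mapping.keys c \<subseteq> carrier (sec F U) \<times> carrier (sec G U)" by simp
    then have "tres U U c = c"
      by (induction c rule: frag_induction) (auto simp: frag_extend_diff F.res_id[OF U] G.res_id[OF U])
    then show "res TP U U C = C" unfolding c(2) TP_res[OF U U order_refl] by simp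
  qed
next
  fix U V W assume "open_in X U \<and> open_in X V \<and> open_in X W \<and> W \<subseteq> V \<and> V \<subseteq> U"
  then have o: "open_in X U" "open_in X V" "open_in X W" "W \<subseteq> V" "V \<subseteq> U" by auto
  have WU: "W \<subseteq> U" using o by auto
  show "\<forall>C\<in>carrier (sec TP U). res TP V W (res TP U V C) = res TP U W C"
  proof
    fix C assume "C \<in> carrier (sec TP U)"
    then obtain c where c: "c \<in> formal U" "C = tcls U c" by (rule TP_carrierE[OF o(1)])
    from c(1) have "Poly_Mapping.keys c \<subseteq> carrier (sec F U) \<times> carrier (sec G U)" by simp
    then have "tres V W (tres U V c) = tres U W c"
      by (induction c rule: frag_induction) (auto simp: frag_extend_diff F.res_comp[OF o] G.res_comp[OF o])
    then show "res TP V W (res TP U V C) = res TP U W C"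
      unfolding c(2) TP_res[OF o(1,2,5)] TP_res[OF o(2,3,4)] TP_res[OF o(1,3) WU] by simp
  qed
qed

sublocale TP: presheaf X "tensor_presheaf X F G"
  by unfold_locales (rule TP_presheaf)

lemma pure_tensor_eq: "pure_tensor X F G U s t = TP.to_sheaf U (tpure U s t)"
  by (simp add: pure_tensor_def TP.to_sheaf_def)

lemma tpure_section:
  "open_in X U \<Longrightarrow> s \<in> carrier (sec F U) \<Longrightarrow> t \<in> carrier (sec G U) \<Longrightarrow> TP.section_over U (tpure U s t)"
  unfolding TP.section_over_def by (simp add: TP_carrierI)

lemma TP_induct [consumes 2, case_names zero pure diff]:
  assumes "open_in X U" "C \<in> carrier (sec TP U)" and "P (tcls U 0)"
    and "\<And>s t. s \<in> carrier (sec F U) \<Longrightarrow> t \<in> carrier (sec G U) \<Longrightarrow> P (tpure U s t)"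
    and "\<And>c d. c \<in> formal U \<Longrightarrow> d \<in> formal U \<Longrightarrow> P (tcls U c) \<Longrightarrow> P (tcls U d) \<Longrightarrow> P (tcls U (c - d))"
  shows "P C"
proof -
  interpret U: tensor_pair "structure_sheaf X U" "sec F U" "sec G U" by (rule tensor_pair[OF assms(1)])
  show ?thesis
    by (rule U.T_induct[where P = P, OF assms(2)[unfolded TP_sec] assms(3)])
      (use assms(4,5) in simp_all)
qed

lemma tensor_sheaf_eq: "tensor_sheaf X F G = sheafification X TP"
  by (simp add: tensor_sheaf_def)

end

section \<open>Bilinear families of maps and morphisms out of the tensor sheaf\<close>

locale bilinear = presheaf_pair X F G + H: presheaf X H
  for X :: "'x surface" and F :: "('x, 'f) msheaf" and G :: "('x, 'g) msheaf"
    and H :: "('x, 'h) msheaf" +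
  fixes \<beta> :: "'x set \<Rightarrow> 'f \<Rightarrow> 'g \<Rightarrow> 'h"
  assumes closed: "\<And>U s t. open_in X U \<Longrightarrow> s \<in> carrier (sec F U) \<Longrightarrow> t \<in> carrier (sec G U)
      \<Longrightarrow> \<beta> U s t \<in> carrier (sec H U)"
    and add_left: "\<And>U s s' t. open_in X U \<Longrightarrow> s \<in> carrier (sec F U) \<Longrightarrow> s' \<in> carrier (sec F U)
      \<Longrightarrow> t \<in> carrier (sec G U) \<Longrightarrow> \<beta> U (s \<oplus>\<^bsub>sec F U\<^esub> s') t = \<beta> U s t \<oplus>\<^bsub>sec H U\<^esub> \<beta> U s' t"
    and add_right: "\<And>U s t t'. open_in X U \<Longrightarrow> s \<in> carrier (sec F U) \<Longrightarrow> t \<in> carrier (sec G U)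
      \<Longrightarrow> t' \<in> carrier (sec G U) \<Longrightarrow> \<beta> U s (t \<oplus>\<^bsub>sec G U\<^esub> t') = \<beta> U s t \<oplus>\<^bsub>sec H U\<^esub> \<beta> U s t'"
    and smult_left: "\<And>U f s t. open_in X U \<Longrightarrow> f \<in> carrier (structure_sheaf X U) \<Longrightarrow> s \<in> carrier (sec F U)
      \<Longrightarrow> t \<in> carrier (sec G U) \<Longrightarrow> \<beta> U (f \<odot>\<^bsub>sec F U\<^esub> s) t = f \<odot>\<^bsub>sec H U\<^esub> \<beta> U s t"
    and smult_right: "\<And>U f s t. open_in X U \<Longrightarrow> f \<in> carrier (structure_sheaf X U) \<Longrightarrow> s \<in> carrier (sec F U)
      \<Longrightarrow> t \<in> carrier (sec G U) \<Longrightarrow> \<beta> U s (f \<odot>\<^bsub>sec G U\<^esub> t) = f \<odot>\<^bsub>sec H U\<^esub> \<beta> U s t"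
    and restricts: "\<And>U V s t. open_in X U \<Longrightarrow> open_in X V \<Longrightarrow> V \<subseteq> U \<Longrightarrow> s \<in> carrier (sec F U)
      \<Longrightarrow> t \<in> carrier (sec G U) \<Longrightarrow> \<beta> V (res F U V s) (res G U V t) = res H U V (\<beta> U s t)"

text \<open>This turns a morphism out of the sheafified tensor product into a family of maps on
  pairs of sections, the only form in which \<psi> is used in computations.\<close>

lemma (in presheaf_pair) bilinear_of_sheaf_hom:
  assumes "module_presheaf X H" "sheaf_hom X (tensor_sheaf X F G) H \<psi>"
  shows "bilinear X F G H (\<lambda>U s t. \<psi> U (pure_tensor X F G U s t))"
proof -
  interpret H: presheaf X H by unfold_locales fact
  note psi = assms(2)[unfolded tensor_sheaf_eq]
  show ?thesis
  proof (unfold_locales, unfold pure_tensor_eq)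
    fix U s t assume U: "open_in X U" and s: "s \<in> carrier (sec F U)" and t: "t \<in> carrier (sec G U)"
    interpret U: tensor_pair "structure_sheaf X U" "sec F U" "sec G U" by (rule tensor_pair[OF U])
    note p = tpure_section[OF U s t]
    note c = TP.to_sheaf_closed[OF p]
    show "\<psi> U (TP.to_sheaf U (tpure U s t)) \<in> carrier (sec H U)"
      by (rule sheaf_homD(1)[OF psi U c])
    show "\<psi> U (TP.to_sheaf U (tpure U (s \<oplus>\<^bsub>sec F U\<^esub> s') t))
        = \<psi> U (TP.to_sheaf U (tpure U s t)) \<oplus>\<^bsub>sec H U\<^esub> \<psi> U (TP.to_sheaf U (tpure U s' t))"
      if s': "s' \<in> carrier (sec F U)" for s'
    proof -
      note p' = tpure_section[OF U s' t]
      show ?thesis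
        unfolding U.pure_add_left[OF s s' t] TP_sec[symmetric] TP.to_sheaf_add[OF p p']
        by (rule sheaf_homD(2)[OF psi U c TP.to_sheaf_closed[OF p']])
    qed
    show "\<psi> U (TP.to_sheaf U (tpure U s (t \<oplus>\<^bsub>sec G U\<^esub> t')))
        = \<psi> U (TP.to_sheaf U (tpure U s t)) \<oplus>\<^bsub>sec H U\<^esub> \<psi> U (TP.to_sheaf U (tpure U s t'))"
      if t': "t' \<in> carrier (sec G U)" for t'
    proof -
      note p' = tpure_section[OF U s t']
      show ?thesis
        unfolding U.pure_add_right[OF s t t'] TP_sec[symmetric] TP.to_sheaf_add[OF p p']
        by (rule sheaf_homD(2)[OF psi U c TP.to_sheaf_closed[OF p']])
    qed
    show 1: "\<psi> U (TP.to_sheaf U (tpure U (f \<odot>\<^bsub>sec F U\<^esub> s) t)) = f \<odot>\<^bsub>sec H U\<^esub> \<psi> U (TP.to_sheaf U (tpure U s t))"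
      if f: "f \<in> carrier (structure_sheaf X U)" for f
      unfolding U.pure_smult[OF f, symmetric] TP_sec[symmetric] TP.to_sheaf_smult[OF p f]
      by (rule sheaf_homD(3)[OF psi U c f])
    \<comment> \<open>Linearity on the right is linearity on the left, since a scalar moves across a
      pure tensor.\<close>
    show "\<psi> U (TP.to_sheaf U (tpure U s (f \<odot>\<^bsub>sec G U\<^esub> t))) = f \<odot>\<^bsub>sec H U\<^esub> \<psi> U (TP.to_sheaf U (tpure U s t))"
      if f: "f \<in> carrier (structure_sheaf X U)" for f
      using 1[OF f] unfolding U.pure_smult_swap[OF f s t] .
    show "\<psi> V (TP.to_sheaf V (tpure V (res F U V s) (res G U V t))) = res H U V (\<psi> U (TP.to_sheaf U (tpure U s t)))"
      if V: "open_in X V" "V \<subseteq> U" for V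
    proof -
      have "tpure V (res F U V s) (res G U V t) = res TP U V (tpure U s t)"
        unfolding TP_res[OF U V] by simp
      then show ?thesis
        unfolding TP.to_sheaf_res[OF p V, symmetric] sheaf_homD(4)[OF psi U c V, symmetric] by simp
    qed
  qed
qed

locale bilinear_to_sheaf = bilinear X F G H \<beta> + H: sheaf X H
  for X :: "'x surface" and F :: "('x, 'f) msheaf" and G :: "('x, 'g) msheaf"
    and H :: "('x, 'h) msheaf" and \<beta>
begin

text \<open>Chosen separately over each open set. Being determined on pure tensors, the choices are
  nevertheless compatible with restriction.\<close>

definition presheaf_hom :: "'x set \<Rightarrow> (('f \<times> 'g) \<Rightarrow>\<^sub>0 int) set \<Rightarrow> 'h" where
  "presheaf_hom U = (SOME \<eta>. \<eta> \<in> module_hom (structure_sheaf X U) (sec TP U) (sec H U) \<and>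
     (\<forall>s\<in>carrier (sec F U). \<forall>t\<in>carrier (sec G U). \<eta> (tpure U s t) = \<beta> U s t))"

lemma presheaf_hom:
  assumes U: "open_in X U"
  shows "presheaf_hom U \<in> module_hom (structure_sheaf X U) (sec TP U) (sec H U)"
    and "s \<in> carrier (sec F U) \<Longrightarrow> t \<in> carrier (sec G U) \<Longrightarrow> presheaf_hom U (tpure U s t) = \<beta> U s t"
proof -
  interpret U: tensor_pair "structure_sheaf X U" "sec F U" "sec G U" by (rule tensor_pair[OF U])
  have "\<exists>\<eta>\<in>module_hom (structure_sheaf X U) (sec TP U) (sec H U).
      \<forall>s\<in>carrier (sec F U). \<forall>t\<in>carrier (sec G U). \<eta> (tpure U s t) = \<beta> U s t"
    unfolding TP_sec
    by (rule U.T_lift[OF H.sec_module[OF U] closed[OF U] add_left[OF U] add_right[OF U]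
          smult_left[OF U] smult_right[OF U]])
  then have "presheaf_hom U \<in> module_hom (structure_sheaf X U) (sec TP U) (sec H U) \<and>
     (\<forall>s\<in>carrier (sec F U). \<forall>t\<in>carrier (sec G U). presheaf_hom U (tpure U s t) = \<beta> U s t)"
    unfolding presheaf_hom_def Bex_def by (rule someI_ex)
  then show "presheaf_hom U \<in> module_hom (structure_sheaf X U) (sec TP U) (sec H U)"
    "s \<in> carrier (sec F U) \<Longrightarrow> t \<in> carrier (sec G U) \<Longrightarrow> presheaf_hom U (tpure U s t) = \<beta> U s t"
    by auto
qed

lemma presheaf_hom_closed:
  "open_in X U \<Longrightarrow> C \<in> carrier (sec TP U) \<Longrightarrow> presheaf_hom U C \<in> carrier (sec H U)"
  using presheaf_hom(1)[of U] unfolding module_hom_def by (auto dest: funcset_mem)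

lemma presheaf_hom_add:
  "open_in X U \<Longrightarrow> C \<in> carrier (sec TP U) \<Longrightarrow> D \<in> carrier (sec TP U) \<Longrightarrow>
    presheaf_hom U (C \<oplus>\<^bsub>sec TP U\<^esub> D) = presheaf_hom U C \<oplus>\<^bsub>sec H U\<^esub> presheaf_hom U D"
  using presheaf_hom(1)[of U] unfolding module_hom_def by simp

text \<open>Compatibility with restriction compares two additive maps into \<open>sec H V\<close>
  that agree on pure tensors, where it is the compatibility of \<beta>.\<close>

lemma presheaf_hom_sheaf_hom: "sheaf_hom X TP H presheaf_hom"
proof (rule sheaf_homI)
  fix U C assume U: "open_in X U" and C: "C \<in> carrier (sec TP U)"
  interpret U: tensor_pair "structure_sheaf X U" "sec F U" "sec G U" by (rule tensor_pair[OF U])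
  show "presheaf_hom U C \<in> carrier (sec H U)" by (rule presheaf_hom_closed[OF U C])
  show "presheaf_hom U (C \<oplus>\<^bsub>sec TP U\<^esub> D) = presheaf_hom U C \<oplus>\<^bsub>sec H U\<^esub> presheaf_hom U D"
    if "D \<in> carrier (sec TP U)" for D
    by (rule presheaf_hom_add[OF U C that])
  show "presheaf_hom U (f \<odot>\<^bsub>sec TP U\<^esub> C) = f \<odot>\<^bsub>sec H U\<^esub> presheaf_hom U C" if "f \<in> hol U" for f
    using presheaf_hom(1)[OF U] that C unfolding module_hom_def by simp
  fix V assume V: "open_in X V" "V \<subseteq> U"
  show "presheaf_hom V (res TP U V C) = res H U V (presheaf_hom U C)"
  proof (rule U.T_hom_unique[where h = "\<lambda>C. presheaf_hom V (res TP U V C)"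
        and k = "\<lambda>C. res H U V (presheaf_hom U C)" and H = "sec H V", OF H.sec_group[OF V(1)]])
    show "C \<in> carrier U.T" using C unfolding TP_sec .
    fix s t assume s: "s \<in> carrier (sec F U)" and t: "t \<in> carrier (sec G U)"
    have "presheaf_hom V (res TP U V (tpure U s t)) = presheaf_hom V (tpure V (res F U V s) (res G U V t))"
      unfolding TP_res[OF U V] by simp
    also have "\<dots> = \<beta> V (res F U V s) (res G U V t)"
      by (rule presheaf_hom(2)[OF V(1) F.res_closed[OF U V s] G.res_closed[OF U V t]])
    also have "\<dots> = res H U V (presheaf_hom U (tpure U s t))"
      unfolding restricts[OF U V s t] presheaf_hom(2)[OF U s t] by (rule refl)
    finally show "presheaf_hom V (res TP U V (tpure U s t)) = res H U V (presheaf_hom U (tpure U s t))" .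
  qed (use U V in \<open>simp_all add: TP_sec[symmetric] presheaf_hom_closed presheaf_hom_add
        TP.res_closed TP.res_add H.res_closed H.res_add\<close>)
qed

sublocale lift: presheaf_map X "tensor_presheaf X F G" H presheaf_hom
  by unfold_locales (rule presheaf_hom_sheaf_hom)

abbreviation "tensor_hom \<equiv> lift.lift"

lemma tensor_hom: "sheaf_hom X (tensor_sheaf X F G) H tensor_hom"
  unfolding tensor_sheaf_eq by (rule lift.lift_hom)

lemma tensor_hom_pure:
  "open_in X U \<Longrightarrow> s \<in> carrier (sec F U) \<Longrightarrow> t \<in> carrier (sec G U)
    \<Longrightarrow> tensor_hom U (pure_tensor X F G U s t) = \<beta> U s t"
  unfolding pure_tensor_eq by (simp add: lift.lift_to_sheaf tpure_section presheaf_hom)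

lemma presheaf_hom_zero:
  assumes "open_in X U"
  shows "presheaf_hom U (tcls U 0) = \<zero>\<^bsub>sec H U\<^esub>"
proof -
  interpret U: tensor_pair "structure_sheaf X U" "sec F U" "sec G U" by (rule tensor_pair[OF assms])
  interpret HU: abelian_group "sec H U" by (rule H.sec_group[OF assms])
  have c: "tcls U 0 \<in> carrier (sec TP U)" by (rule TP_carrierI[OF assms]) simp
  have "presheaf_hom U (tcls U 0) = presheaf_hom U (tcls U 0) \<oplus>\<^bsub>sec H U\<^esub> presheaf_hom U (tcls U 0)"
    using presheaf_hom_add[OF assms c c] unfolding TP_sec U.T_add by simp
  then show ?thesis using presheaf_hom_closed[OF assms c] by (metis HU.add.r_cancel_one')
qed

text \<open>The form that fits the difference case of \<open>TP_induct\<close>: additivity for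
  \<open>c = (c - d) + d\<close>, with no subtraction in \<open>H\<close>.\<close>

lemma presheaf_hom_diff:
  assumes U: "open_in X U" and c: "c \<in> formal U" and d: "d \<in> formal U"
  shows "presheaf_hom U (tcls U c) = presheaf_hom U (tcls U (c - d)) \<oplus>\<^bsub>sec H U\<^esub> presheaf_hom U (tcls U d)"
proof -
  interpret U: tensor_pair "structure_sheaf X U" "sec F U" "sec G U" by (rule tensor_pair[OF U])
  show ?thesis
    using presheaf_hom_add[OF U TP_carrierI[OF U U.formal_diff[OF c d]] TP_carrierI[OF U d]]
    unfolding TP_sec U.T_add by simp
qed

end

section \<open>Frames and coordinates\<close>

text \<open>In a monoid, preservation of zero does not follow from additivity, so it is a separate
  hypothesis.\<close>

lemma finsum_hom:
  assumes "abelian_monoid G" "abelian_monoid H" "finite A"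
    and f: "\<And>i. i \<in> A \<Longrightarrow> f i \<in> carrier G"
    and h: "\<And>a. a \<in> carrier G \<Longrightarrow> h a \<in> carrier H"
    and add: "\<And>a b. a \<in> carrier G \<Longrightarrow> b \<in> carrier G \<Longrightarrow> h (a \<oplus>\<^bsub>G\<^esub> b) = h a \<oplus>\<^bsub>H\<^esub> h b"
    and zero: "h \<zero>\<^bsub>G\<^esub> = \<zero>\<^bsub>H\<^esub>"
  shows "h (finsum G f A) = finsum H (\<lambda>i. h (f i)) A"
proof -
  interpret G: abelian_monoid G by fact
  interpret H: abelian_monoid H by fact
  show ?thesis using assms(3) f
  proof (induction A rule: finite_induct)
    case (insert i A)
    have c: "f \<in> A \<rightarrow> carrier G" "f i \<in> carrier G" "(\<lambda>i. h (f i)) \<in> A \<rightarrow> carrier H"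
      using insert.prems h by auto
    show ?case
      using insert.hyps insert.IH insert.prems h c by (simp add: add G.finsum_closed)
  qed (simp add: zero)
qed

lemma finsum_additive:
  fixes \<nu> :: "'b \<Rightarrow> complex"
  assumes "abelian_group G" "finite A"
    and f: "\<And>i. i \<in> A \<Longrightarrow> f i \<in> carrier G"
    and add: "\<And>a b. a \<in> carrier G \<Longrightarrow> b \<in> carrier G \<Longrightarrow> \<nu> (a \<oplus>\<^bsub>G\<^esub> b) = \<nu> a + \<nu> b"
  shows "\<nu> (finsum G f A) = (\<Sum>i\<in>A. \<nu> (f i))"
proof -
  interpret G: abelian_group G by fact
  have "\<nu> \<zero>\<^bsub>G\<^esub> = 0" using add[of "\<zero>\<^bsub>G\<^esub>" "\<zero>\<^bsub>G\<^esub>"] by simp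
  show ?thesis using assms(2) f
  proof (induction A rule: finite_induct)
    case (insert i A)
    have c: "f \<in> A \<rightarrow> carrier G" "f i \<in> carrier G" using insert.prems by auto
    show ?case using insert.hyps insert.IH insert.prems c by (simp add: add G.finsum_closed)
  qed (simp add: \<open>\<nu> \<zero>\<^bsub>G\<^esub> = 0\<close>)
qed

section \<open>Coordinates with respect to a frame\<close>

locale framed = sheaf X F for X :: "'x surface" and F :: "('x, 'f) msheaf" +
  fixes r :: nat and U :: "'x set" and e :: "nat \<Rightarrow> 'f"
  assumes U_open: "open_in X U"
    and frame: "frame_over X r F U e"
begin

abbreviation "coefficients V \<equiv> {..<r} \<rightarrow>\<^sub>E hol V"

definition combination :: "'x set \<Rightarrow> (nat \<Rightarrow> 'x \<Rightarrow> complex) \<Rightarrow> 'f" where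
  "combination V c = (\<Oplus>\<^bsub>sec F V\<^esub>i\<in>{..<r}. c i \<odot>\<^bsub>sec F V\<^esub> res F U V (e i))"

definition coords :: "'x set \<Rightarrow> 'f \<Rightarrow> nat \<Rightarrow> 'x \<Rightarrow> complex" where
  "coords V s = (THE c. c \<in> coefficients V \<and> s = combination V c)"

lemma e_closed: "i < r \<Longrightarrow> e i \<in> carrier (sec F U)"
  using frame unfolding frame_over_def by auto

lemma coords_ex1:
  assumes "open_in X V" "V \<subseteq> U" "s \<in> carrier (sec F V)"
  shows "\<exists>!c. c \<in> coefficients V \<and> s = combination V c"
  unfolding combination_def
  using frame[unfolded frame_over_def, THEN conjunct2, THEN spec, THEN mp, THEN bspec, of V s] assms by simp

lemma coords:
  assumes "open_in X V" "V \<subseteq> U" "s \<in> carrier (sec F V)"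
  shows "coords V s \<in> coefficients V" "combination V (coords V s) = s"
proof -
  have "coords V s \<in> coefficients V \<and> s = combination V (coords V s)"
    unfolding coords_def by (rule theI'[OF coords_ex1[OF assms]])
  then show "coords V s \<in> coefficients V" "combination V (coords V s) = s" by auto
qed

lemma coords_hol:
  "open_in X V \<Longrightarrow> V \<subseteq> U \<Longrightarrow> s \<in> carrier (sec F V) \<Longrightarrow> i < r \<Longrightarrow> coords V s i \<in> hol V"
  using coords(1)[of V s] by (auto simp: PiE_iff)

context
  fixes V assumes V: "open_in X V" "V \<subseteq> U"
begin

interpretation V: Module.module "structure_sheaf X V" "sec F V" by (rule sec_module[OF V(1)])

lemma res_e_closed: "i < r \<Longrightarrow> res F U V (e i) \<in> carrier (sec F V)"
  by (rule res_closed[OF U_open V e_closed])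

lemma term_closed: "(\<And>i. i < r \<Longrightarrow> c i \<in> hol V) \<Longrightarrow>
    (\<lambda>i. c i \<odot>\<^bsub>sec F V\<^esub> res F U V (e i)) \<in> {..<r} \<rightarrow> carrier (sec F V)"
  by (auto intro: V.smult_closed res_e_closed)

lemma combination_closed: "(\<And>i. i < r \<Longrightarrow> c i \<in> hol V) \<Longrightarrow> combination V c \<in> carrier (sec F V)"
  unfolding combination_def by (rule V.M.finsum_closed[OF term_closed])

lemma combination_cong:
  assumes "\<And>i. i < r \<Longrightarrow> d i \<in> hol V" "\<And>i. i < r \<Longrightarrow> c i = d i"
  shows "combination V c = combination V d"
  unfolding combination_def
  by (rule V.M.finsum_cong'[OF refl term_closed]) (use assms in auto)

lemma coords_combination:
  assumes "\<And>i. i < r \<Longrightarrow> c i \<in> hol V" "i < r"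
  shows "coords V (combination V c) i = c i"
proof -
  \<comment> \<open>Uniqueness of coefficients is stated for functions that are extensional on
    \<open>{..<r}\<close>, so \<open>c\<close> is cut off before it is compared with
    \<open>coords\<close>.\<close>
  have "combination V c = combination V (restrict c {..<r})"
    by (rule combination_cong) (use assms in auto)
  moreover have "restrict c {..<r} \<in> coefficients V" using assms by auto
  ultimately have "coords V (combination V c) = restrict c {..<r}"
    unfolding coords_def
    by (intro the1_equality[OF coords_ex1[OF V combination_closed]]) (use assms in auto)
  then show ?thesis using assms(2) by simp
qed

lemma coords_add:
  assumes "s \<in> carrier (sec F V)" "t \<in> carrier (sec F V)" "i < r"
  shows "coords V (s \<oplus>\<^bsub>sec F V\<^esub> t) i = (\<lambda>y\<in>V. coords V s i y + coords V t i y)"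
proof -
  let ?c = "\<lambda>i. \<lambda>y\<in>V. coords V s i y + coords V t i y"
  note h = coords_hol[OF V assms(1)] coords_hol[OF V assms(2)]
  have "combination V ?c = (\<Oplus>\<^bsub>sec F V\<^esub>i\<in>{..<r}. coords V s i \<odot>\<^bsub>sec F V\<^esub> res F U V (e i)
      \<oplus>\<^bsub>sec F V\<^esub> coords V t i \<odot>\<^bsub>sec F V\<^esub> res F U V (e i))"
    unfolding combination_def
  proof (rule V.M.finsum_cong'[OF refl])
    fix i assume "i \<in> {..<r}"
    then show "?c i \<odot>\<^bsub>sec F V\<^esub> res F U V (e i) = coords V s i \<odot>\<^bsub>sec F V\<^esub> res F U V (e i)
      \<oplus>\<^bsub>sec F V\<^esub> coords V t i \<odot>\<^bsub>sec F V\<^esub> res F U V (e i)"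
      using V.smult_l_distr[OF h(1) h(2) res_e_closed, of i i i] by simp
  qed (use h res_e_closed in auto)
  also have "\<dots> = combination V (coords V s) \<oplus>\<^bsub>sec F V\<^esub> combination V (coords V t)"
    unfolding combination_def by (rule V.M.finsum_addf[OF term_closed term_closed]) (use h in auto)
  also have "\<dots> = s \<oplus>\<^bsub>sec F V\<^esub> t" using coords(2)[OF V] assms by simp
  finally have "combination V ?c = s \<oplus>\<^bsub>sec F V\<^esub> t" .
  moreover have "?c i \<in> hol V" if "i < r" for i
    using hol_add[OF h(1)[OF that] h(2)[OF that]] by (simp del: restrict_hol_iff)
  ultimately show ?thesis using coords_combination[of ?c i] assms(3) by (simp del: restrict_hol_iff)
qed

lemma coords_smult:
  assumes "f \<in> hol V" "s \<in> carrier (sec F V)" "i < r"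
  shows "coords V (f \<odot>\<^bsub>sec F V\<^esub> s) i = (\<lambda>y\<in>V. f y * coords V s i y)"
proof -
  let ?c = "\<lambda>i. \<lambda>y\<in>V. f y * coords V s i y"
  note h = coords_hol[OF V assms(2)]
  have "combination V ?c = (\<Oplus>\<^bsub>sec F V\<^esub>i\<in>{..<r}. f \<odot>\<^bsub>sec F V\<^esub> (coords V s i \<odot>\<^bsub>sec F V\<^esub> res F U V (e i)))"
    unfolding combination_def
  proof (rule V.M.finsum_cong'[OF refl])
    fix i assume "i \<in> {..<r}"
    then show "?c i \<odot>\<^bsub>sec F V\<^esub> res F U V (e i) = f \<odot>\<^bsub>sec F V\<^esub> (coords V s i \<odot>\<^bsub>sec F V\<^esub> res F U V (e i))"
      using V.smult_assoc1[OF assms(1) h res_e_closed, of i i] by simp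
  qed (use h res_e_closed assms(1) in auto)
  also have "\<dots> = f \<odot>\<^bsub>sec F V\<^esub> combination V (coords V s)"
    unfolding combination_def
    by (rule V.finsum_smult_ldistr[OF _ assms(1) term_closed, symmetric]) (use h in auto)
  also have "\<dots> = f \<odot>\<^bsub>sec F V\<^esub> s" using coords(2)[OF V] assms by simp
  finally have "combination V ?c = f \<odot>\<^bsub>sec F V\<^esub> s" .
  moreover have "?c i \<in> hol V" if "i < r" for i
    using hol_mult[OF assms(1) h[OF that]] by (simp del: restrict_hol_iff)
  ultimately show ?thesis using coords_combination[of ?c i] assms(3) by (simp del: restrict_hol_iff)
qed

lemma coords_e:
  assumes "k < r" "i < r"
  shows "coords V (res F U V (e k)) i = (\<lambda>y\<in>V. if i = k then 1 else 0)"
proof -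
  let ?c = "\<lambda>i. \<lambda>y\<in>V. if i = k then 1 else (0 :: complex)"
  have h: "?c i \<in> hol V" for i using hol_const[of "if i = k then 1 else 0" V] by simp
  have "combination V ?c = (\<Oplus>\<^bsub>sec F V\<^esub>i\<in>{..<r}. if k = i then res F U V (e i) else \<zero>\<^bsub>sec F V\<^esub>)"
    unfolding combination_def
  proof (rule V.M.finsum_cong'[OF refl])
    fix i assume i: "i \<in> {..<r}"
    show "?c i \<odot>\<^bsub>sec F V\<^esub> res F U V (e i) = (if k = i then res F U V (e i) else \<zero>\<^bsub>sec F V\<^esub>)"
    proof (cases "i = k")
      case True
      then show ?thesis using V.smult_one[OF res_e_closed[OF assms(1)]] by simp
    next
      case False
      then show ?thesis using sec_zero_smult[OF V(1) res_e_closed, of i] i by simp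
    qed
  qed (use res_e_closed in auto)
  also have "\<dots> = res F U V (e k)"
    by (rule V.M.finsum_singleton) (use assms res_e_closed in auto)
  finally have "combination V ?c = res F U V (e k)" .
  then show ?thesis using coords_combination[of ?c i] h assms by (simp del: restrict_hol_iff)
qed

end

lemma coords_res:
  assumes V: "open_in X V" "V \<subseteq> U" and W: "open_in X W" "W \<subseteq> V" and s: "s \<in> carrier (sec F V)" and i: "i < r"
  shows "coords W (res F V W s) i = restrict (coords V s i) W"
proof -
  have WU: "W \<subseteq> U" using V W by auto
  interpret V: Module.module "structure_sheaf X V" "sec F V" by (rule sec_module[OF V(1)])
  interpret W: Module.module "structure_sheaf X W" "sec F W" by (rule sec_module[OF W(1)])
  note h = coords_hol[OF V s]
  have "res F V W s = res F V W (combination V (coords V s))" using coords(2)[OF V s] by simp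
  also have "\<dots> = (\<Oplus>\<^bsub>sec F W\<^esub>i\<in>{..<r}. res F V W (coords V s i \<odot>\<^bsub>sec F V\<^esub> res F U V (e i)))"
    unfolding combination_def
    by (rule finsum_hom[OF V.M.abelian_monoid_axioms W.M.abelian_monoid_axioms])
      (use V W h in \<open>auto simp: res_closed res_add res_zero intro!: V.smult_closed res_e_closed\<close>)
  also have "\<dots> = combination W (\<lambda>i. restrict (coords V s i) W)"
    unfolding combination_def
  proof (rule W.M.finsum_cong'[OF refl term_closed[OF W(1) WU]])
    show "restrict (coords V s i) W \<in> hol W" if "i < r" for i using hol_restrict[OF h[OF that] W(2)] .
    show "res F V W (coords V s i \<odot>\<^bsub>sec F V\<^esub> res F U V (e i)) = restrict (coords V s i) W \<odot>\<^bsub>sec F W\<^esub> res F U W (e i)"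
      if "i \<in> {..<r}" for i
      using that res_smult[OF V(1) W h res_e_closed[OF V], of i i] res_comp[OF U_open V(1) W V(2) e_closed, of i]
      by (simp del: restrict_apply)
  qed
  finally have "coords W (res F V W s) i = coords W (combination W (\<lambda>i. restrict (coords V s i) W)) i" by simp
  also have "\<dots> = restrict (coords V s i) W"
    by (rule coords_combination[OF W(1) WU _ i]) (rule hol_restrict[OF h W(2)])
  finally show ?thesis .
qed

text \<open>The section may live over any open \<open>V\<close>, not only inside the domain of the
  frame; it is restricted to \<open>V \<inter> U\<close> before its coordinate is evaluated. The
  value is therefore insensitive to restriction around \<open>y\<close> and serves for germs and
  fibers alike.\<close>

definition val :: "'x \<Rightarrow> 'x set \<Rightarrow> 'f \<Rightarrow> nat \<Rightarrow> complex" where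
  "val y V s i = coords (V \<inter> U) (res F V (V \<inter> U) s) i y"

lemma val_eq_coords:
  assumes "open_in X V" "V \<subseteq> U" "s \<in> carrier (sec F V)"
  shows "val y V s i = coords V s i y"
  using assms by (simp add: val_def Int_absorb2 res_id)

lemma
  assumes V: "open_in X V" and y: "y \<in> V" "y \<in> U" and s: "s \<in> carrier (sec F V)" and i: "i < r"
  shows val_add: "t \<in> carrier (sec F V) \<Longrightarrow> val y V (s \<oplus>\<^bsub>sec F V\<^esub> t) i = val y V s i + val y V t i"
    and val_smult: "f \<in> hol V \<Longrightarrow> val y V (f \<odot>\<^bsub>sec F V\<^esub> s) i = f y * val y V s i"
    and val_res: "open_in X W \<Longrightarrow> W \<subseteq> V \<Longrightarrow> y \<in> W \<Longrightarrow> val y W (res F V W s) i = val y V s i"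
proof -
  let ?I = "V \<inter> U"
  have I: "open_in X ?I" "?I \<subseteq> U" "?I \<subseteq> V" using V U_open by (auto intro: openin_Int)
  note s' = res_closed[OF V I(1,3)]
  show "val y V (s \<oplus>\<^bsub>sec F V\<^esub> t) i = val y V s i + val y V t i" if t: "t \<in> carrier (sec F V)"
    unfolding val_def res_add[OF V I(1,3) s t] coords_add[OF I(1,2) s'[OF s] s'[OF t] i] using y by simp
  show "val y V (f \<odot>\<^bsub>sec F V\<^esub> s) i = f y * val y V s i" if f: "f \<in> hol V"
    unfolding val_def res_smult[OF V I(1,3) f s] coords_smult[OF I(1,2) hol_restrict[OF f I(3)] s'[OF s] i]
    using y by simp
  show "val y W (res F V W s) i = val y V s i" if W: "open_in X W" "W \<subseteq> V" "y \<in> W"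
  proof -
    let ?J = "W \<inter> U"
    have J: "open_in X ?J" "?J \<subseteq> W" "?J \<subseteq> ?I" using W U_open by (auto intro: openin_Int)
    have "res F W ?J (res F V W s) = res F ?I ?J (res F V ?I s)"
      using res_comp[OF V W(1) J(1,2) W(2) s] res_comp[OF V I(1) J(1,3) I(3) s] by simp
    then show ?thesis unfolding val_def using coords_res[OF I(1,2) J(1,3) s'[OF s] i] W y by simp
  qed
qed

lemma val_zero:
  assumes "open_in X V" "y \<in> V" "y \<in> U" "i < r"
  shows "val y V \<zero>\<^bsub>sec F V\<^esub> i = 0"
proof -
  note z = sec_zero_closed[OF assms(1)]
  show ?thesis
    using val_smult[OF assms(1-3) z assms(4) hol_zero] sec_zero_smult[OF assms(1) z] assms(2) by simp
qed

lemma val_e: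
  assumes "open_in X V" "V \<subseteq> U" "y \<in> V" "k < r" "i < r"
  shows "val y V (res F U V (e k)) i = (if i = k then 1 else 0)"
  unfolding val_eq_coords[OF assms(1,2) res_e_closed[OF assms(1,2,4)]] coords_e[OF assms(1,2,4,5)]
  using assms(3) by simp

lemma val_e':
  assumes "y \<in> U" "k < r" "i < r"
  shows "val y U (e k) i = (if i = k then 1 else 0)"
  using val_e[OF U_open order_refl assms] res_id[OF U_open e_closed[OF assms(2)]] by simp

lemma val_hol:
  assumes "open_in X V" "V \<subseteq> U" "s \<in> carrier (sec F V)" "i < r"
  shows "(\<lambda>y\<in>V. val y V s i) \<in> hol V"
  using coords_hol[OF assms] val_eq_coords[OF assms(1-3)] by (simp del: restrict_hol_iff)

lemma val_separates:
  assumes V: "open_in X V" "V \<subseteq> U" and s: "s \<in> carrier (sec F V)" and t: "t \<in> carrier (sec F V)"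
    and eq: "\<And>y i. y \<in> V \<Longrightarrow> i < r \<Longrightarrow> val y V s i = val y V t i"
  shows "s = t"
proof -
  have "coords V s i = coords V t i" if "i < r" for i
    by (rule hol_ext[OF coords_hol[OF V s that] coords_hol[OF V t that]])
      (use eq[OF _ that] val_eq_coords[OF V] s t in simp)
  then have "combination V (coords V s) = combination V (coords V t)"
    by (intro combination_cong[OF V] coords_hol[OF V t]) auto
  then show ?thesis using coords(2)[OF V s] coords(2)[OF V t] by simp
qed

lemma val_section:
  assumes V: "open_in X V" "V \<subseteq> U" and c: "\<And>i. i < r \<Longrightarrow> c i \<in> hol V"
  obtains s where "s \<in> carrier (sec F V)" "\<And>y i. y \<in> V \<Longrightarrow> i < r \<Longrightarrow> val y V s i = c i y"
proof (rule that)
  show s: "combination V c \<in> carrier (sec F V)" by (rule combination_closed[OF V c])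
  show "val y V (combination V c) i = c i y" if "i < r" for y i
    using val_eq_coords[OF V s, of y i] coords_combination[OF V, of c i] c that by simp
qed

lemma restrict_framed:
  assumes W: "open_in X W" "W \<subseteq> U"
  shows "framed X F r W (\<lambda>i. res F U W (e i))"
proof unfold_locales
  show "frame_over X r F W (\<lambda>i. res F U W (e i))"
    unfolding frame_over_def
  proof (intro conjI allI impI ballI)
    show "(\<lambda>i. res F U W (e i)) ` {..<r} \<subseteq> carrier (sec F W)"
      using res_e_closed[OF W] by auto
    fix V s assume "open_in X V \<and> V \<subseteq> W" and s: "s \<in> carrier (sec F V)"
    then have V: "open_in X V" "V \<subseteq> W" "V \<subseteq> U" using W by auto
    interpret V: abelian_group "sec F V" by (rule sec_group[OF V(1)])
    have eq: "(\<Oplus>\<^bsub>sec F V\<^esub>i\<in>{..<r}. c i \<odot>\<^bsub>sec F V\<^esub> res F W V (res F U W (e i))) = combination V c"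
      if c: "c \<in> coefficients V" for c
      unfolding combination_def
      by (rule V.finsum_cong'[OF refl term_closed[OF V(1,3)]])
        (use c res_comp[OF U_open W(1) V(1,2) W(2) e_closed] in auto)
    have *: "c \<in> coefficients V \<and>
        s = (\<Oplus>\<^bsub>sec F V\<^esub>i\<in>{..<r}. c i \<odot>\<^bsub>sec F V\<^esub> res F W V (res F U W (e i))) \<longleftrightarrow>
        c \<in> coefficients V \<and> s = combination V c" for c
      by (rule conj_cong[OF refl]) (simp only: eq)
    show "\<exists>!c. c \<in> coefficients V \<and>
        s = (\<Oplus>\<^bsub>sec F V\<^esub>i\<in>{..<r}. c i \<odot>\<^bsub>sec F V\<^esub> res F W V (res F U W (e i)))"
      unfolding * by (rule coords_ex1[OF V(1,3) s])
  qed
qed fact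

end

text \<open>A separating family of functionals \<open>\<nu>\<close> turns the defining property of a frame into a
  system of linear equations between holomorphic functions.\<close>

lemma (in presheaf) frame_overI:
  fixes \<nu> :: "'x \<Rightarrow> 'x set \<Rightarrow> 'm \<Rightarrow> nat \<Rightarrow> complex"
  assumes U: "open_in X U" and b: "\<And>k. k < r \<Longrightarrow> b k \<in> carrier (sec P U)"
    and add: "\<And>y V s t i. open_in X V \<Longrightarrow> V \<subseteq> U \<Longrightarrow> y \<in> V \<Longrightarrow> s \<in> carrier (sec P V) \<Longrightarrow> t \<in> carrier (sec P V)
      \<Longrightarrow> i < m \<Longrightarrow> \<nu> y V (s \<oplus>\<^bsub>sec P V\<^esub> t) i = \<nu> y V s i + \<nu> y V t i"
    and smult: "\<And>y V f s i. open_in X V \<Longrightarrow> V \<subseteq> U \<Longrightarrow> y \<in> V \<Longrightarrow> f \<in> hol V \<Longrightarrow> s \<in> carrier (sec P V)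
      \<Longrightarrow> i < m \<Longrightarrow> \<nu> y V (f \<odot>\<^bsub>sec P V\<^esub> s) i = f y * \<nu> y V s i"
    and separates: "\<And>V s t. open_in X V \<Longrightarrow> V \<subseteq> U \<Longrightarrow> s \<in> carrier (sec P V) \<Longrightarrow> t \<in> carrier (sec P V)
      \<Longrightarrow> (\<And>y i. y \<in> V \<Longrightarrow> i < m \<Longrightarrow> \<nu> y V s i = \<nu> y V t i) \<Longrightarrow> s = t"
    and ex1: "\<And>V s. open_in X V \<Longrightarrow> V \<subseteq> U \<Longrightarrow> s \<in> carrier (sec P V) \<Longrightarrow>
      \<exists>!d. d \<in> {..<r} \<rightarrow>\<^sub>E hol V \<and>
        (\<forall>y\<in>V. \<forall>i<m. \<nu> y V s i = (\<Sum>k<r. d k y * \<nu> y V (res P U V (b k)) i))"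
  shows "frame_over X r P U b"
  unfolding frame_over_def
proof (intro conjI allI impI ballI)
  show "b ` {..<r} \<subseteq> carrier (sec P U)" using b by auto
  fix V s assume "open_in X V \<and> V \<subseteq> U" and s: "s \<in> carrier (sec P V)"
  then have V: "open_in X V" "V \<subseteq> U" by auto
  interpret V: Module.module "structure_sheaf X V" "sec P V" by (rule sec_module[OF V(1)])
  have rb: "res P U V (b k) \<in> carrier (sec P V)" if "k < r" for k
    by (rule res_closed[OF U V b[OF that]])
  have eq: "s = (\<Oplus>\<^bsub>sec P V\<^esub>k\<in>{..<r}. d k \<odot>\<^bsub>sec P V\<^esub> res P U V (b k)) \<longleftrightarrow>
      (\<forall>y\<in>V. \<forall>i<m. \<nu> y V s i = (\<Sum>k<r. d k y * \<nu> y V (res P U V (b k)) i))" (is "s = ?S \<longleftrightarrow> ?R")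
    if d: "d \<in> {..<r} \<rightarrow>\<^sub>E hol V" for d
  proof -
    have t: "d k \<odot>\<^bsub>sec P V\<^esub> res P U V (b k) \<in> carrier (sec P V)" if "k \<in> {..<r}" for k
      using d that rb by (auto simp: PiE_iff)
    have S: "?S \<in> carrier (sec P V)" by (rule V.M.finsum_closed) (use t in auto)
    have v: "\<nu> y V ?S i = (\<Sum>k<r. d k y * \<nu> y V (res P U V (b k)) i)" if y: "y \<in> V" "i < m" for y i
    proof -
      have "\<nu> y V ?S i = (\<Sum>k<r. \<nu> y V (d k \<odot>\<^bsub>sec P V\<^esub> res P U V (b k)) i)"
        by (rule finsum_additive[where \<nu> = "\<lambda>s. \<nu> y V s i", OF V.M.abelian_group_axioms _ t])
          (use add[OF V y(1) _ _ y(2)] in auto)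
      also have "\<dots> = (\<Sum>k<r. d k y * \<nu> y V (res P U V (b k)) i)"
        by (rule sum.cong[OF refl], rule smult[OF V y(1) _ _ y(2)]) (use d rb in \<open>auto simp: PiE_iff\<close>)
      finally show ?thesis .
    qed
    show ?thesis
    proof
      show ?R if "s = ?S" unfolding that using v by simp
      show "s = ?S" if ?R by (rule separates[OF V s S]) (use that v in simp)
    qed
  qed
  have *: "d \<in> {..<r} \<rightarrow>\<^sub>E hol V \<and> s = (\<Oplus>\<^bsub>sec P V\<^esub>k\<in>{..<r}. d k \<odot>\<^bsub>sec P V\<^esub> res P U V (b k)) \<longleftrightarrow>
      d \<in> {..<r} \<rightarrow>\<^sub>E hol V \<and>
        (\<forall>y\<in>V. \<forall>i<m. \<nu> y V s i = (\<Sum>k<r. d k y * \<nu> y V (res P U V (b k)) i))" for d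
    by (rule conj_cong[OF refl]) (rule eq)
  show "\<exists>!d. d \<in> {..<r} \<rightarrow>\<^sub>E hol V \<and> s = (\<Oplus>\<^bsub>sec P V\<^esub>k\<in>{..<r}. d k \<odot>\<^bsub>sec P V\<^esub> res P U V (b k))"
    unfolding * by (rule ex1[OF V s])
qed

section \<open>Fibers\<close>

context framed begin

lemma val_inverse:
  assumes V: "open_in X V" and y: "y \<in> V" "y \<in> U" and s: "s \<in> carrier (sec F V)" and i: "i < r"
  shows "val y V (\<ominus>\<^bsub>sec F V\<^esub> s) i = - val y V s i"
proof -
  interpret V: abelian_group "sec F V" by (rule sec_group[OF V])
  have "val y V (\<ominus>\<^bsub>sec F V\<^esub> s \<oplus>\<^bsub>sec F V\<^esub> s) i = 0"
    using V.l_neg[OF s] val_zero[OF V y i] by simp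
  then show ?thesis
    using val_add[OF V y V.a_inv_closed[OF s] i s] by (simp add: eq_neg_iff_add_eq_0)
qed

lemma val_minus:
  assumes V: "open_in X V" and y: "y \<in> V" "y \<in> U" and s: "s \<in> carrier (sec F V)"
    and t: "t \<in> carrier (sec F V)" and i: "i < r"
  shows "val y V (s \<ominus>\<^bsub>sec F V\<^esub> t) i = val y V s i - val y V t i"
proof -
  interpret V: abelian_group "sec F V" by (rule sec_group[OF V])
  show ?thesis
    unfolding V.minus_eq val_add[OF V y s i V.a_inv_closed[OF t]] val_inverse[OF V y t i] by simp
qed

text \<open>A functional that is additive and evaluates scalars at \<open>y\<close> is determined by
  its values on the frame. It is applied to forms with one argument fixed and to coordinates in a
  second frame.\<close>

lemma val_expand:
  fixes \<nu> :: "'f \<Rightarrow> complex"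
  assumes V: "open_in X V" "V \<subseteq> U" and y: "y \<in> V" and s: "s \<in> carrier (sec F V)"
    and add: "\<And>s t. s \<in> carrier (sec F V) \<Longrightarrow> t \<in> carrier (sec F V) \<Longrightarrow> \<nu> (s \<oplus>\<^bsub>sec F V\<^esub> t) = \<nu> s + \<nu> t"
    and smult: "\<And>f s. f \<in> hol V \<Longrightarrow> s \<in> carrier (sec F V) \<Longrightarrow> \<nu> (f \<odot>\<^bsub>sec F V\<^esub> s) = f y * \<nu> s"
  shows "\<nu> s = (\<Sum>i<r. val y V s i * \<nu> (res F U V (e i)))"
proof -
  interpret V: Module.module "structure_sheaf X V" "sec F V" by (rule sec_module[OF V(1)])
  note c = coords_hol[OF V s]
  have "\<nu> s = \<nu> (combination V (coords V s))" using coords(2)[OF V s] by simp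
  also have "\<dots> = (\<Sum>i<r. \<nu> (coords V s i \<odot>\<^bsub>sec F V\<^esub> res F U V (e i)))"
    unfolding combination_def
    by (rule finsum_additive[OF V.M.abelian_group_axioms]) (use add c res_e_closed[OF V] in auto)
  also have "\<dots> = (\<Sum>i<r. val y V s i * \<nu> (res F U V (e i)))"
    by (rule sum.cong[OF refl]) (use smult c res_e_closed[OF V] val_eq_coords[OF V s] in auto)
  finally show ?thesis .
qed

lemma vanishing_span_val:
  assumes W: "open_in X W" and y: "y \<in> W" "y \<in> U" and s: "s \<in> vanishing_span X F y W"
  shows "s \<in> carrier (sec F W) \<and> (\<forall>i<r. val y W s i = 0)"
proof -
  interpret W: Module.module "structure_sheaf X W" "sec F W" by (rule sec_module[OF W])
  show ?thesis
    using s unfolding vanishing_span_def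
  proof induction
    case one
    then show ?case using val_zero[OF W y] by simp
  next
    case (incl h)
    then obtain f u where h: "h = f \<odot>\<^bsub>sec F W\<^esub> u" "f \<in> hol W" "f y = 0" "u \<in> carrier (sec F W)" by blast
    then show ?case using val_smult[OF W y h(4) _ h(2)] W.smult_closed[OF h(2,4)] by simp
  next
    case (inv h)
    then obtain f u where h: "h = f \<odot>\<^bsub>sec F W\<^esub> u" "f \<in> hol W" "f y = 0" "u \<in> carrier (sec F W)" by blast
    have hc: "h \<in> carrier (sec F W)" unfolding h(1) by (rule W.smult_closed[OF h(2,4)])
    have "inv\<^bsub>add_monoid (sec F W)\<^esub> h = \<ominus>\<^bsub>sec F W\<^esub> h" by (simp add: a_inv_def)
    then show ?case
      using val_inverse[OF W y hc] val_smult[OF W y h(4) _ h(2)] h W.M.a_inv_closed[OF hc] by simp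
  next
    case (eng h1 h2)
    then show ?case using val_add[OF W y] W.M.a_closed by simp
  qed
qed

text \<open>If all coordinates of \<open>s\<close> vanish at \<open>y\<close>, each term of its
  expansion in the frame is a function vanishing at \<open>y\<close> times a section, which is
  already a generator of the span.\<close>

lemma vanishing_spanI:
  assumes W: "open_in X W" "W \<subseteq> U" and y: "y \<in> W" and s: "s \<in> carrier (sec F W)"
    and zero: "\<And>i. i < r \<Longrightarrow> val y W s i = 0"
  shows "s \<in> vanishing_span X F y W"
proof -
  interpret W: Module.module "structure_sheaf X W" "sec F W" by (rule sec_module[OF W(1)])
  define t where "t i = coords W s i \<odot>\<^bsub>sec F W\<^esub> res F U W (e i)" for i
  have t: "t i \<in> vanishing_span X F y W" "t i \<in> carrier (sec F W)" if "i < r" for i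
  proof -
    have "coords W s i y = 0" using zero[OF that] val_eq_coords[OF W s] by simp
    then have "\<exists>f u. t i = f \<odot>\<^bsub>sec F W\<^esub> u \<and> f \<in> hol W \<and> f y = 0 \<and> u \<in> carrier (sec F W)"
      unfolding t_def using coords_hol[OF W s that] res_e_closed[OF W that] by blast
    then show "t i \<in> vanishing_span X F y W"
      unfolding vanishing_span_def by (intro generate.incl CollectI)
    show "t i \<in> carrier (sec F W)"
      unfolding t_def by (rule W.smult_closed[OF coords_hol[OF W s that] res_e_closed[OF W that]])
  qed
  have "finsum (sec F W) t A \<in> vanishing_span X F y W" if "finite A" "A \<subseteq> {..<r}" for A
    using that
  proof (induction A rule: finite_induct)
    case empty
    then show ?case using generate.one[of "add_monoid (sec F W)"] unfolding vanishing_span_def by simp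
  next
    case (insert i A)
    have "t \<in> A \<rightarrow> carrier (sec F W)" "t i \<in> carrier (sec F W)" using insert.prems t by auto
    then have "finsum (sec F W) t (insert i A) = t i \<oplus>\<^bsub>sec F W\<^esub> finsum (sec F W) t A"
      using insert.hyps by simp
    moreover have "t i \<in> vanishing_span X F y W" "finsum (sec F W) t A \<in> vanishing_span X F y W"
      using insert t by auto
    ultimately show ?case
      using generate.eng[of "t i" "add_monoid (sec F W)"] unfolding vanishing_span_def by simp
  qed
  from this[of "{..<r}"] show ?thesis
    using coords(2)[OF W s] unfolding combination_def t_def by simp
qed

section \<open>The fiber at a point as a coordinate space\<close>

context
  fixes y assumes y: "y \<in> U"
begin

text \<open>Over the domain of a frame, the span of the products with functions vanishing at
  \<open>y\<close> is exactly the set of sections with zero coordinates at \<open>y\<close>. A fiber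
  class is thus known from \<open>r\<close> complex numbers.\<close>

lemma at_point_mem:
  assumes V: "open_in X V" "y \<in> V" and s: "s \<in> carrier (sec F V)"
  shows "(V', t) \<in> at_point X F y V s \<longleftrightarrow>
    open_in X V' \<and> y \<in> V' \<and> t \<in> carrier (sec F V') \<and> (\<forall>i<r. val y V' t i = val y V s i)"
proof
  assume "(V', t) \<in> at_point X F y V s"
  then obtain W where V': "open_in X V'" "y \<in> V'" "t \<in> carrier (sec F V')"
    and W: "open_in X W" "y \<in> W" "W \<subseteq> V" "W \<subseteq> V'"
      "res F V W s \<ominus>\<^bsub>sec F W\<^esub> res F V' W t \<in> vanishing_span X F y W"
    unfolding at_point_def by auto
  have c: "res F V W s \<in> carrier (sec F W)" "res F V' W t \<in> carrier (sec F W)"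
    using res_closed V V' W s by auto
  have "val y V' t i = val y V s i" if i: "i < r" for i
    using vanishing_span_val[OF W(1,2) y W(5)] i val_minus[OF W(1,2) y c i]
      val_res[OF V y s i W(1,3,2)] val_res[OF V'(1,2) y V'(3) i W(1,4,2)] by simp
  then show "open_in X V' \<and> y \<in> V' \<and> t \<in> carrier (sec F V') \<and> (\<forall>i<r. val y V' t i = val y V s i)"
    using V' by simp
next
  assume "open_in X V' \<and> y \<in> V' \<and> t \<in> carrier (sec F V') \<and> (\<forall>i<r. val y V' t i = val y V s i)"
  then have V': "open_in X V'" "y \<in> V'" "t \<in> carrier (sec F V')"
    and eq: "\<And>i. i < r \<Longrightarrow> val y V' t i = val y V s i" by auto
  define W where "W = V \<inter> (V' \<inter> U)"
  have W: "open_in X W" "W \<subseteq> U" "y \<in> W" "W \<subseteq> V" "W \<subseteq> V'"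
    using V V' U_open y unfolding W_def by (auto intro: openin_Int)
  have c: "res F V W s \<in> carrier (sec F W)" "res F V' W t \<in> carrier (sec F W)"
    using res_closed V V' W s by auto
  interpret W: abelian_group "sec F W" by (rule sec_group[OF W(1)])
  have "res F V W s \<ominus>\<^bsub>sec F W\<^esub> res F V' W t \<in> vanishing_span X F y W"
  proof (rule vanishing_spanI[OF W(1-3) W.minus_closed[OF c]])
    fix i assume i: "i < r"
    show "val y W (res F V W s \<ominus>\<^bsub>sec F W\<^esub> res F V' W t) i = 0"
      unfolding val_minus[OF W(1,3) y c i] val_res[OF V y s i W(1,4,3)]
        val_res[OF V'(1,2) y V'(3) i W(1,5,3)] eq[OF i] by simp
  qed
  then show "(V', t) \<in> at_point X F y V s"
    unfolding at_point_def using V' W by auto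
qed

lemma at_point_eq_iff:
  assumes V: "open_in X V" "y \<in> V" "s \<in> carrier (sec F V)"
    and V': "open_in X V'" "y \<in> V'" "t \<in> carrier (sec F V')"
  shows "at_point X F y V s = at_point X F y V' t \<longleftrightarrow> (\<forall>i<r. val y V s i = val y V' t i)"
proof
  assume "at_point X F y V s = at_point X F y V' t"
  moreover have "(V, s) \<in> at_point X F y V s" using at_point_mem[OF V] V by simp
  ultimately show "\<forall>i<r. val y V s i = val y V' t i" using at_point_mem[OF V'] by simp
next
  assume eq: "\<forall>i<r. val y V s i = val y V' t i"
  show "at_point X F y V s = at_point X F y V' t"
  proof (rule Set.set_eqI)
    fix p
    show "p \<in> at_point X F y V s \<longleftrightarrow> p \<in> at_point X F y V' t"
      using eq by (cases p) (simp add: at_point_mem[OF V] at_point_mem[OF V'])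
  qed
qed

lemma at_point_self:
  assumes "open_in X V" "y \<in> V" "s \<in> carrier (sec F V)"
  shows "(V, s) \<in> at_point X F y V s"
  using at_point_mem[OF assms] assms by simp

lemma at_point_rep:
  assumes "(V', t) \<in> at_point X F y V s" "open_in X V" "y \<in> V" "s \<in> carrier (sec F V)"
  shows "open_in X V'" "y \<in> V'" "t \<in> carrier (sec F V')" "i < r \<Longrightarrow> val y V' t i = val y V s i"
  using assms(1) at_point_mem[OF assms(2-4)] by auto

text \<open>Evaluated on an arbitrary element of the class; all elements have the same coordinates
  at \<open>y\<close>.\<close>

definition fiber_val :: "('x set \<times> 'f) set \<Rightarrow> nat \<Rightarrow> complex" where
  "fiber_val v i = (case (SOME p. p \<in> v) of (V, s) \<Rightarrow> val y V s i)"

lemma fiber_val: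
  assumes "open_in X V" "y \<in> V" "s \<in> carrier (sec F V)" "i < r"
  shows "fiber_val (at_point X F y V s) i = val y V s i"
proof -
  obtain V' t where p: "(SOME p. p \<in> at_point X F y V s) = (V', t)" by (cases "SOME p. p \<in> at_point X F y V s")
  have "(SOME p. p \<in> at_point X F y V s) \<in> at_point X F y V s"
    by (rule someI) (rule at_point_self[OF assms(1-3)])
  then show ?thesis
    unfolding fiber_val_def p case_prod_conv by (rule at_point_rep(4)[OF _ assms])
qed

lemma fiber_carrierE:
  assumes "v \<in> carrier (fiber X F y)"
  obtains V s where "open_in X V" "y \<in> V" "s \<in> carrier (sec F V)" "v = at_point X F y V s"
  using assms unfolding fiber_def make_module_def by auto

lemma fiber_carrierI:
  "open_in X V \<Longrightarrow> y \<in> V \<Longrightarrow> s \<in> carrier (sec F V) \<Longrightarrow> at_point X F y V s \<in> carrier (fiber X F y)"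
  unfolding fiber_def make_module_def by auto

lemma fiber_ext:
  assumes "v \<in> carrier (fiber X F y)" "w \<in> carrier (fiber X F y)"
    and "\<And>i. i < r \<Longrightarrow> fiber_val v i = fiber_val w i"
  shows "v = w"
proof -
  obtain V s where v: "open_in X V" "y \<in> V" "s \<in> carrier (sec F V)" "v = at_point X F y V s"
    by (rule fiber_carrierE[OF assms(1)])
  obtain V' t where w: "open_in X V'" "y \<in> V'" "t \<in> carrier (sec F V')" "w = at_point X F y V' t"
    by (rule fiber_carrierE[OF assms(2)])
  show ?thesis
    using assms(3) unfolding v(4) w(4) at_point_eq_iff[OF v(1-3) w(1-3)]
    by (simp add: fiber_val[OF v(1-3)] fiber_val[OF w(1-3)])
qed

lemma UN_at_point_eq:
  assumes "A \<noteq> {}" "\<And>V s. (V, s) \<in> A \<Longrightarrow> f V s = B"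
  shows "(\<Union>(V, s)\<in>A. f V s) = B"
  using assms by auto

text \<open>The union in the definition of the sum collapses because the coordinates of each
  candidate sum depend only on the two classes.\<close>

lemma fiber_add_at_point:
  assumes V: "open_in X V" "y \<in> V" "s \<in> carrier (sec F V)"
    and W: "open_in X W" "y \<in> W" "t \<in> carrier (sec F W)"
  shows "at_point X F y V s \<oplus>\<^bsub>fiber X F y\<^esub> at_point X F y W t
    = at_point X F y (V \<inter> W) (res F V (V \<inter> W) s \<oplus>\<^bsub>sec F (V \<inter> W)\<^esub> res F W (V \<inter> W) t)"
proof -
  have *: "V1 \<inter> V2 \<subseteq> V1" "V1 \<inter> V2 \<subseteq> V2" for V1 V2 :: "'x set" by auto
  have sum: "open_in X (V1 \<inter> V2)" "y \<in> V1 \<inter> V2"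
      "res F V1 (V1 \<inter> V2) s1 \<oplus>\<^bsub>sec F (V1 \<inter> V2)\<^esub> res F V2 (V1 \<inter> V2) s2 \<in> carrier (sec F (V1 \<inter> V2))"
      "i < r \<Longrightarrow> val y (V1 \<inter> V2) (res F V1 (V1 \<inter> V2) s1 \<oplus>\<^bsub>sec F (V1 \<inter> V2)\<^esub> res F V2 (V1 \<inter> V2) s2) i
        = val y V1 s1 i + val y V2 s2 i"
    if 1: "open_in X V1" "y \<in> V1" "s1 \<in> carrier (sec F V1)" and 2: "open_in X V2" "y \<in> V2" "s2 \<in> carrier (sec F V2)"
    for V1 V2 s1 s2 i
  proof -
    show o: "open_in X (V1 \<inter> V2)" "y \<in> V1 \<inter> V2" using 1 2 by (auto intro: openin_Int)
    note c = res_closed[OF 1(1) o(1) *(1) 1(3)] res_closed[OF 2(1) o(1) *(2) 2(3)]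
    show "res F V1 (V1 \<inter> V2) s1 \<oplus>\<^bsub>sec F (V1 \<inter> V2)\<^esub> res F V2 (V1 \<inter> V2) s2 \<in> carrier (sec F (V1 \<inter> V2))"
      by (rule sec_add_closed[OF o(1) c])
    show "val y (V1 \<inter> V2) (res F V1 (V1 \<inter> V2) s1 \<oplus>\<^bsub>sec F (V1 \<inter> V2)\<^esub> res F V2 (V1 \<inter> V2) s2) i
        = val y V1 s1 i + val y V2 s2 i" if i: "i < r"
      unfolding val_add[OF o y c(1) i c(2)] val_res[OF 1(1,2) y 1(3) i o(1) *(1) o(2)]
        val_res[OF 2(1,2) y 2(3) i o(1) *(2) o(2)] by (rule refl)
  qed
  have eq: "at_point X F y (V1 \<inter> V2) (res F V1 (V1 \<inter> V2) s1 \<oplus>\<^bsub>sec F (V1 \<inter> V2)\<^esub> res F V2 (V1 \<inter> V2) s2)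
      = at_point X F y (V \<inter> W) (res F V (V \<inter> W) s \<oplus>\<^bsub>sec F (V \<inter> W)\<^esub> res F W (V \<inter> W) t)"
    if m: "(V1, s1) \<in> at_point X F y V s" "(V2, s2) \<in> at_point X F y W t" for V1 s1 V2 s2
  proof -
    note 1 = at_point_rep[OF m(1) V] and 2 = at_point_rep[OF m(2) W]
    show ?thesis
      unfolding at_point_eq_iff[OF sum(1-3)[OF 1(1-3) 2(1-3)] sum(1-3)[OF V W]]
      by (simp add: sum(4)[OF 1(1-3) 2(1-3)] sum(4)[OF V W] 1(4) 2(4))
  qed
  show ?thesis
    unfolding fiber_def make_module_def ring.simps
  proof (rule UN_at_point_eq)
    fix V1 s1 assume m1: "(V1, s1) \<in> at_point X F y V s"
    show "(\<Union>(V2, s2)\<in>at_point X F y W t. at_point X F y (V1 \<inter> V2)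
        (res F V1 (V1 \<inter> V2) s1 \<oplus>\<^bsub>sec F (V1 \<inter> V2)\<^esub> res F V2 (V1 \<inter> V2) s2))
      = at_point X F y (V \<inter> W) (res F V (V \<inter> W) s \<oplus>\<^bsub>sec F (V \<inter> W)\<^esub> res F W (V \<inter> W) t)"
      by (rule UN_at_point_eq) (use at_point_self[OF W] eq[OF m1] in auto)
  qed (use at_point_self[OF V] in auto)
qed

lemma fiber_smult_at_point:
  assumes V: "open_in X V" "y \<in> V" "s \<in> carrier (sec F V)"
  shows "a \<odot>\<^bsub>fiber X F y\<^esub> at_point X F y V s = at_point X F y V ((\<lambda>z\<in>V. a) \<odot>\<^bsub>sec F V\<^esub> s)"
  unfolding fiber_def make_module_def module.simps
proof (rule UN_at_point_eq)
  fix V1 s1 assume m: "(V1, s1) \<in> at_point X F y V s"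
  note 1 = at_point_rep[OF m V]
  note c = sec_smult_closed[OF 1(1) hol_const 1(3)] sec_smult_closed[OF V(1) hol_const V(3)]
  show "at_point X F y V1 ((\<lambda>z\<in>V1. a) \<odot>\<^bsub>sec F V1\<^esub> s1) = at_point X F y V ((\<lambda>z\<in>V. a) \<odot>\<^bsub>sec F V\<^esub> s)"
    unfolding at_point_eq_iff[OF 1(1,2) c(1) V(1,2) c(2)]
    using val_smult[OF 1(1,2) y 1(3) _ hol_const] val_smult[OF V(1,2) y V(3) _ hol_const] 1(2,4) V(2) by simp
qed (use at_point_self[OF V] in auto)

lemma fiber_zero_val: "\<zero>\<^bsub>fiber X F y\<^esub> \<in> carrier (fiber X F y)" "i < r \<Longrightarrow> fiber_val \<zero>\<^bsub>fiber X F y\<^esub> i = 0"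
proof -
  have yt: "y \<in> topspace (points X)" using y U_open openin_subset by blast
  have z: "\<zero>\<^bsub>fiber X F y\<^esub> = at_point X F y (topspace (points X)) \<zero>\<^bsub>sec F (topspace (points X))\<^esub>"
    by (simp add: fiber_def make_module_def)
  have zc: "\<zero>\<^bsub>sec F (topspace (points X))\<^esub> \<in> carrier (sec F (topspace (points X)))"
    by (rule sec_zero_closed) simp
  show "\<zero>\<^bsub>fiber X F y\<^esub> \<in> carrier (fiber X F y)"
    unfolding z by (rule fiber_carrierI[OF _ yt zc]) simp
  show "fiber_val \<zero>\<^bsub>fiber X F y\<^esub> i = 0" if "i < r"
    unfolding z using fiber_val[OF _ yt zc that] val_zero[OF _ yt y that] by simp
qed

lemma fiber_add_val:
  assumes "v \<in> carrier (fiber X F y)" "w \<in> carrier (fiber X F y)"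
  shows "v \<oplus>\<^bsub>fiber X F y\<^esub> w \<in> carrier (fiber X F y)"
    "i < r \<Longrightarrow> fiber_val (v \<oplus>\<^bsub>fiber X F y\<^esub> w) i = fiber_val v i + fiber_val w i"
proof -
  obtain V s where v: "open_in X V" "y \<in> V" "s \<in> carrier (sec F V)" "v = at_point X F y V s"
    by (rule fiber_carrierE[OF assms(1)])
  obtain W t where w: "open_in X W" "y \<in> W" "t \<in> carrier (sec F W)" "w = at_point X F y W t"
    by (rule fiber_carrierE[OF assms(2)])
  have o: "open_in X (V \<inter> W)" "y \<in> V \<inter> W" "V \<inter> W \<subseteq> V" "V \<inter> W \<subseteq> W" using v w by (auto intro: openin_Int)
  note c = res_closed[OF v(1) o(1,3) v(3)] res_closed[OF w(1) o(1,4) w(3)]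
  note a = sec_add_closed[OF o(1) c]
  show "v \<oplus>\<^bsub>fiber X F y\<^esub> w \<in> carrier (fiber X F y)"
    unfolding v(4) w(4) fiber_add_at_point[OF v(1-3) w(1-3)] by (rule fiber_carrierI[OF o(1,2) a])
  show "fiber_val (v \<oplus>\<^bsub>fiber X F y\<^esub> w) i = fiber_val v i + fiber_val w i" if i: "i < r"
    unfolding v(4) w(4) fiber_add_at_point[OF v(1-3) w(1-3)] fiber_val[OF o(1,2) a i]
      fiber_val[OF v(1-3) i] fiber_val[OF w(1-3) i] val_add[OF o(1,2) y c(1) i c(2)]
      val_res[OF v(1,2) y v(3) i o(1,3,2)] val_res[OF w(1,2) y w(3) i o(1,4,2)] by (rule refl)
qed

lemma fiber_smult_val:
  assumes "v \<in> carrier (fiber X F y)"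
  shows "a \<odot>\<^bsub>fiber X F y\<^esub> v \<in> carrier (fiber X F y)"
    "i < r \<Longrightarrow> fiber_val (a \<odot>\<^bsub>fiber X F y\<^esub> v) i = a * fiber_val v i"
proof -
  obtain V s where v: "open_in X V" "y \<in> V" "s \<in> carrier (sec F V)" "v = at_point X F y V s"
    by (rule fiber_carrierE[OF assms])
  note c = sec_smult_closed[OF v(1) hol_const v(3)]
  show "a \<odot>\<^bsub>fiber X F y\<^esub> v \<in> carrier (fiber X F y)"
    unfolding v(4) fiber_smult_at_point[OF v(1-3)] by (rule fiber_carrierI[OF v(1,2) c])
  show "fiber_val (a \<odot>\<^bsub>fiber X F y\<^esub> v) i = a * fiber_val v i" if i: "i < r"
    unfolding v(4) fiber_smult_at_point[OF v(1-3)] fiber_val[OF v(1,2) c i] fiber_val[OF v(1-3) i]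
      val_smult[OF v(1,2) y v(3) i hol_const] using v(2) by simp
qed

lemma fiber_val_surj:
  obtains v where "v \<in> carrier (fiber X F y)" "\<And>i. i < r \<Longrightarrow> fiber_val v i = c i"
proof -
  have h: "(\<lambda>z\<in>U. c i) \<in> hol U" for i by (rule hol_const)
  obtain s where s: "s \<in> carrier (sec F U)" "\<And>z i. z \<in> U \<Longrightarrow> i < r \<Longrightarrow> val z U s i = (\<lambda>z\<in>U. c i) z"
    using val_section[OF U_open order_refl, of "\<lambda>i. \<lambda>z\<in>U. c i"] h by blast
  show ?thesis
    by (rule that[OF fiber_carrierI[OF U_open y s(1)]]) (use fiber_val[OF U_open y s(1)] s(2) y in simp)
qed

text \<open>Coordinates separate the points of the fiber and turn its operations into those of
  complex numbers, so the group laws are inherited; the inverse is multiplication by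
  \<open>- 1\<close>.\<close>

lemma fiber_group: "abelian_group (fiber X F y)"
proof (rule abelian_groupI)
  fix v assume v: "v \<in> carrier (fiber X F y)"
  show "\<exists>w\<in>carrier (fiber X F y). w \<oplus>\<^bsub>fiber X F y\<^esub> v = \<zero>\<^bsub>fiber X F y\<^esub>"
  proof (rule bexI)
    note c = fiber_smult_val(1)[OF v, of "- 1"]
    show "(- 1) \<odot>\<^bsub>fiber X F y\<^esub> v \<oplus>\<^bsub>fiber X F y\<^esub> v = \<zero>\<^bsub>fiber X F y\<^esub>"
      by (rule fiber_ext[OF fiber_add_val(1)[OF c v] fiber_zero_val(1)])
        (simp add: fiber_add_val(2)[OF c v] fiber_smult_val(2)[OF v] fiber_zero_val(2))
    show "(- 1) \<odot>\<^bsub>fiber X F y\<^esub> v \<in> carrier (fiber X F y)" by (rule c)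
  qed
qed ((rule fiber_ext; simp add: fiber_zero_val fiber_add_val add_ac | simp add: fiber_zero_val fiber_add_val)+)

lemma fiber_val_finsum:
  assumes "finite A" "\<And>k. k \<in> A \<Longrightarrow> f k \<in> carrier (fiber X F y)" "i < r"
  shows "fiber_val (finsum (fiber X F y) f A) i = (\<Sum>k\<in>A. fiber_val (f k) i)"
  by (rule finsum_additive[where \<nu> = "\<lambda>v. fiber_val v i", OF fiber_group assms(1,2)])
    (use fiber_add_val(2)[OF _ _ assms(3)] in auto)

lemma fiber_projection_zero_iff:
  assumes S: "subgroup S (add_monoid (fiber X F y))" and V: "open_in X V" "y \<in> V" and s: "s \<in> carrier (sec F V)"
  shows "fiber_projection X F y S V s = \<zero>\<^bsub>sec (fiber_quotient_sheaf X F y S) V\<^esub> \<longleftrightarrow> at_point X F y V s \<in> S"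
proof -
  interpret A: abelian_group "fiber X F y" by (rule fiber_group)
  have v: "at_point X F y V s \<in> carrier (add_monoid (fiber X F y))"
    using fiber_carrierI[OF V s] by simp
  have z: "\<zero>\<^bsub>sec (fiber_quotient_sheaf X F y S) V\<^esub> = S"
    by (simp add: fiber_quotient_sheaf_def skyscraper_def quotient_module_def make_module_def)
  have "S #>\<^bsub>add_monoid (fiber X F y)\<^esub> at_point X F y V s = S \<longleftrightarrow> at_point X F y V s \<in> S"
    using group.coset_join1[OF A.a_group _ v S] group.coset_join2[OF A.a_group v S]
      subgroup.subset[OF S] by blast
  then show ?thesis using V(2) unfolding z by (simp add: fiber_projection_def a_r_coset_def)
qed

end

end

section \<open>Square matrices of complex numbers\<close>

lemma mat_prod_entry:
  assumes "i < N" "j < N"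
  shows "(Matrix.mat N N A * Matrix.mat N N B) $$ (i, j) = (\<Sum>k<N. A (i, k) * B (k, j) :: complex)"
  using assms by (simp add: times_mat_def scalar_prod_def atLeast0LessThan)

text \<open>A matrix is a plain function of which only the entries with indices below
  \<open>n\<close> and \<open>N\<close> count, so that coordinates of frames and Gram functions can
  be inserted directly.\<close>

definition independent_rows :: "nat \<Rightarrow> nat \<Rightarrow> (nat \<Rightarrow> nat \<Rightarrow> complex) \<Rightarrow> bool" where
  "independent_rows n N b \<longleftrightarrow>
     (\<forall>c. (\<forall>i<N. (\<Sum>k<n. c k * b k i) = 0) \<longrightarrow> (\<forall>k<n. c k = 0))"

lemma independent_rowsD:
  "independent_rows n N b \<Longrightarrow> (\<And>i. i < N \<Longrightarrow> (\<Sum>k<n. c k * b k i) = 0) \<Longrightarrow> k < n \<Longrightarrow> c k = 0"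
  unfolding independent_rows_def by simp

lemma independent_rowsI:
  "(\<And>c k. (\<And>i. i < N \<Longrightarrow> (\<Sum>k<n. c k * b k i) = 0) \<Longrightarrow> k < n \<Longrightarrow> c k = 0) \<Longrightarrow> independent_rows n N b"
  unfolding independent_rows_def by simp

text \<open>Independence of the rows is injectivity of the transpose, so the determinant is nonzero,
  and the adjugate divided by it is a two-sided inverse.\<close>

lemma independent_rows_inverse:
  assumes ind: "independent_rows N N A"
  obtains C where "\<And>k l. k < N \<Longrightarrow> l < N \<Longrightarrow> (\<Sum>i<N. A k i * C i l) = (if k = l then 1 else 0)"
    "\<And>i j. i < N \<Longrightarrow> j < N \<Longrightarrow> (\<Sum>k<N. C i k * A k j) = (if i = j then 1 else 0)"
proof -
  define M where "M = Matrix.mat N N (\<lambda>(k, i). A k i)"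
  have M: "M \<in> carrier_mat N N" by (simp add: M_def)
  have "Determinant.det (transpose_mat M) \<noteq> 0"
  proof
    assume "Determinant.det (transpose_mat M) = 0"
    then obtain v where v: "v \<in> carrier_vec N" "v \<noteq> 0\<^sub>v N" "transpose_mat M *\<^sub>v v = 0\<^sub>v N"
      using det_0_iff_vec_prod_zero_field[of "transpose_mat M" N] M by auto
    have z: "(\<Sum>k<N. vec_index v k * A k i) = 0" if i: "i < N" for i
    proof -
      have "vec_index (transpose_mat M *\<^sub>v v) i = (\<Sum>k<N. A k i * vec_index v k)"
        using i v(1) M by (simp add: M_def scalar_prod_def atLeast0LessThan)
      then show "(\<Sum>k<N. vec_index v k * A k i) = 0" using v(3) i by (simp add: mult.commute)
    qed
    have "vec_index v k = 0" if "k < N" for k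
      using independent_rowsD[OF ind z that] .
    then have "v = 0\<^sub>v N" using v(1) by (intro eq_vecI) auto
    then show False using v(2) by simp
  qed
  then have d: "Determinant.det M \<noteq> 0" using Determinant.det_transpose[OF M] by simp
  define C where "C i k = adj_mat M $$ (i, k) / Determinant.det M" for i k
  have adj: "adj_mat M \<in> carrier_mat N N" "M * adj_mat M = Determinant.det M \<cdot>\<^sub>m 1\<^sub>m N" "adj_mat M * M = Determinant.det M \<cdot>\<^sub>m 1\<^sub>m N"
    by (rule adj_mat[OF M])+
  show ?thesis
  proof (rule that)
    fix k l assume kl: "k < N" "l < N"
    have "(M * adj_mat M) $$ (k, l) = (\<Sum>i<N. A k i * adj_mat M $$ (i, l))"
      using kl adj(1) M by (simp add: M_def times_mat_def scalar_prod_def atLeast0LessThan)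
    then have "(\<Sum>i<N. A k i * adj_mat M $$ (i, l)) = (if k = l then Determinant.det M else 0)"
      unfolding adj(2) using kl by (cases "k = l") simp_all
    then show "(\<Sum>i<N. A k i * C i l) = (if k = l then 1 else 0)"
      using d by (simp add: C_def flip: sum_divide_distrib)
    have "(adj_mat M * M) $$ (k, l) = (\<Sum>i<N. adj_mat M $$ (k, i) * A i l)"
      using kl adj(1) M by (simp add: M_def times_mat_def scalar_prod_def atLeast0LessThan)
    then have "(\<Sum>i<N. adj_mat M $$ (k, i) * A i l) = (if k = l then Determinant.det M else 0)"
      unfolding adj(3) using kl by (cases "k = l") simp_all
    then show "(\<Sum>i<N. C k i * A i l) = (if k = l then 1 else 0)"
      using d by (simp add: C_def flip: sum_divide_distrib)
  qed
qed

text \<open>A left inverse \<open>C\<close> of \<open>B\<close> exists, so \<open>B v = 0\<close>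
  yields \<open>v = C (B v) = 0\<close>.\<close>

lemma independent_rows_imp_independent_columns:
  assumes ind: "independent_rows n n B"
    and v: "\<And>j. j < n \<Longrightarrow> (\<Sum>k<n. B j k * v k) = 0" and k: "k < n"
  shows "v k = 0"
proof -
  obtain C where C: "\<And>i j. i < n \<Longrightarrow> j < n \<Longrightarrow> (\<Sum>k<n. C i k * B k j) = (if i = j then 1 else 0)"
    using independent_rows_inverse[OF ind] by metis
  have "v k = (\<Sum>j<n. (if k = j then 1 else 0) * v j)"
    using k by (simp add: if_distrib[of "\<lambda>a. a * _"] cong: if_cong)
  also have "\<dots> = (\<Sum>j<n. (\<Sum>l<n. C k l * B l j) * v j)"
    by (rule sum.cong[OF refl]) (use C k in simp)
  also have "\<dots> = (\<Sum>j<n. \<Sum>l<n. C k l * (B l j * v j))"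
    by (simp add: sum_distrib_right mult.assoc)
  also have "\<dots> = (\<Sum>l<n. \<Sum>j<n. C k l * (B l j * v j))" by (rule sum.swap)
  also have "\<dots> = 0" using v by (simp flip: sum_distrib_left)
  finally show ?thesis .
qed

text \<open>If all \<open>N\<close> unit vectors were combinations of \<open>n < N\<close> rows,
  padding with zeros would give square matrices with \<open>D b = 1\<close>, hence
  \<open>b D = 1\<close>. But row \<open>n\<close> of the padded \<open>b\<close> is zero, which
  contradicts the diagonal entry 1.\<close>

lemma unit_vector_outside_span:
  fixes b :: "nat \<Rightarrow> nat \<Rightarrow> complex"
  assumes "n < N"
  shows "\<exists>i<N. \<not> (\<exists>d. \<forall>j<N. (if i = j then 1 else 0) = (\<Sum>k<n. d k * b k j))"
proof (rule ccontr)
  assume "\<not> ?thesis"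
  then have "\<forall>i. \<exists>d. i < N \<longrightarrow> (\<forall>j<N. (if i = j then 1 else 0) = (\<Sum>k<n. d k * b k j))" by blast
  from choice[OF this] obtain D where
    D: "\<And>i j. i < N \<Longrightarrow> j < N \<Longrightarrow> (if i = j then 1 else 0) = (\<Sum>k<n. D i k * b k j)" by blast
  let ?D = "\<lambda>(i, k). if k < n then D i k else 0" and ?b = "\<lambda>(k, j). if k < n then b k j else 0"
  have "Matrix.mat N N ?D * Matrix.mat N N ?b = 1\<^sub>m N"
  proof (rule eq_matI)
    fix i j assume "i < dim_row (1\<^sub>m N :: complex mat)" "j < dim_col (1\<^sub>m N :: complex mat)"
    then have ij: "i < N" "j < N" by auto
    have "(\<Sum>k<N. ?D (i, k) * ?b (k, j)) = (\<Sum>k<n. D i k * b k j)"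
      by (rule sum.mono_neutral_cong_right) (use assms in auto)
    then show "(Matrix.mat N N ?D * Matrix.mat N N ?b) $$ (i, j) = 1\<^sub>m N $$ (i, j)"
      unfolding mat_prod_entry[OF ij] using D[OF ij] ij by simp
  qed auto
  then have "Matrix.mat N N ?b * Matrix.mat N N ?D = 1\<^sub>m N"
    by (rule mat_mult_left_right_inverse[rotated 2]) auto
  then have "(Matrix.mat N N ?b * Matrix.mat N N ?D) $$ (n, n) = 1" using assms by simp
  then show False unfolding mat_prod_entry[OF assms assms] by simp
qed

text \<open>Basis extension by induction on the number of missing rows: each new row, placed at
  index \<open>n\<close>, is a unit vector outside the span of the rows present. A relation with
  nonzero coefficient at \<open>n\<close> would place that vector in the span.\<close>

lemma extend_independent_rows:
  assumes "n \<le> N" "independent_rows n N b"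
  shows "\<exists>A. (\<forall>k<n. A k = b k) \<and> independent_rows N N A"
  using assms
proof (induction "N - n" arbitrary: n b)
  case 0
  then show ?case by (intro exI[of _ b]) simp
next
  case (Suc m)
  then have n: "n < N" "m = N - Suc n" by auto
  obtain i where i: "i < N" "\<not> (\<exists>d. \<forall>j<N. (if i = j then 1 else 0) = (\<Sum>k<n. d k * b k j))"
    using unit_vector_outside_span[OF n(1), of b] by blast
  define b' where "b' = b(n := \<lambda>j. if i = j then 1 else 0)"
  have b': "(\<Sum>k<Suc n. c k * b' k j) = (\<Sum>k<n. c k * b k j) + c n * (if i = j then 1 else 0)" for c j
    by (simp add: b'_def)
  have "independent_rows (Suc n) N b'"
  proof (rule independent_rowsI)
    fix c k assume c: "\<And>j. j < N \<Longrightarrow> (\<Sum>k<Suc n. c k * b' k j) = 0" and k: "k < Suc n"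
    have "c n = 0"
    proof (rule ccontr)
      assume cn: "c n \<noteq> 0"
      have "(if i = j then 1 else 0) = (\<Sum>k<n. (- c k / c n) * b k j)" if j: "j < N" for j
      proof -
        have "c n * (\<Sum>k<n. (- c k / c n) * b k j) = - (\<Sum>k<n. c k * b k j)"
          using cn by (simp add: sum_distrib_left sum_negf)
        also have "(\<Sum>k<n. c k * b k j) = - (c n * (if i = j then 1 else 0))"
          using c[OF j] unfolding b' by (simp only: eq_neg_iff_add_eq_0)
        finally show ?thesis using cn by simp
      qed
      then have "\<exists>d. \<forall>j<N. (if i = j then 1 else 0) = (\<Sum>k<n. d k * b k j)"
        by (intro exI[of _ "\<lambda>k. - c k / c n"]) simp
      with i(2) show False by (rule notE)
    qed
    then have "(\<Sum>k<n. c k * b k j) = 0" if "j < N" for j using c[OF that] unfolding b' by simp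
    then have "k < n \<Longrightarrow> c k = 0" by (rule independent_rowsD[OF Suc.prems(2)])
    then show "c k = 0" using \<open>c n = 0\<close> k by (cases "k = n") simp_all
  qed
  from Suc.hyps(1)[OF n(2) _ this] n(1)
  obtain A where A: "\<And>k. k < Suc n \<Longrightarrow> A k = b' k" "independent_rows N N A" by auto
  have "A k = b k" if "k < n" for k using A(1)[of k] that by (simp add: b'_def)
  then show ?case using A(2) by blast
qed

section \<open>Bilinear forms in coordinates\<close>

locale framed_form = F: framed X F r U e + M: framed X M 1 U l +
    B: bilinear X F F M "\<lambda>V s t. \<psi> V (pure_tensor X F F V s t)"
  for X :: "'x surface" and F :: "('x, 'f) msheaf" and M :: "('x, 'm) msheaf"
    and \<psi> :: "'x set \<Rightarrow> ('x, 'f, 'f) tensor_section \<Rightarrow> 'm"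
    and r :: nat and U :: "'x set" and e :: "nat \<Rightarrow> 'f" and l :: "nat \<Rightarrow> 'm"
begin

abbreviation form :: "'x set \<Rightarrow> 'f \<Rightarrow> 'f \<Rightarrow> 'm"
  where "form V s t \<equiv> \<psi> V (pure_tensor X F F V s t)"

text \<open>The values lie in a line bundle with a frame of one member, whence the single coordinate
  index \<open>0\<close>.\<close>

definition gram :: "nat \<Rightarrow> nat \<Rightarrow> 'x \<Rightarrow> complex"
  where "gram i j y = M.val y U (form U (e i) (e j)) 0"

text \<open>After restriction to the domain of the frames, \<open>val_expand\<close> is applied in
  each argument; the remaining values of the form on frame members are the Gram entries.\<close>

lemma form_val:
  assumes V: "open_in X V" and y: "y \<in> V" "y \<in> U" and s: "s \<in> carrier (sec F V)" and t: "t \<in> carrier (sec F V)"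
  shows "M.val y V (form V s t) 0 = (\<Sum>i<r. \<Sum>j<r. F.val y V s i * F.val y V t j * gram i j y)"
proof -
  define I where "I = V \<inter> U"
  have I: "open_in X I" "I \<subseteq> U" "I \<subseteq> V" "y \<in> I"
    using V y F.U_open unfolding I_def by (auto intro: openin_Int)
  define s' where "s' = res F V I s"
  define t' where "t' = res F V I t"
  have s': "s' \<in> carrier (sec F I)" and t': "t' \<in> carrier (sec F I)"
    unfolding s'_def t'_def using F.res_closed[OF V I(1,3)] s t by auto
  have re: "res F U I (e i) \<in> carrier (sec F I)" if "i < r" for i by (rule F.res_e_closed[OF I(1,2) that])
  have one: "(0::nat) < 1" by simp
  note ma = M.val_add[OF I(1,4) y(2) _ one] and ms = M.val_smult[OF I(1,4) y(2) _ one]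
  have "M.val y V (form V s t) 0 = M.val y I (res M V I (form V s t)) 0"
    by (rule M.val_res[OF V y B.closed[OF V s t] one I(1,3,4), symmetric])
  also have "\<dots> = M.val y I (form I s' t') 0"
    unfolding s'_def t'_def B.restricts[OF V I(1,3) s t] by (rule refl)
  also have "\<dots> = (\<Sum>i<r. F.val y I s' i * M.val y I (form I (res F U I (e i)) t') 0)"
    by (rule F.val_expand[where \<nu> = "\<lambda>s. M.val y I (form I s t') 0", OF I(1,2,4) s'])
      (use t' in \<open>simp_all add: B.add_left[OF I(1)] B.smult_left[OF I(1)] ma ms B.closed[OF I(1)] del: One_nat_def\<close>)
  also have "\<dots> = (\<Sum>i<r. F.val y I s' i * (\<Sum>j<r. F.val y I t' j * gram i j y))"
  proof (rule sum.cong[OF refl])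
    fix i assume "i \<in> {..<r}"
    then have i: "i < r" by simp
    have "M.val y I (form I (res F U I (e i)) t') 0
      = (\<Sum>j<r. F.val y I t' j * M.val y I (form I (res F U I (e i)) (res F U I (e j))) 0)"
      by (rule F.val_expand[where \<nu> = "\<lambda>t. M.val y I (form I (res F U I (e i)) t) 0", OF I(1,2,4) t'])
        (use re[OF i] in \<open>simp_all add: B.add_right[OF I(1)] B.smult_right[OF I(1)] ma ms B.closed[OF I(1)] del: One_nat_def\<close>)
    also have "\<dots> = (\<Sum>j<r. F.val y I t' j * gram i j y)"
    proof (rule sum.cong[OF refl])
      fix j assume "j \<in> {..<r}"
      then have j: "j < r" by simp
      show "F.val y I t' j * M.val y I (form I (res F U I (e i)) (res F U I (e j))) 0 = F.val y I t' j * gram i j y"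
        unfolding gram_def B.restricts[OF F.U_open I(1,2) F.e_closed[OF i] F.e_closed[OF j]]
          M.val_res[OF F.U_open y(2) y(2) B.closed[OF F.U_open F.e_closed[OF i] F.e_closed[OF j]] one I(1,2,4)]
        by (rule refl)
    qed
    finally show "F.val y I s' i * M.val y I (form I (res F U I (e i)) t') 0
      = F.val y I s' i * (\<Sum>j<r. F.val y I t' j * gram i j y)" by simp
  qed
  also have "\<dots> = (\<Sum>i<r. \<Sum>j<r. F.val y V s i * F.val y V t j * gram i j y)"
    unfolding s'_def t'_def
    by (intro sum.cong refl) (simp add: sum_distrib_left mult.assoc F.val_res[OF V y s _ I(1,3,4)] F.val_res[OF V y t _ I(1,3,4)])
  finally show ?thesis .
qed

text \<open>The value of the fiber form is a class in the fiber of a line bundle, so it is zero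
  exactly if its one coordinate is, and \<open>form_val\<close> computes that coordinate. The same
  formula shows that the union over representatives is a single class.\<close>

lemma fiber_form_zero_iff:
  assumes y: "y \<in> U" and v: "v \<in> carrier (fiber X F y)" and w: "w \<in> carrier (fiber X F y)"
  shows "fiber_form X F M \<psi> y v w = \<zero>\<^bsub>fiber X M y\<^esub> \<longleftrightarrow>
    (\<Sum>i<r. \<Sum>j<r. F.fiber_val y v i * F.fiber_val y w j * gram i j y) = 0"
proof -
  obtain V s where V: "open_in X V" "y \<in> V" "s \<in> carrier (sec F V)" "v = at_point X F y V s"
    by (rule F.fiber_carrierE[OF y v])
  obtain W t where W: "open_in X W" "y \<in> W" "t \<in> carrier (sec F W)" "w = at_point X F y W t"
    by (rule F.fiber_carrierE[OF y w])
  have sub: "V1 \<inter> V2 \<subseteq> V1" "V1 \<inter> V2 \<subseteq> V2" for V1 V2 :: "'x set" by auto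
  have one: "(0::nat) < 1" by simp
  define \<Phi> where "\<Phi> V1 s1 V2 s2 = form (V1 \<inter> V2) (res F V1 (V1 \<inter> V2) s1) (res F V2 (V1 \<inter> V2) s2)" for V1 s1 V2 s2
  have sum: "open_in X (V1 \<inter> V2)" "y \<in> V1 \<inter> V2" "\<Phi> V1 s1 V2 s2 \<in> carrier (sec M (V1 \<inter> V2))"
      "M.val y (V1 \<inter> V2) (\<Phi> V1 s1 V2 s2) 0 = (\<Sum>i<r. \<Sum>j<r. F.val y V1 s1 i * F.val y V2 s2 j * gram i j y)"
    if 1: "open_in X V1" "y \<in> V1" "s1 \<in> carrier (sec F V1)" and 2: "open_in X V2" "y \<in> V2" "s2 \<in> carrier (sec F V2)"
    for V1 V2 s1 s2
  proof -
    show o: "open_in X (V1 \<inter> V2)" "y \<in> V1 \<inter> V2" using 1 2 by (auto intro: openin_Int)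
    note c = F.res_closed[OF 1(1) o(1) sub(1) 1(3)] F.res_closed[OF 2(1) o(1) sub(2) 2(3)]
    show "\<Phi> V1 s1 V2 s2 \<in> carrier (sec M (V1 \<inter> V2))" unfolding \<Phi>_def by (rule B.closed[OF o(1) c])
    show "M.val y (V1 \<inter> V2) (\<Phi> V1 s1 V2 s2) 0 = (\<Sum>i<r. \<Sum>j<r. F.val y V1 s1 i * F.val y V2 s2 j * gram i j y)"
      unfolding \<Phi>_def form_val[OF o y c]
      by (intro sum.cong refl) (simp add: F.val_res[OF 1(1,2) y 1(3) _ o(1) sub(1) o(2)] F.val_res[OF 2(1,2) y 2(3) _ o(1) sub(2) o(2)])
  qed
  have eq: "at_point X M y (V1 \<inter> V2) (\<Phi> V1 s1 V2 s2) = at_point X M y (V \<inter> W) (\<Phi> V s W t)"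
    if m: "(V1, s1) \<in> at_point X F y V s" "(V2, s2) \<in> at_point X F y W t" for V1 s1 V2 s2
  proof -
    note 1 = F.at_point_rep[OF y m(1) V(1-3)] and 2 = F.at_point_rep[OF y m(2) W(1-3)]
    show ?thesis
      unfolding M.at_point_eq_iff[OF y sum(1-3)[OF 1(1-3) 2(1-3)] sum(1-3)[OF V(1-3) W(1-3)]]
      by (simp add: sum(4)[OF 1(1-3) 2(1-3)] sum(4)[OF V(1-3) W(1-3)] 1(4) 2(4) del: One_nat_def)
  qed
  have form: "fiber_form X F M \<psi> y v w = at_point X M y (V \<inter> W) (\<Phi> V s W t)"
    unfolding fiber_form_def V(4) W(4)
  proof (rule F.UN_at_point_eq[OF y])
    fix V1 s1 assume m1: "(V1, s1) \<in> at_point X F y V s"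
    show "(\<Union>(V2, s2)\<in>at_point X F y W t. at_point X M y (V1 \<inter> V2)
        (form (V1 \<inter> V2) (res F V1 (V1 \<inter> V2) s1) (res F V2 (V1 \<inter> V2) s2))) = at_point X M y (V \<inter> W) (\<Phi> V s W t)"
      by (rule F.UN_at_point_eq[OF y]) (use F.at_point_self[OF y W(1-3)] eq[OF m1] in \<open>auto simp: \<Phi>_def\<close>)
  qed (use F.at_point_self[OF y V(1-3)] in auto)
  note S = sum[OF V(1-3) W(1-3)]
  note fc = M.fiber_carrierI[OF y S(1-3)]
  have "fiber_form X F M \<psi> y v w = \<zero>\<^bsub>fiber X M y\<^esub> \<longleftrightarrow> M.val y (V \<inter> W) (\<Phi> V s W t) 0 = 0"
    unfolding form
  proof
    assume "at_point X M y (V \<inter> W) (\<Phi> V s W t) = \<zero>\<^bsub>fiber X M y\<^esub>"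
    then show "M.val y (V \<inter> W) (\<Phi> V s W t) 0 = 0"
      using M.fiber_val[OF y S(1-3) one] M.fiber_zero_val(2)[OF y one] by simp
  next
    assume z: "M.val y (V \<inter> W) (\<Phi> V s W t) 0 = 0"
    show "at_point X M y (V \<inter> W) (\<Phi> V s W t) = \<zero>\<^bsub>fiber X M y\<^esub>"
      by (rule M.fiber_ext[OF y fc M.fiber_zero_val(1)[OF y]])
        (use z M.fiber_val[OF y S(1-3) one] M.fiber_zero_val(2)[OF y one] in simp)
  qed
  also have "M.val y (V \<inter> W) (\<Phi> V s W t) 0 = (\<Sum>i<r. \<Sum>j<r. F.fiber_val y v i * F.fiber_val y w j * gram i j y)"
    unfolding S(4) V(4) W(4)
    by (intro sum.cong refl) (simp add: F.fiber_val[OF y V(1-3)] F.fiber_val[OF y W(1-3)])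
  finally show ?thesis .
qed

text \<open>Every coordinate vector is attained in the fiber, so the quantifier over
  \<open>v\<close> becomes one over coefficient vectors \<open>a\<close>, and testing against the
  points with unit coordinates isolates the columns of the Gram matrix.\<close>

lemma nondegenerate_iff:
  assumes y: "y \<in> U"
  shows "(\<forall>v\<in>carrier (fiber X F y). (\<forall>w\<in>carrier (fiber X F y). fiber_form X F M \<psi> y v w = \<zero>\<^bsub>fiber X M y\<^esub>)
      \<longrightarrow> v = \<zero>\<^bsub>fiber X F y\<^esub>) \<longleftrightarrow>
    (\<forall>a. (\<forall>j<r. (\<Sum>i<r. a i * gram i j y) = 0) \<longrightarrow> (\<forall>i<r. a i = 0))" (is "?L \<longleftrightarrow> ?R")
proof -
  have swap: "(\<Sum>i<r. \<Sum>j<r. a i * b j * gram i j y) = (\<Sum>j<r. b j * (\<Sum>i<r. a i * gram i j y))" for a b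
  proof -
    have "(\<Sum>i<r. \<Sum>j<r. a i * b j * gram i j y) = (\<Sum>j<r. \<Sum>i<r. a i * b j * gram i j y)" by (rule sum.swap)
    also have "\<dots> = (\<Sum>j<r. b j * (\<Sum>i<r. a i * gram i j y))"
      by (simp add: sum_distrib_left mult_ac)
    finally show ?thesis .
  qed
  show ?thesis
  proof
    assume L: ?L
    show ?R
    proof (intro allI impI)
      fix a i assume a: "\<forall>j<r. (\<Sum>i<r. a i * gram i j y) = 0" and i: "i < r"
      obtain v where v: "v \<in> carrier (fiber X F y)" "\<And>i. i < r \<Longrightarrow> F.fiber_val y v i = a i"
        using F.fiber_val_surj[OF y, of a] by blast
      have "fiber_form X F M \<psi> y v w = \<zero>\<^bsub>fiber X M y\<^esub>" if w: "w \<in> carrier (fiber X F y)" for w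
        unfolding fiber_form_zero_iff[OF y v(1) w] swap using a v(2) by simp
      then have "v = \<zero>\<^bsub>fiber X F y\<^esub>" using L v(1) by blast
      then show "a i = 0" using v(2)[OF i] F.fiber_zero_val(2)[OF y i] by simp
    qed
  next
    assume R: ?R
    show ?L
    proof (intro ballI impI)
      fix v assume v: "v \<in> carrier (fiber X F y)"
        and z: "\<forall>w\<in>carrier (fiber X F y). fiber_form X F M \<psi> y v w = \<zero>\<^bsub>fiber X M y\<^esub>"
      have "(\<Sum>i<r. F.fiber_val y v i * gram i j y) = 0" if j: "j < r" for j
      proof -
        obtain w where w: "w \<in> carrier (fiber X F y)" "\<And>i. i < r \<Longrightarrow> F.fiber_val y w i = (if i = j then 1 else 0)"
          using F.fiber_val_surj[OF y, of "\<lambda>i. if i = j then 1 else 0"] by blast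
        have "(\<Sum>k<r. F.fiber_val y w k * (\<Sum>i<r. F.fiber_val y v i * gram i k y)) = 0"
          using bspec[OF z w(1)] unfolding fiber_form_zero_iff[OF y v w(1)] swap .
        moreover have "(\<Sum>k<r. F.fiber_val y w k * (\<Sum>i<r. F.fiber_val y v i * gram i k y))
          = (\<Sum>k<r. if k = j then (\<Sum>i<r. F.fiber_val y v i * gram i k y) else 0)"
          by (rule sum.cong[OF refl]) (simp add: w(2))
        ultimately show ?thesis using j by simp
      qed
      then have "\<forall>i<r. F.fiber_val y v i = 0" using R by blast
      then show "v = \<zero>\<^bsub>fiber X F y\<^esub>"
        by (intro F.fiber_ext[OF y v F.fiber_zero_val(1)[OF y]]) (simp add: F.fiber_zero_val(2)[OF y])
    qed
  qed
qed

end

section \<open>Elementary modifications\<close>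

text \<open>\<open>G\<close> is identified by \<open>j\<close> with the subsheaf of those sections of \<open>F\<close> whose coordinates
  with index in \<open>K\<close> vanish at \<open>x\<close>.  Both the Hecke transform of \<open>F\<close> (with \<open>j\<close> the inclusion) and
  \<open>M(-x)\<close> arise in this way.\<close>

locale modification = framed X F r U e
  for X :: "'x surface" and F :: "('x, 'f) msheaf" and r :: nat and U :: "'x set"
    and e :: "nat \<Rightarrow> 'f" +
  fixes x :: 'x and K :: "nat set" and G :: "('x, 'h) msheaf" and j :: "'x set \<Rightarrow> 'h \<Rightarrow> 'f"
  assumes x: "x \<in> U" and K: "K \<subseteq> {..<r}"
    and G_zero: "\<And>V. open_in X V \<Longrightarrow> \<zero>\<^bsub>sec G V\<^esub> \<in> carrier (sec G V)"
    and G_add: "\<And>V s t. open_in X V \<Longrightarrow> s \<in> carrier (sec G V) \<Longrightarrow> t \<in> carrier (sec G V)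
      \<Longrightarrow> s \<oplus>\<^bsub>sec G V\<^esub> t \<in> carrier (sec G V)"
    and G_smult: "\<And>V f s. open_in X V \<Longrightarrow> f \<in> carrier (structure_sheaf X V) \<Longrightarrow> s \<in> carrier (sec G V)
      \<Longrightarrow> f \<odot>\<^bsub>sec G V\<^esub> s \<in> carrier (sec G V)"
    and G_res: "\<And>V W s. open_in X V \<Longrightarrow> open_in X W \<Longrightarrow> W \<subseteq> V \<Longrightarrow> s \<in> carrier (sec G V)
      \<Longrightarrow> res G V W s \<in> carrier (sec G W)"
    and j_zero: "\<And>V. open_in X V \<Longrightarrow> j V \<zero>\<^bsub>sec G V\<^esub> = \<zero>\<^bsub>sec F V\<^esub>"
    and j_hom: "sheaf_hom X G F j"
    and j_inj: "\<And>V. open_in X V \<Longrightarrow> inj_on (j V) (carrier (sec G V))"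
    and j_image: "\<And>V. open_in X V \<Longrightarrow> j V ` carrier (sec G V)
      = {s \<in> carrier (sec F V). x \<in> V \<longrightarrow> (\<forall>k\<in>K. val x V s k = 0)}"
begin

lemmas j_closed = sheaf_homD(1)[OF j_hom]
  and j_add = sheaf_homD(2)[OF j_hom]
  and j_smult = sheaf_homD(3)[OF j_hom]
  and j_res = sheaf_homD(4)[OF j_hom]

lemma j_eqD: "open_in X V \<Longrightarrow> s \<in> carrier (sec G V) \<Longrightarrow> t \<in> carrier (sec G V) \<Longrightarrow> j V s = j V t \<Longrightarrow> s = t"
  by (rule inj_onD[OF j_inj])

lemma j_surj:
  assumes "open_in X V" "s \<in> carrier (sec F V)" "\<And>k. x \<in> V \<Longrightarrow> k \<in> K \<Longrightarrow> val x V s k = 0"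
  obtains t where "t \<in> carrier (sec G V)" "j V t = s"
proof -
  have "s \<in> j V ` carrier (sec G V)" unfolding j_image[OF assms(1)] using assms by simp
  then show ?thesis using that by (elim imageE) simp
qed

lemma j_vanishes:
  assumes "open_in X V" "s \<in> carrier (sec G V)" "x \<in> V" "k \<in> K"
  shows "val x V (j V s) k = 0"
proof -
  have "j V s \<in> j V ` carrier (sec G V)" using assms(2) by (rule imageI)
  then show ?thesis unfolding j_image[OF assms(1)] using assms by simp
qed

text \<open>Each law holds after applying the injective, linear \<open>j\<close>. Only the existence
  of negatives needs the description of the image, which is closed under negation.\<close>

lemma G_module:
  assumes V: "open_in X V"
  shows "Module.module (structure_sheaf X V) (sec G V)"
proof -
  interpret V: Module.module "structure_sheaf X V" "sec F V" by (rule sec_module[OF V])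
  note c = j_closed[OF V] G_add[OF V] G_smult[OF V] G_zero[OF V]
  note h = j_add[OF V] j_smult[OF V] j_zero[OF V]
  note eqI = j_eqD[OF V]
  show ?thesis
  proof (rule moduleI)
    show "cring (structure_sheaf X V)" by (rule cring_structure_sheaf)
    show "abelian_group (sec G V)"
    proof (rule abelian_groupI)
      fix s assume s: "s \<in> carrier (sec G V)"
      have "val x V (\<ominus>\<^bsub>sec F V\<^esub> j V s) k = 0" if "x \<in> V" "k \<in> K" for k
        using val_inverse[OF V that(1) x c(1)[OF s]] j_vanishes[OF V s that] K that by auto
      then obtain t where t: "t \<in> carrier (sec G V)" "j V t = \<ominus>\<^bsub>sec F V\<^esub> j V s"
        by (rule j_surj[OF V V.M.a_inv_closed[OF c(1)[OF s]]])
      have "t \<oplus>\<^bsub>sec G V\<^esub> s = \<zero>\<^bsub>sec G V\<^esub>"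
        by (rule eqI) (use t s in \<open>simp_all add: c h V.M.l_neg\<close>)
      then show "\<exists>t\<in>carrier (sec G V). t \<oplus>\<^bsub>sec G V\<^esub> s = \<zero>\<^bsub>sec G V\<^esub>" using t(1) by blast
    next
      fix s t u assume "s \<in> carrier (sec G V)" "t \<in> carrier (sec G V)" "u \<in> carrier (sec G V)"
      then show "s \<oplus>\<^bsub>sec G V\<^esub> t \<oplus>\<^bsub>sec G V\<^esub> u = s \<oplus>\<^bsub>sec G V\<^esub> (t \<oplus>\<^bsub>sec G V\<^esub> u)"
        by (intro eqI) (simp_all add: c h V.M.a_assoc)
    next
      fix s t assume "s \<in> carrier (sec G V)" "t \<in> carrier (sec G V)"
      then show "s \<oplus>\<^bsub>sec G V\<^esub> t = t \<oplus>\<^bsub>sec G V\<^esub> s"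
        by (intro eqI) (simp_all add: c h V.M.a_comm)
    next
      fix s assume "s \<in> carrier (sec G V)"
      then show "\<zero>\<^bsub>sec G V\<^esub> \<oplus>\<^bsub>sec G V\<^esub> s = s"
        by (intro eqI) (simp_all add: c h)
    qed (simp_all add: c)
    fix f s assume f: "f \<in> hol V" and s: "s \<in> carrier (sec G V)"
    show "f \<odot>\<^bsub>sec G V\<^esub> s \<in> carrier (sec G V)" by (rule c(3)[OF f s])
    show "f \<odot>\<^bsub>sec G V\<^esub> (s \<oplus>\<^bsub>sec G V\<^esub> t) = f \<odot>\<^bsub>sec G V\<^esub> s \<oplus>\<^bsub>sec G V\<^esub> f \<odot>\<^bsub>sec G V\<^esub> t"
      if "t \<in> carrier (sec G V)" for t
      using f s that by (intro eqI) (simp_all add: c h V.smult_r_distr)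
    show "(f \<oplus>\<^bsub>structure_sheaf X V\<^esub> g) \<odot>\<^bsub>sec G V\<^esub> s = f \<odot>\<^bsub>sec G V\<^esub> s \<oplus>\<^bsub>sec G V\<^esub> g \<odot>\<^bsub>sec G V\<^esub> s"
      if g: "g \<in> hol V" for g
    proof (rule eqI)
      show "(f \<oplus>\<^bsub>structure_sheaf X V\<^esub> g) \<odot>\<^bsub>sec G V\<^esub> s \<in> carrier (sec G V)"
        by (rule c(3)[OF V.R.a_closed[OF f g] s])
      show "f \<odot>\<^bsub>sec G V\<^esub> s \<oplus>\<^bsub>sec G V\<^esub> g \<odot>\<^bsub>sec G V\<^esub> s \<in> carrier (sec G V)"
        by (intro c f g s)
      show "j V ((f \<oplus>\<^bsub>structure_sheaf X V\<^esub> g) \<odot>\<^bsub>sec G V\<^esub> s) = j V (f \<odot>\<^bsub>sec G V\<^esub> s \<oplus>\<^bsub>sec G V\<^esub> g \<odot>\<^bsub>sec G V\<^esub> s)"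
        unfolding h(2)[OF s V.R.a_closed[OF f g]] h(1)[OF c(3)[OF f s] c(3)[OF g s]] h(2)[OF s f] h(2)[OF s g]
        by (rule V.smult_l_distr[OF f g c(1)[OF s]])
    qed
    show "(f \<otimes>\<^bsub>structure_sheaf X V\<^esub> g) \<odot>\<^bsub>sec G V\<^esub> s = f \<odot>\<^bsub>sec G V\<^esub> (g \<odot>\<^bsub>sec G V\<^esub> s)"
      if g: "g \<in> hol V" for g
    proof (rule eqI)
      show "(f \<otimes>\<^bsub>structure_sheaf X V\<^esub> g) \<odot>\<^bsub>sec G V\<^esub> s \<in> carrier (sec G V)"
        by (rule c(3)[OF V.R.m_closed[OF f g] s])
      show "f \<odot>\<^bsub>sec G V\<^esub> (g \<odot>\<^bsub>sec G V\<^esub> s) \<in> carrier (sec G V)" by (intro c f g s)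
      show "j V ((f \<otimes>\<^bsub>structure_sheaf X V\<^esub> g) \<odot>\<^bsub>sec G V\<^esub> s) = j V (f \<odot>\<^bsub>sec G V\<^esub> (g \<odot>\<^bsub>sec G V\<^esub> s))"
        unfolding h(2)[OF s V.R.m_closed[OF f g]] h(2)[OF c(3)[OF g s] f] h(2)[OF s g]
        by (rule V.smult_assoc1[OF f g c(1)[OF s]])
    qed
  next
    fix s assume s: "s \<in> carrier (sec G V)"
    show "\<one>\<^bsub>structure_sheaf X V\<^esub> \<odot>\<^bsub>sec G V\<^esub> s = s"
    proof (rule eqI[OF c(3)[OF V.R.one_closed s] s])
      show "j V (\<one>\<^bsub>structure_sheaf X V\<^esub> \<odot>\<^bsub>sec G V\<^esub> s) = j V s"
        unfolding h(2)[OF s V.R.one_closed] by (rule V.smult_one[OF c(1)[OF s]])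
    qed
  qed
qed

lemma G_presheaf: "module_presheaf X G"
  unfolding module_presheaf_def
proof (intro conjI allI impI)
  fix V assume V: "open_in X V"
  show "Module.module (structure_sheaf X V) (sec G V)" by (rule G_module[OF V])
  show "\<forall>s\<in>carrier (sec G V). res G V V s = s"
  proof
    fix s assume s: "s \<in> carrier (sec G V)"
    show "res G V V s = s"
      by (rule j_eqD[OF V G_res[OF V V order_refl s] s])
        (simp add: j_res[OF V s V order_refl] res_id[OF V j_closed[OF V s]])
  qed
next
  fix V W assume "open_in X V \<and> open_in X W \<and> W \<subseteq> V"
  then have V: "open_in X V" "open_in X W" "W \<subseteq> V" by auto
  note c = j_closed[OF V(1)] G_res[OF V]
  show "res G V W \<in> carrier (sec G V) \<rightarrow> carrier (sec G W)" by (rule funcsetI) (rule c(2))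
  show "\<forall>s\<in>carrier (sec G V). \<forall>t\<in>carrier (sec G V).
      res G V W (s \<oplus>\<^bsub>sec G V\<^esub> t) = res G V W s \<oplus>\<^bsub>sec G W\<^esub> res G V W t"
  proof (intro ballI)
    fix s t assume st: "s \<in> carrier (sec G V)" "t \<in> carrier (sec G V)"
    show "res G V W (s \<oplus>\<^bsub>sec G V\<^esub> t) = res G V W s \<oplus>\<^bsub>sec G W\<^esub> res G V W t"
      by (rule j_eqD[OF V(2) c(2)[OF G_add[OF V(1) st]] G_add[OF V(2) c(2)[OF st(1)] c(2)[OF st(2)]]])
        (simp add: j_res[OF V(1) _ V(2,3)] j_add[OF V(1)] j_add[OF V(2)] st c G_add[OF V(1)] res_add[OF V])
  qed
  show "\<forall>f\<in>hol V. \<forall>s\<in>carrier (sec G V).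
      res G V W (f \<odot>\<^bsub>sec G V\<^esub> s) = restrict f W \<odot>\<^bsub>sec G W\<^esub> res G V W s"
  proof (intro ballI)
    fix f s assume f: "f \<in> hol V" and s: "s \<in> carrier (sec G V)"
    note fW = hol_restrict[OF f V(3)]
    show "res G V W (f \<odot>\<^bsub>sec G V\<^esub> s) = restrict f W \<odot>\<^bsub>sec G W\<^esub> res G V W s"
    proof (rule j_eqD[OF V(2) c(2)[OF G_smult[OF V(1) f s]] G_smult[OF V(2) fW c(2)[OF s]]])
      show "j W (res G V W (f \<odot>\<^bsub>sec G V\<^esub> s)) = j W (restrict f W \<odot>\<^bsub>sec G W\<^esub> res G V W s)"
        unfolding j_res[OF V(1) G_smult[OF V(1) f s] V(2,3)] j_smult[OF V(1) s f]
          j_smult[OF V(2) c(2)[OF s] fW] j_res[OF V(1) s V(2,3)]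
        by (rule res_smult[OF V f c(1)[OF s]])
    qed
  qed
next
  fix V W Y assume "open_in X V \<and> open_in X W \<and> open_in X Y \<and> Y \<subseteq> W \<and> W \<subseteq> V"
  then have o: "open_in X V" "open_in X W" "open_in X Y" "Y \<subseteq> W" "W \<subseteq> V" "Y \<subseteq> V" by auto
  show "\<forall>s\<in>carrier (sec G V). res G W Y (res G V W s) = res G V Y s"
  proof
    fix s assume s: "s \<in> carrier (sec G V)"
    note c = G_res[OF o(1,2,5) s] G_res[OF o(1,3,6) s]
    show "res G W Y (res G V W s) = res G V Y s"
    proof (rule j_eqD[OF o(3) G_res[OF o(2,3,4) c(1)] c(2)])
      show "j Y (res G W Y (res G V W s)) = j Y (res G V Y s)"
        unfolding j_res[OF o(2) c(1) o(3,4)] j_res[OF o(1) s o(2,5)] j_res[OF o(1) s o(3,6)]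
        by (rule res_comp[OF o(1-5) j_closed[OF o(1) s]])
    qed
  qed
qed

text \<open>Sections of \<open>G\<close> are glued as sections of \<open>F\<close> and brought back
  through \<open>j\<close>.\<close>

lemma G_sheaf: "module_sheaf X G"
  unfolding module_sheaf_def
proof (intro conjI allI impI G_presheaf)
  fix \<U> assume "\<forall>V\<in>\<U>. open_in X V"
  then have o: "\<And>V. V \<in> \<U> \<Longrightarrow> open_in X V" by blast
  have oU: "open_in X (\<Union>\<U>)" using o by (intro openin_Union) auto
  show "\<forall>s\<in>carrier (sec G (\<Union>\<U>)). \<forall>t\<in>carrier (sec G (\<Union>\<U>)).
      (\<forall>V\<in>\<U>. res G (\<Union>\<U>) V s = res G (\<Union>\<U>) V t) \<longrightarrow> s = t"
  proof (intro ballI impI)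
    fix s t assume s: "s \<in> carrier (sec G (\<Union>\<U>))" and t: "t \<in> carrier (sec G (\<Union>\<U>))"
      and eq: "\<forall>V\<in>\<U>. res G (\<Union>\<U>) V s = res G (\<Union>\<U>) V t"
    show "s = t"
    proof (rule j_eqD[OF oU s t], rule separated[OF oU j_closed[OF oU s] j_closed[OF oU t]])
      fix y assume "y \<in> \<Union>\<U>"
      then obtain V where V: "V \<in> \<U>" "y \<in> V" by blast
      have VU: "V \<subseteq> \<Union>\<U>" using V(1) by blast
      have "res F (\<Union>\<U>) V (j (\<Union>\<U>) s) = res F (\<Union>\<U>) V (j (\<Union>\<U>) t)"
        unfolding j_res[OF oU s o[OF V(1)] VU, symmetric] j_res[OF oU t o[OF V(1)] VU, symmetric]
          bspec[OF eq V(1)] by (rule refl)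
      then show "\<exists>W. open_in X W \<and> y \<in> W \<and> W \<subseteq> \<Union>\<U> \<and>
          res F (\<Union>\<U>) W (j (\<Union>\<U>) s) = res F (\<Union>\<U>) W (j (\<Union>\<U>) t)"
        using V VU o[OF V(1)] by blast
    qed
  qed
  fix \<sigma> assume "(\<forall>V\<in>\<U>. \<sigma> V \<in> carrier (sec G V)) \<and>
      (\<forall>V\<in>\<U>. \<forall>W\<in>\<U>. res G V (V \<inter> W) (\<sigma> V) = res G W (V \<inter> W) (\<sigma> W))"
  then have \<sigma>: "\<And>V. V \<in> \<U> \<Longrightarrow> \<sigma> V \<in> carrier (sec G V)"
    and comp: "\<And>V W. V \<in> \<U> \<Longrightarrow> W \<in> \<U> \<Longrightarrow> res G V (V \<inter> W) (\<sigma> V) = res G W (V \<inter> W) (\<sigma> W)"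
    by auto
  have "\<exists>s\<in>carrier (sec F (\<Union>\<U>)). \<forall>V\<in>\<U>. res F (\<Union>\<U>) V s = j V (\<sigma> V)"
  proof (rule glue)
    show "\<forall>V\<in>\<U>. open_in X V" using o by blast
    show "\<forall>V\<in>\<U>. j V (\<sigma> V) \<in> carrier (sec F V)" using j_closed[OF o \<sigma>] by blast
    show "\<forall>V\<in>\<U>. \<forall>W\<in>\<U>. res F V (V \<inter> W) (j V (\<sigma> V)) = res F W (V \<inter> W) (j W (\<sigma> W))"
    proof (intro ballI)
      fix V W assume VW: "V \<in> \<U>" "W \<in> \<U>"
      have oVW: "open_in X (V \<inter> W)" using o VW by (simp add: openin_Int)
      show "res F V (V \<inter> W) (j V (\<sigma> V)) = res F W (V \<inter> W) (j W (\<sigma> W))"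
        using j_res[OF o[OF VW(1)] \<sigma>[OF VW(1)] oVW] j_res[OF o[OF VW(2)] \<sigma>[OF VW(2)] oVW] comp[OF VW] by simp
    qed
  qed (rule refl)
  then obtain s where s: "s \<in> carrier (sec F (\<Union>\<U>))" and sV: "\<And>V. V \<in> \<U> \<Longrightarrow> res F (\<Union>\<U>) V s = j V (\<sigma> V)"
    by blast
  \<comment> \<open>The condition cutting out \<open>G\<close> concerns the single point
    \<open>x\<close>, so it can be read off on one member of the cover that contains
    \<open>x\<close>.\<close>
  have "val x (\<Union>\<U>) s k = 0" if xk: "x \<in> \<Union>\<U>" "k \<in> K" for k
  proof -
    obtain V where V: "V \<in> \<U>" "x \<in> V" using xk(1) by blast
    have VU: "V \<subseteq> \<Union>\<U>" and k: "k < r" using V(1) xk(2) K by auto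
    show ?thesis
      using val_res[OF oU xk(1) x s k o[OF V(1)] VU V(2)] j_vanishes[OF o[OF V(1)] \<sigma>[OF V(1)] V(2) xk(2)] sV[OF V(1)] by simp
  qed
  then obtain t where t: "t \<in> carrier (sec G (\<Union>\<U>))" "j (\<Union>\<U>) t = s" by (rule j_surj[OF oU s])
  have "res G (\<Union>\<U>) V t = \<sigma> V" if V: "V \<in> \<U>" for V
  proof (rule j_eqD[OF o[OF V] _ \<sigma>[OF V]])
    have VU: "V \<subseteq> \<Union>\<U>" using V by blast
    show "res G (\<Union>\<U>) V t \<in> carrier (sec G V)" by (rule G_res[OF oU o[OF V] VU t(1)])
    show "j V (res G (\<Union>\<U>) V t) = j V (\<sigma> V)"
      unfolding j_res[OF oU t(1) o[OF V] VU] t(2) by (rule sV[OF V])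
  qed
  then show "\<exists>s\<in>carrier (sec G (\<Union>\<U>)). \<forall>V\<in>\<U>. res G (\<Union>\<U>) V s = \<sigma> V" using t(1) by blast
qed

sublocale G: sheaf X G by unfold_locales (rule G_sheaf)

text \<open>The candidates \<open>b k\<close> correspond to the multiples \<open>c k\<close> of the
  members of a frame of \<open>F\<close>. Expanding \<open>s\<close> in them means solving
  \<open>val k = c k * d k\<close> for each index: divisibility gives existence, cancellation gives
  uniqueness. The frame \<open>e'\<close> is arbitrary so that the lemma serves both near
  \<open>x\<close> and away from it.\<close>

lemma framed_of_multiples:
  assumes fr: "framed X F r U' e'" and W: "open_in X W" "W \<subseteq> U'"
    and b: "\<And>k. k < r \<Longrightarrow> b k \<in> carrier (sec G W)"
    and b_val: "\<And>y i k. y \<in> W \<Longrightarrow> k < r \<Longrightarrow> i < r \<Longrightarrow>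
      framed.val X F r U' e' y W (j W (b k)) i = (if i = k then c k y else 0)"
    and div: "\<And>V s k. open_in X V \<Longrightarrow> V \<subseteq> W \<Longrightarrow> s \<in> carrier (sec G V) \<Longrightarrow> k < r \<Longrightarrow>
      \<exists>h\<in>hol V. \<forall>y\<in>V. framed.val X F r U' e' y V (j V s) k = c k y * h y"
    and cancel: "\<And>V f g k. open_in X V \<Longrightarrow> V \<subseteq> W \<Longrightarrow> k < r \<Longrightarrow> f \<in> hol V \<Longrightarrow> g \<in> hol V \<Longrightarrow>
      \<forall>y\<in>V. c k y * f y = c k y * g y \<Longrightarrow> \<forall>y\<in>V. f y = g y"
  shows "framed X G r W b"
    and "y \<in> W \<Longrightarrow> s \<in> carrier (sec G W) \<Longrightarrow> i < r \<Longrightarrow>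
      framed.val X F r U' e' y W (j W s) i = framed.val X G r W b y W s i * c i y"
proof -
  interpret E: framed X F r U' e' by fact
  have b_res: "E.val y V (j V (res G W V (b k))) i = (if i = k then c k y else 0)"
    if V: "open_in X V" "V \<subseteq> W" and y: "y \<in> V" and ki: "k < r" "i < r" for V y k i
  proof -
    have yW: "y \<in> W" "y \<in> U'" using y V W by auto
    show ?thesis
      unfolding j_res[OF W(1) b[OF ki(1)] V] E.val_res[OF W(1) yW j_closed[OF W(1) b[OF ki(1)]] ki(2) V y]
      by (rule b_val[OF yW(1) ki])
  qed
  have sum: "(\<Sum>k<r. d k y * E.val y V (j V (res G W V (b k))) i) = d i y * c i y"
    if V: "open_in X V" "V \<subseteq> W" and y: "y \<in> V" and i: "i < r" for V y i and d :: "nat \<Rightarrow> 'x \<Rightarrow> complex"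
  proof -
    have "(\<Sum>k<r. d k y * E.val y V (j V (res G W V (b k))) i) = (\<Sum>k<r. if k = i then d k y * c k y else 0)"
      by (rule sum.cong[OF refl]) (use b_res[OF V y _ i] in auto)
    then show ?thesis using i by simp
  qed
  show fG: "framed X G r W b"
  proof unfold_locales
    show "open_in X W" by fact
    show "frame_over X r G W b"
    proof (rule G.frame_overI[where \<nu> = "\<lambda>y V s i. E.val y V (j V s) i" and m = r])
      fix V s assume V: "open_in X V" "V \<subseteq> W" and s: "s \<in> carrier (sec G V)"
      have VU: "V \<subseteq> U'" using V W by auto
      show "s = t" if t: "t \<in> carrier (sec G V)"
        and eq: "\<And>y i. y \<in> V \<Longrightarrow> i < r \<Longrightarrow> E.val y V (j V s) i = E.val y V (j V t) i" for t
        by (rule j_eqD[OF V(1) s t], rule E.val_separates[OF V(1) VU j_closed[OF V(1) s] j_closed[OF V(1) t]])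
          (rule eq)
      have "\<exists>d. d \<in> {..<r} \<rightarrow>\<^sub>E hol V \<and> (\<forall>k<r. \<forall>y\<in>V. E.val y V (j V s) k = c k y * d k y)"
      proof -
        have "\<forall>k. \<exists>h. k < r \<longrightarrow> h \<in> hol V \<and> (\<forall>y\<in>V. E.val y V (j V s) k = c k y * h y)"
          using div[OF V s] by blast
        from choice[OF this] obtain h where
          h: "\<And>k. k < r \<Longrightarrow> h k \<in> hol V" "\<And>k y. k < r \<Longrightarrow> y \<in> V \<Longrightarrow> E.val y V (j V s) k = c k y * h k y"
          by blast
        show ?thesis by (rule exI[of _ "restrict h {..<r}"]) (use h in auto)
      qed
      then obtain d where d: "d \<in> {..<r} \<rightarrow>\<^sub>E hol V"
        "\<And>k y. k < r \<Longrightarrow> y \<in> V \<Longrightarrow> E.val y V (j V s) k = c k y * d k y" by blast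
      show "\<exists>!d. d \<in> {..<r} \<rightarrow>\<^sub>E hol V \<and>
          (\<forall>y\<in>V. \<forall>i<r. E.val y V (j V s) i = (\<Sum>k<r. d k y * E.val y V (j V (res G W V (b k))) i))"
      proof (rule ex1I[of _ d])
        show "d \<in> {..<r} \<rightarrow>\<^sub>E hol V \<and>
          (\<forall>y\<in>V. \<forall>i<r. E.val y V (j V s) i = (\<Sum>k<r. d k y * E.val y V (j V (res G W V (b k))) i))"
          using d sum[OF V] by (simp add: mult.commute)
        fix d' assume "d' \<in> {..<r} \<rightarrow>\<^sub>E hol V \<and>
          (\<forall>y\<in>V. \<forall>i<r. E.val y V (j V s) i = (\<Sum>k<r. d' k y * E.val y V (j V (res G W V (b k))) i))"
        then have d': "d' \<in> {..<r} \<rightarrow>\<^sub>E hol V"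
          "\<And>y i. y \<in> V \<Longrightarrow> i < r \<Longrightarrow> E.val y V (j V s) i = d' i y * c i y"
          using sum[OF V] by auto
        show "d' = d"
        proof (rule PiE_ext[OF d'(1) d(1)])
          fix k assume "k \<in> {..<r}"
          then have k: "k < r" and h: "d' k \<in> hol V" "d k \<in> hol V"
            using d(1) d'(1) by (auto simp: PiE_iff)
          have "\<forall>y\<in>V. c k y * d' k y = c k y * d k y"
            using d(2)[OF k] d'(2)[OF _ k] by (simp add: mult.commute)
          from cancel[OF V k h this] show "d' k = d k" by (intro hol_ext[OF h]) simp
        qed
      qed
      fix y i assume y: "y \<in> V" and i: "i < r"
      have yU: "y \<in> U'" using y VU by auto
      show "E.val y V (j V (s \<oplus>\<^bsub>sec G V\<^esub> t)) i = E.val y V (j V s) i + E.val y V (j V t) i"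
        if t: "t \<in> carrier (sec G V)" for t
        unfolding j_add[OF V(1) s t] by (rule E.val_add[OF V(1) y yU j_closed[OF V(1) s] i j_closed[OF V(1) t]])
      show "E.val y V (j V (f \<odot>\<^bsub>sec G V\<^esub> s)) i = f y * E.val y V (j V s) i" if f: "f \<in> hol V" for f
        unfolding j_smult[OF V(1) s f] by (rule E.val_smult[OF V(1) y yU j_closed[OF V(1) s] i f])
    qed (use W b in auto)
  qed
  interpret G': framed X G r W b by (rule fG)
  show "E.val y W (j W s) i = G'.val y W s i * c i y"
    if y: "y \<in> W" and s: "s \<in> carrier (sec G W)" and i: "i < r"
  proof -
    have yU: "y \<in> U'" using y W by auto
    have "E.val y W (j W s) i = (\<Sum>k<r. G'.val y W s k * E.val y W (j W (res G W W (b k))) i)"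
    proof (rule G'.val_expand[where \<nu> = "\<lambda>s. E.val y W (j W s) i", OF W(1) order_refl y s])
      fix s t assume s: "s \<in> carrier (sec G W)"
      show "E.val y W (j W (s \<oplus>\<^bsub>sec G W\<^esub> t)) i = E.val y W (j W s) i + E.val y W (j W t) i"
        if t: "t \<in> carrier (sec G W)"
        unfolding j_add[OF W(1) s t] by (rule E.val_add[OF W(1) y yU j_closed[OF W(1) s] i j_closed[OF W(1) t]])
      show "E.val y W (j W (f \<odot>\<^bsub>sec G W\<^esub> s)) i = f y * E.val y W (j W s) i" if f: "f \<in> hol W" for f
        unfolding j_smult[OF W(1) s f] by (rule E.val_smult[OF W(1) y yU j_closed[OF W(1) s] i f])
    qed
    then show ?thesis using sum[OF W(1) order_refl y i, of "\<lambda>k y. G'.val y W s k"] by simp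
  qed
qed

text \<open>Over open sets that miss \<open>x\<close> the vanishing condition is void, so
  \<open>j\<close> is bijective there and the frame is carried over with all multipliers equal to
  1.\<close>

lemma framed_away:
  assumes fr: "framed X F r U' e'" and xU: "x \<notin> U'"
  obtains b where "framed X G r U' b"
    "\<And>k. k < r \<Longrightarrow> b k \<in> carrier (sec G U') \<and> j U' (b k) = e' k"
    "\<And>y s i. y \<in> U' \<Longrightarrow> s \<in> carrier (sec G U') \<Longrightarrow> i < r \<Longrightarrow>
      framed.val X F r U' e' y U' (j U' s) i = framed.val X G r U' b y U' s i"
proof -
  interpret E: framed X F r U' e' by fact
  have "\<forall>k. \<exists>t. k < r \<longrightarrow> t \<in> carrier (sec G U') \<and> j U' t = e' k"
    using j_surj[OF E.U_open E.e_closed] xU by metis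
  from choice[OF this] obtain b where
    b: "\<And>k. k < r \<Longrightarrow> b k \<in> carrier (sec G U')" "\<And>k. k < r \<Longrightarrow> j U' (b k) = e' k" by blast
  have 1: "E.val y U' (j U' (b k)) i = (if i = k then 1 else 0)" if "y \<in> U'" "k < r" "i < r" for y i k
    using E.val_e'[OF that] b(2)[OF that(2)] by simp
  have 2: "\<exists>h\<in>hol V. \<forall>y\<in>V. E.val y V (j V s) k = 1 * h y"
    if V: "open_in X V" "V \<subseteq> U'" and s: "s \<in> carrier (sec G V)" and k: "k < r" for V s k
    by (rule bexI[OF _ E.val_hol[OF V j_closed[OF V(1) s] k]]) simp
  note fr' = framed_of_multiples[where c = "\<lambda>_ _. 1", OF fr E.U_open order_refl b(1) 1 2]
  show ?thesis by (rule that[OF fr'(1)]) (use fr'(2) b in auto)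
qed

text \<open>Besides the frame itself, two computations are exported: the coordinates of the images
  of its members, and how coordinates in \<open>G\<close> relate to coordinates in \<open>F\<close>.
  The former is used for \<open>E\<close>, the latter for \<open>M(-x)\<close>.\<close>

lemma framed_at:
  assumes W: "W \<subseteq> U" and \<zeta>: "local_parameter x W \<zeta>"
  obtains b where "framed X G r W b"
    "\<And>y k i. y \<in> W \<Longrightarrow> k < r \<Longrightarrow> i < r \<Longrightarrow>
      val y W (j W (b k)) i = (if i = k then if k \<in> K then \<zeta> y else 1 else 0)"
    "\<And>k. k < r \<Longrightarrow> b k \<in> carrier (sec G W)"
    "\<And>y s i. y \<in> W \<Longrightarrow> s \<in> carrier (sec G W) \<Longrightarrow> i < r \<Longrightarrow>
      val y W (j W s) i = framed.val X G r W b y W s i * (if i \<in> K then \<zeta> y else 1)"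
proof -
  note oW = local_parameterD(1)[OF \<zeta>] and xW = local_parameterD(2)[OF \<zeta>]
    and zh = local_parameterD(3)[OF \<zeta>] and z0 = local_parameterD(4)[OF \<zeta>]
    and zdiv = local_parameter_divides[OF \<zeta>] and zcancel = local_parameter_cancels[OF \<zeta>]
  \<comment> \<open>The multiplier is the parameter exactly for the coordinates that are forced to
    vanish at \<open>x\<close>.\<close>
  define c where "c k = (if k \<in> K then \<zeta> else (\<lambda>y\<in>W. 1))" for k
  have c_hol: "c k \<in> hol W" for k
    using zh hol_const[of 1 W] by (simp add: c_def del: restrict_hol_iff)
  have re: "res F U W (e k) \<in> carrier (sec F W)" if "k < r" for k by (rule res_e_closed[OF oW W that])
  have v: "val y W (c k \<odot>\<^bsub>sec F W\<^esub> res F U W (e k)) i = (if i = k then c k y else 0)"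
    if "y \<in> W" "k < r" "i < r" for y k i
  proof -
    have "y \<in> U" using that W by auto
    then show ?thesis
      using val_smult[OF oW that(1) _ re[OF that(2)] that(3) c_hol[of k]] val_e[OF oW W that] by simp
  qed
  have "\<forall>k. \<exists>t. k < r \<longrightarrow> t \<in> carrier (sec G W) \<and> j W t = c k \<odot>\<^bsub>sec F W\<^esub> res F U W (e k)"
  proof
    fix k
    show "\<exists>t. k < r \<longrightarrow> t \<in> carrier (sec G W) \<and> j W t = c k \<odot>\<^bsub>sec F W\<^esub> res F U W (e k)"
    proof (cases "k < r")
      case True
      have "val x W (c k \<odot>\<^bsub>sec F W\<^esub> res F U W (e k)) i = 0" if "i \<in> K" for i
        using v[OF xW True, of i] that K z0 by (auto simp: c_def)
      then show ?thesis using j_surj[OF oW sec_smult_closed[OF oW c_hol re[OF True]]] by metis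
    qed simp
  qed
  from choice[OF this] obtain b where
    b: "\<And>k. k < r \<Longrightarrow> b k \<in> carrier (sec G W)" "\<And>k. k < r \<Longrightarrow> j W (b k) = c k \<odot>\<^bsub>sec F W\<^esub> res F U W (e k)" by blast
  have 1: "val y W (j W (b k)) i = (if i = k then c k y else 0)" if "y \<in> W" "k < r" "i < r" for y i k
    using v[OF that] b(2)[OF that(2)] by simp
  have 2: "\<exists>h\<in>hol V. \<forall>y\<in>V. val y V (j V s) k = c k y * h y"
    if V: "open_in X V" "V \<subseteq> W" and s: "s \<in> carrier (sec G V)" and k: "k < r" for V s k
  proof -
    have VU: "V \<subseteq> U" using V W by auto
    note h = val_hol[OF V(1) VU j_closed[OF V(1) s] k]
    show ?thesis
    proof (cases "k \<in> K")
      case True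
      have "\<exists>h\<in>hol V. \<forall>y\<in>V. (\<lambda>y\<in>V. val y V (j V s) k) y = \<zeta> y * h y"
        by (rule zdiv[OF V h]) (simp add: j_vanishes[OF V(1) s _ True])
      then show ?thesis using True by (simp add: c_def)
    next
      case False
      show ?thesis by (rule bexI[OF _ h]) (use False V in \<open>auto simp: c_def\<close>)
    qed
  qed
  have 3: "\<forall>y\<in>V. f y = g y"
    if V: "open_in X V" "V \<subseteq> W" "k < r" and fg: "f \<in> hol V" "g \<in> hol V"
      and eq: "\<forall>y\<in>V. c k y * f y = c k y * g y" for V f g k
  proof (cases "k \<in> K")
    case True
    then show ?thesis using zcancel[OF V(1,2) fg] eq by (simp add: c_def)
  next
    case False
    show ?thesis
    proof
      fix y assume y: "y \<in> V"
      then have "y \<in> W" using V(2) by auto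
      then show "f y = g y" using bspec[OF eq y] False by (simp add: c_def)
    qed
  qed
  note fr = framed_of_multiples[where c = c and b = b, OF framed_axioms oW W]
  have fr1: "framed X G r W b" by (rule fr(1)) (assumption | rule b(1) 1 2 3)+
  show ?thesis
  proof (rule that[OF fr1])
    show "val y W (j W (b k)) i = (if i = k then if k \<in> K then \<zeta> y else 1 else 0)"
      if "y \<in> W" "k < r" "i < r" for y k i
      using 1[OF that] that(1) by (simp add: c_def)
    show "val y W (j W s) i = framed.val X G r W b y W s i * (if i \<in> K then \<zeta> y else 1)"
      if "y \<in> W" "s \<in> carrier (sec G W)" "i < r" for y s i
    proof -
      have "val y W (j W s) i = framed.val X G r W b y W s i * c i y"
        by (rule fr(2)) (assumption | rule that b(1) 1 2 3)+
      then show ?thesis using that(1) by (simp add: c_def)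
    qed
  qed (use b in auto)
qed

end

section \<open>Passing between vector bundles and their local frames\<close>

context surface_charts begin

lemma sheafI: "module_sheaf X F \<Longrightarrow> sheaf X F"
  by unfold_locales

lemma framed_at_point:
  assumes "vector_bundle X r F" "y \<in> topspace (points X)"
  obtains U e where "y \<in> U" "framed X F r U e"
proof -
  obtain U e where U: "open_in X U" "y \<in> U" "frame_over X r F U e"
    using assms unfolding vector_bundle_def by blast
  have "sheaf X F" using assms(1) unfolding vector_bundle_def by (intro sheafI) simp
  then have "framed X F r U e" by (intro framed.intro framed_axioms.intro U)
  then show ?thesis using that U(2) by blast
qed

lemma vector_bundleI:
  assumes "module_sheaf X F"
    and "\<And>y. y \<in> topspace (points X) \<Longrightarrow> \<exists>U e. y \<in> U \<and> framed X F r U e"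
  shows "vector_bundle X r F"
  unfolding vector_bundle_def
proof (intro conjI ballI assms(1))
  fix y assume "y \<in> topspace (points X)"
  from assms(2)[OF this] obtain U e where U: "y \<in> U" "framed X F r U e" by blast
  show "\<exists>U e. open_in X U \<and> y \<in> U \<and> frame_over X r F U e"
    using U(1) framed.U_open[OF U(2)] framed.frame[OF U(2)] by blast
qed

end

text \<open>At \<open>x\<close> the modified frame is used; at any other point a frame of
  \<open>F\<close> is restricted to the complement of \<open>x\<close> and carried over.\<close>

lemma (in modification) vector_bundle_G:
  assumes "vector_bundle X r F"
  shows "vector_bundle X r G"
proof (rule vector_bundleI[OF G_sheaf])
  fix y assume y: "y \<in> topspace (points X)"
  show "\<exists>U e. y \<in> U \<and> framed X G r U e"
  proof (cases "y = x")
    case True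
    obtain W \<zeta> where W: "W \<subseteq> U" "local_parameter x W \<zeta>"
      by (rule local_parameter_exists[OF U_open x])
    obtain b where b: "framed X G r W b" by (rule framed_at[OF W])
    show ?thesis
      by (rule exI[of _ W], rule exI[of _ b], rule conjI[OF _ b]) (simp add: True local_parameterD(2)[OF W(2)])
  next
    case False
    obtain U' e' where U': "y \<in> U'" "framed X F r U' e'" by (rule framed_at_point[OF assms y])
    interpret E: framed X F r U' e' by (rule U'(2))
    have fr: "framed X F r (U' - {x}) (\<lambda>i. res F U' (U' - {x}) (e' i))"
      by (rule E.restrict_framed[OF open_in_delete[OF E.U_open]]) auto
    obtain b where b: "framed X G r (U' - {x}) b" by (rule framed_away[OF fr]) auto
    show ?thesis
      by (rule exI[of _ "U' - {x}"], rule exI[of _ b], rule conjI[OF _ b]) (use False U'(1) in simp)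
  qed
qed

lemma ex1_eq: "\<exists>!c. P c \<Longrightarrow> P a \<Longrightarrow> P b \<Longrightarrow> a = b"
  by (erule ex1E) metis

section \<open>A frame adapted to a subspace of a fiber\<close>

context framed begin

text \<open>Change of frame by a constant matrix \<open>A\<close> with inverse \<open>C\<close>. The
  two inverse identities have separate jobs: \<open>CA\<close> shows that the new coefficients
  represent the section, \<open>AC\<close> that they are the only ones.\<close>

lemma framed_change:
  assumes e': "\<And>k. k < r \<Longrightarrow> e' k \<in> carrier (sec F U)"
    and e'_val: "\<And>y k i. y \<in> U \<Longrightarrow> k < r \<Longrightarrow> i < r \<Longrightarrow> val y U (e' k) i = A k i"
    and AC: "\<And>k l. k < r \<Longrightarrow> l < r \<Longrightarrow> (\<Sum>i<r. A k i * C i l) = (if k = l then 1 else 0)"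
    and CA: "\<And>i j. i < r \<Longrightarrow> j < r \<Longrightarrow> (\<Sum>k<r. C i k * A k j) = (if i = j then 1 else 0)"
  shows "framed X F r U e'"
    and "open_in X V \<Longrightarrow> y \<in> V \<Longrightarrow> y \<in> U \<Longrightarrow> s \<in> carrier (sec F V) \<Longrightarrow> i < r \<Longrightarrow>
      val y V s i = (\<Sum>k<r. framed.val X F r U e' y V s k * A k i)"
proof -
  have inv1: "(\<Sum>k<r. (\<Sum>i<r. u i * C i k) * A k j) = u j" if j: "j < r" for u j
  proof -
    have "(\<Sum>k<r. (\<Sum>i<r. u i * C i k) * A k j) = (\<Sum>k<r. \<Sum>i<r. u i * (C i k * A k j))"
      by (simp add: sum_distrib_right mult.assoc)
    also have "\<dots> = (\<Sum>i<r. \<Sum>k<r. u i * (C i k * A k j))" by (rule sum.swap)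
    also have "\<dots> = (\<Sum>i<r. if i = j then u i else 0)"
      by (rule sum.cong[OF refl]) (use CA j in \<open>simp flip: sum_distrib_left\<close>)
    finally show ?thesis using j by simp
  qed
  have inv2: "(\<Sum>i<r. (\<Sum>k<r. d k * A k i) * C i l) = d l" if l: "l < r" for d l
  proof -
    have "(\<Sum>i<r. (\<Sum>k<r. d k * A k i) * C i l) = (\<Sum>i<r. \<Sum>k<r. d k * (A k i * C i l))"
      by (simp add: sum_distrib_right mult.assoc)
    also have "\<dots> = (\<Sum>k<r. \<Sum>i<r. d k * (A k i * C i l))" by (rule sum.swap)
    also have "\<dots> = (\<Sum>k<r. if k = l then d k else 0)"
      by (rule sum.cong[OF refl]) (use AC l in \<open>simp flip: sum_distrib_left\<close>)
    finally show ?thesis using l by simp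
  qed
  have e'_res: "val y V (res F U V (e' k)) i = A k i"
    if V: "open_in X V" "V \<subseteq> U" and y: "y \<in> V" and "k < r" "i < r" for V y k i
  proof -
    have yU: "y \<in> U" using y V by auto
    show ?thesis
      unfolding val_res[OF U_open yU yU e'[OF \<open>k < r\<close>] \<open>i < r\<close> V y] by (rule e'_val[OF yU that(4,5)])
  qed
  show fr: "framed X F r U e'"
  proof unfold_locales
    show "frame_over X r F U e'"
    proof (rule frame_overI[where \<nu> = val and m = r])
      fix V s assume V: "open_in X V" "V \<subseteq> U" and s: "s \<in> carrier (sec F V)"
      define d where "d = (\<lambda>k\<in>{..<r}. \<lambda>y\<in>V. \<Sum>i<r. val y V s i * C i k)"
      have "(\<lambda>y\<in>V. \<Sum>i<r. val y V s i * C i k) \<in> hol V" for k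
      proof -
        have m: "(\<lambda>y\<in>V. (\<lambda>y\<in>V. val y V s i) y * (\<lambda>y\<in>V. C i k) y) \<in> hol V" if "i < r" for i
          by (rule hol_mult[OF val_hol[OF V s that] hol_const])
        have "(\<lambda>y\<in>V. \<Sum>i<r. (\<lambda>y\<in>V. (\<lambda>y\<in>V. val y V s i) y * (\<lambda>y\<in>V. C i k) y) y) \<in> hol V"
          by (rule hol_sum, rule m, unfold lessThan_iff)
        moreover have "(\<lambda>y\<in>V. \<Sum>i<r. (\<lambda>y\<in>V. (\<lambda>y\<in>V. val y V s i) y * (\<lambda>y\<in>V. C i k) y) y)
          = (\<lambda>y\<in>V. \<Sum>i<r. val y V s i * C i k)" by (rule restrict_ext) simp
        ultimately show ?thesis by (simp only:)
      qed
      then have dh: "d \<in> {..<r} \<rightarrow>\<^sub>E hol V" by (auto simp: d_def simp del: restrict_hol_iff)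
      show "\<exists>!d. d \<in> {..<r} \<rightarrow>\<^sub>E hol V \<and>
          (\<forall>y\<in>V. \<forall>i<r. val y V s i = (\<Sum>k<r. d k y * val y V (res F U V (e' k)) i))"
      proof (rule ex1I[of _ d])
        have "val y V s i = (\<Sum>k<r. d k y * val y V (res F U V (e' k)) i)" if y: "y \<in> V" "i < r" for y i
        proof -
          have "(\<Sum>k<r. d k y * val y V (res F U V (e' k)) i) = (\<Sum>k<r. (\<Sum>i<r. val y V s i * C i k) * A k i)"
            by (rule sum.cong[OF refl]) (use e'_res[OF V y(1) _ y(2)] y in \<open>simp add: d_def\<close>)
          then show ?thesis using inv1[OF y(2)] by simp
        qed
        then show "d \<in> {..<r} \<rightarrow>\<^sub>E hol V \<and>
          (\<forall>y\<in>V. \<forall>i<r. val y V s i = (\<Sum>k<r. d k y * val y V (res F U V (e' k)) i))" using dh by blast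
        fix d' assume "d' \<in> {..<r} \<rightarrow>\<^sub>E hol V \<and>
          (\<forall>y\<in>V. \<forall>i<r. val y V s i = (\<Sum>k<r. d' k y * val y V (res F U V (e' k)) i))"
        then have d': "d' \<in> {..<r} \<rightarrow>\<^sub>E hol V"
          "\<And>y i. y \<in> V \<Longrightarrow> i < r \<Longrightarrow> val y V s i = (\<Sum>k<r. d' k y * val y V (res F U V (e' k)) i)" by auto
        show "d' = d"
        proof (rule PiE_ext[OF d'(1) dh])
          fix k assume "k \<in> {..<r}"
          then have k: "k < r" and h: "d' k \<in> hol V" "d k \<in> hol V"
            using dh d'(1) by (auto simp: PiE_iff)
          show "d' k = d k"
          proof (rule hol_ext[OF h])
            fix y assume y: "y \<in> V"
            have "val y V s i = (\<Sum>k<r. d' k y * A k i)" if i: "i < r" for i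
              unfolding d'(2)[OF y i] by (rule sum.cong[OF refl]) (use e'_res[OF V y _ i] in simp)
            then have "(\<Sum>i<r. val y V s i * C i k) = (\<Sum>i<r. (\<Sum>k<r. d' k y * A k i) * C i k)" by simp
            then show "d' k y = d k y" using inv2[OF k, of "\<lambda>k. d' k y"] y k by (simp add: d_def)
          qed
        qed
      qed
      show "s = t" if "t \<in> carrier (sec F V)" "\<And>y i. y \<in> V \<Longrightarrow> i < r \<Longrightarrow> val y V s i = val y V t i" for t
        by (rule val_separates[OF V s that])
    next
      fix y V s t i assume V: "open_in X V" "V \<subseteq> U" "y \<in> V" and s: "s \<in> carrier (sec F V)" and i: "i < r"
      have yU: "y \<in> U" using V by auto
      show "val y V (s \<oplus>\<^bsub>sec F V\<^esub> t) i = val y V s i + val y V t i" if "t \<in> carrier (sec F V)"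
        by (rule val_add[OF V(1,3) yU s i that])
      show "val y V (f \<odot>\<^bsub>sec F V\<^esub> s) i = f y * val y V s i" if "f \<in> hol V" for f
        by (rule val_smult[OF V(1,3) yU s i that])
    qed (use U_open e' in auto)
  qed (rule U_open)
  interpret E: framed X F r U e' by (rule fr)
  show "val y V s i = (\<Sum>k<r. E.val y V s k * A k i)"
    if V: "open_in X V" and y: "y \<in> V" "y \<in> U" and s: "s \<in> carrier (sec F V)" and i: "i < r"
  proof -
    define W where "W = V \<inter> U"
    have W: "open_in X W" "W \<subseteq> U" "y \<in> W" "W \<subseteq> V"
      using V y U_open unfolding W_def by (auto intro: openin_Int)
    note sW = res_closed[OF V W(1,4) s]
    have "val y W (res F V W s) i = (\<Sum>k<r. E.val y W (res F V W s) k * val y W (res F U W (e' k)) i)"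
      by (rule E.val_expand[where \<nu> = "\<lambda>s. val y W s i", OF W(1-3) sW])
        (use val_add[OF W(1,3) y(2) _ i] val_smult[OF W(1,3) y(2) _ i] in auto)
    also have "\<dots> = (\<Sum>k<r. E.val y V s k * A k i)"
      by (rule sum.cong[OF refl])
        (use e'_res[OF W(1-3) _ i] E.val_res[OF V y s _ W(1,4,3)] in simp)
    finally show ?thesis unfolding val_res[OF V y s i W(1,4,3)] .
  qed
qed

text \<open>The coordinates at \<open>x\<close> of a basis of \<open>S\<close> form \<open>n\<close>
  independent rows; they are completed to an invertible matrix, and the new frame consists of the
  sections with these constant coordinates. Since the matrix is constant, it is a frame on all of
  \<open>U\<close>, not only near \<open>x\<close>.\<close>

lemma adapted_frame:
  assumes x: "x \<in> U" and n: "n \<le> r" and S: "submodule S complex_field (fiber X F x)"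
    and dim: "has_dimension complex_field (fiber X F x) S n"
  obtains e' where "framed X F r U e'"
    "\<And>V s. open_in X V \<Longrightarrow> x \<in> V \<Longrightarrow> s \<in> carrier (sec F V) \<Longrightarrow>
      at_point X F x V s \<in> S \<longleftrightarrow> (\<forall>k\<in>{n..<r}. framed.val X F r U e' x V s k = 0)"
proof -
  let ?f = "fiber X F x"
  interpret f: abelian_group ?f by (rule fiber_group[OF x])
  note Ssub = submodule.axioms(1)[OF S]
  have S_carrier: "v \<in> carrier ?f" if "v \<in> S" for v
    using subgroup.subset[OF Ssub] that by auto
  have S_smult: "a \<odot>\<^bsub>?f\<^esub> v \<in> S" if "v \<in> S" for a v
    by (rule submodule.smult_closed[OF S _ that]) (simp add: complex_field_def)
  have S_add: "v \<oplus>\<^bsub>?f\<^esub> w \<in> S" if "v \<in> S" "w \<in> S" for v w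
    using subgroup.m_closed[OF Ssub that] by simp
  have S_zero: "\<zero>\<^bsub>?f\<^esub> \<in> S" using subgroup.one_closed[OF Ssub] by simp
  obtain b where b: "b ` {..<n} \<subseteq> S"
    and "\<forall>v\<in>S. \<exists>!c. c \<in> {..<n} \<rightarrow>\<^sub>E carrier complex_field \<and> v = (\<Oplus>\<^bsub>?f\<^esub>i\<in>{..<n}. c i \<odot>\<^bsub>?f\<^esub> b i)"
    using dim unfolding has_dimension_def by (elim exE conjE) (rule that)
  note ex1 = bspec[OF this(2)]
  have bS: "b k \<in> S" if "k < n" for k using b that by auto
  have sum_S: "(\<Oplus>\<^bsub>?f\<^esub>i\<in>A. c i \<odot>\<^bsub>?f\<^esub> b i) \<in> S" if "finite A" "A \<subseteq> {..<n}" for A c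
    using that
  proof (induction A rule: finite_induct)
    case (insert k A)
    have "c i \<odot>\<^bsub>?f\<^esub> b i \<in> S" if "i \<in> insert k A" for i
      using S_smult bS insert.prems that by auto
    then have "(\<lambda>i. c i \<odot>\<^bsub>?f\<^esub> b i) \<in> A \<rightarrow> carrier ?f" "c k \<odot>\<^bsub>?f\<^esub> b k \<in> carrier ?f" "c k \<odot>\<^bsub>?f\<^esub> b k \<in> S"
      using S_carrier by auto
    then show ?case using insert S_add by simp
  qed (simp add: S_zero)
  have sum_val: "fiber_val x (\<Oplus>\<^bsub>?f\<^esub>k\<in>{..<n}. c k \<odot>\<^bsub>?f\<^esub> b k) i = (\<Sum>k<n. c k * fiber_val x (b k) i)"
    if "i < r" for c i
  proof -
    have "fiber_val x (\<Oplus>\<^bsub>?f\<^esub>k\<in>{..<n}. c k \<odot>\<^bsub>?f\<^esub> b k) i = (\<Sum>k<n. fiber_val x (c k \<odot>\<^bsub>?f\<^esub> b k) i)"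
      by (rule fiber_val_finsum[OF x]) (use that bS S_smult S_carrier in auto)
    also have "\<dots> = (\<Sum>k<n. c k * fiber_val x (b k) i)"
      by (rule sum.cong[OF refl]) (use fiber_smult_val(2)[OF x S_carrier[OF bS] that] in auto)
    finally show ?thesis .
  qed
  \<comment> \<open>A combination of the rows that vanishes is a second expansion of zero in the
    basis of \<open>S\<close>; uniqueness of expansions makes its coefficients zero.\<close>
  have "independent_rows n r (\<lambda>k. fiber_val x (b k))"
  proof (rule independent_rowsI)
    fix c k assume z: "\<And>i. i < r \<Longrightarrow> (\<Sum>k<n. c k * fiber_val x (b k) i) = 0" and k: "k < n"
    have eq: "\<zero>\<^bsub>?f\<^esub> = (\<Oplus>\<^bsub>?f\<^esub>k\<in>{..<n}. d k \<odot>\<^bsub>?f\<^esub> b k)"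
      if d: "\<And>i. i < r \<Longrightarrow> (\<Sum>k<n. d k * fiber_val x (b k) i) = 0" for d
    proof (rule fiber_ext[OF x fiber_zero_val(1)[OF x]])
      show "(\<Oplus>\<^bsub>?f\<^esub>k\<in>{..<n}. d k \<odot>\<^bsub>?f\<^esub> b k) \<in> carrier ?f" by (intro S_carrier sum_S) auto
    qed (simp add: fiber_zero_val(2)[OF x] sum_val d)
    have ext: "restrict d {..<n} \<in> {..<n} \<rightarrow>\<^sub>E carrier complex_field" for d :: "nat \<Rightarrow> complex"
      by (simp add: complex_field_def PiE_iff)
    have "restrict c {..<n} = (\<lambda>k\<in>{..<n}. 0)"
    proof (rule ex1_eq[OF ex1[OF S_zero]]; rule conjI[OF ext])
      show "\<zero>\<^bsub>?f\<^esub> = (\<Oplus>\<^bsub>?f\<^esub>k\<in>{..<n}. restrict c {..<n} k \<odot>\<^bsub>?f\<^esub> b k)" by (rule eq) (simp add: z)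
      show "\<zero>\<^bsub>?f\<^esub> = (\<Oplus>\<^bsub>?f\<^esub>k\<in>{..<n}. (\<lambda>k\<in>{..<n}. 0) k \<odot>\<^bsub>?f\<^esub> b k)" by (rule eq) simp
    qed
    from fun_cong[OF this, of k] show "c k = 0" using k by simp
  qed
  from extend_independent_rows[OF n this] obtain A where
    A': "\<forall>k<n. A k = fiber_val x (b k)" and A2: "independent_rows r r A" by (elim exE conjE) (rule that)
  have A: "A k = fiber_val x (b k)" if "k < n" for k using A' that by simp
  obtain C where AC': "\<forall>k<r. \<forall>l<r. (\<Sum>i<r. A k i * C i l) = (if k = l then 1 else 0)"
    and CA': "\<forall>i<r. \<forall>j<r. (\<Sum>k<r. C i k * A k j) = (if i = j then 1 else 0)"
  proof (rule independent_rows_inverse[OF A2])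
    fix C assume C: "\<And>k l. k < r \<Longrightarrow> l < r \<Longrightarrow> (\<Sum>i<r. A k i * C i l) = (if k = l then 1 else 0)"
      "\<And>i j. i < r \<Longrightarrow> j < r \<Longrightarrow> (\<Sum>k<r. C i k * A k j) = (if i = j then 1 else 0)"
    show thesis by (rule that[of C]; intro allI impI; rule C)
  qed
  have AC: "(\<Sum>i<r. A k i * C i l) = (if k = l then 1 else 0)" if "k < r" "l < r" for k l
    using AC' that by simp
  have CA: "(\<Sum>k<r. C i k * A k j) = (if i = j then 1 else 0)" if "i < r" "j < r" for i j
    using CA' that by simp
  \<comment> \<open>The coordinate functions are the constants \<open>A k i\<close>, which are
    holomorphic, so a section with these coordinates exists over all of \<open>U\<close>.\<close>
  have "\<exists>s. s \<in> carrier (sec F U) \<and> (\<forall>y\<in>U. \<forall>i<r. val y U s i = A k i)" for k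
  proof -
    obtain s where "s \<in> carrier (sec F U)" "\<And>y i. y \<in> U \<Longrightarrow> i < r \<Longrightarrow> val y U s i = (\<lambda>y\<in>U. A k i) y"
      by (rule val_section[OF U_open order_refl, of "\<lambda>i. \<lambda>y\<in>U. A k i"]) (use hol_const in blast)+
    then show ?thesis by auto
  qed
  then obtain e' where e': "\<And>k. e' k \<in> carrier (sec F U)" "\<And>y k i. y \<in> U \<Longrightarrow> i < r \<Longrightarrow> val y U (e' k) i = A k i"
    by metis
  have fr: "framed X F r U e'" by (rule framed_change(1)[OF e'(1) e'(2) AC CA])
  interpret E: framed X F r U e' by (rule fr)
  have change: "val y V s i = (\<Sum>k<r. E.val y V s k * A k i)"
    if "open_in X V" "y \<in> V" "y \<in> U" "s \<in> carrier (sec F V)" "i < r" for y V s i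
    by (rule framed_change(2)[OF e'(1) e'(2) AC CA that])
  show ?thesis
  proof (rule that[OF fr])
    fix V s assume V: "open_in X V" "x \<in> V" and s: "s \<in> carrier (sec F V)"
    show "at_point X F x V s \<in> S \<longleftrightarrow> (\<forall>k\<in>{n..<r}. E.val x V s k = 0)"
    proof
      assume "at_point X F x V s \<in> S"
      from ex1_implies_ex[OF ex1[OF this]] obtain c where
        c: "at_point X F x V s = (\<Oplus>\<^bsub>?f\<^esub>k\<in>{..<n}. c k \<odot>\<^bsub>?f\<^esub> b k)" by (elim exE conjE) (rule that)
      \<comment> \<open>Coefficients of the expansion in \<open>S\<close>, padded by zeros.
        Comparison with the coordinates in the new frame by independence of all rows of
        \<open>A\<close> shows that those with index at least \<open>n\<close> vanish.\<close>
      define c' where "c' k = (if k < n then c k else 0)" for k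
      have sum: "(\<Sum>k<r. (E.val x V s k - c' k) * A k i) = 0" if i: "i < r" for i
      proof -
        have "(\<Sum>k<r. E.val x V s k * A k i) = val x V s i" using change[OF V x s i] by simp
        also have "\<dots> = fiber_val x (at_point X F x V s) i" by (rule fiber_val[OF x V s i, symmetric])
        also have "\<dots> = (\<Sum>k<n. c k * A k i)" unfolding c sum_val[OF i] by (simp add: A)
        also have "\<dots> = (\<Sum>k<r. c' k * A k i)"
          by (rule sum.mono_neutral_cong_left) (use n in \<open>auto simp: c'_def\<close>)
        finally show ?thesis by (simp add: left_diff_distrib sum_subtractf)
      qed
      have "E.val x V s k - c' k = 0" if "k < r" for k
        using independent_rowsD[OF A2 sum that] .
      then show "\<forall>k\<in>{n..<r}. E.val x V s k = 0" by (auto simp: c'_def)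
    next
      assume z: "\<forall>k\<in>{n..<r}. E.val x V s k = 0"
      let ?w = "\<Oplus>\<^bsub>?f\<^esub>k\<in>{..<n}. E.val x V s k \<odot>\<^bsub>?f\<^esub> b k"
      have w: "?w \<in> S" by (rule sum_S) auto
      have "at_point X F x V s = ?w"
      proof (rule fiber_ext[OF x fiber_carrierI[OF x V s] S_carrier[OF w]])
        fix i assume i: "i < r"
        have "fiber_val x ?w i = (\<Sum>k<n. E.val x V s k * A k i)"
          unfolding sum_val[OF i] by (simp add: A)
        also have "\<dots> = (\<Sum>k<r. E.val x V s k * A k i)"
          by (rule sum.mono_neutral_left) (use n z in auto)
        also have "\<dots> = val x V s i" using change[OF V x s i] by simp
        finally show "fiber_val x (at_point X F x V s) i = fiber_val x ?w i" using fiber_val[OF x V s i] by simp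
      qed
      then show "at_point X F x V s \<in> S" using w by simp
    qed
  qed
qed

end

section \<open>The twist by a point\<close>

context surface_charts begin

lemma ideal_carrier: "f \<in> carrier (sec (point_ideal_sheaf X x) V) \<longleftrightarrow> f \<in> hol V \<and> (x \<in> V \<longrightarrow> f x = 0)"
  by (simp add: point_ideal_sheaf_def make_module_def)

lemma ideal_ops:
  "f \<oplus>\<^bsub>sec (point_ideal_sheaf X x) V\<^esub> g = (\<lambda>y\<in>V. f y + g y)"
  "\<zero>\<^bsub>sec (point_ideal_sheaf X x) V\<^esub> = (\<lambda>y\<in>V. 0)"
  "f \<odot>\<^bsub>sec (point_ideal_sheaf X x) V\<^esub> g = (\<lambda>y\<in>V. f y * g y)"
  "res (point_ideal_sheaf X x) V W f = restrict f W"
  by (simp_all add: point_ideal_sheaf_def make_module_def)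

lemma ideal_module: "Module.module (structure_sheaf X V) (sec (point_ideal_sheaf X x) V)"
proof (rule moduleI)
  show "cring (structure_sheaf X V)" by (rule cring_structure_sheaf)
  have c: "(\<lambda>y\<in>V. f y + g y) \<in> carrier (sec (point_ideal_sheaf X x) V)"
    if "f \<in> carrier (sec (point_ideal_sheaf X x) V)" "g \<in> carrier (sec (point_ideal_sheaf X x) V)" for f g
    using that hol_add[of f V g] unfolding ideal_carrier by (simp del: restrict_hol_iff)
  have m: "(\<lambda>y\<in>V. f y * g y) \<in> carrier (sec (point_ideal_sheaf X x) V)"
    if "f \<in> hol V" "g \<in> carrier (sec (point_ideal_sheaf X x) V)" for f g
    using that hol_mult[of f V g] unfolding ideal_carrier by (simp del: restrict_hol_iff)
  have z: "(\<lambda>y\<in>V. 0) \<in> carrier (sec (point_ideal_sheaf X x) V)"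
    unfolding ideal_carrier using hol_zero[of V] by (simp del: restrict_hol_iff)
  show "abelian_group (sec (point_ideal_sheaf X x) V)"
  proof (rule abelian_groupI, unfold ideal_ops)
    fix f assume f: "f \<in> carrier (sec (point_ideal_sheaf X x) V)"
    show "\<exists>g\<in>carrier (sec (point_ideal_sheaf X x) V). (\<lambda>y\<in>V. g y + f y) = (\<lambda>y\<in>V. 0)"
      by (rule bexI[OF _ m[OF hol_const[of "- 1"] f]]) (rule restrict_ext, simp)
    show "(\<lambda>y\<in>V. (\<lambda>y\<in>V. 0) y + f y) = f"
      by (rule hol_ext[OF hol_add[OF hol_zero]]) (use f in \<open>simp_all add: ideal_carrier\<close>)
  qed (rule c z, assumption+, rule z, (rule restrict_ext, simp)+)
  fix f g assume fg: "f \<in> hol V" "g \<in> carrier (sec (point_ideal_sheaf X x) V)"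
  show "f \<odot>\<^bsub>sec (point_ideal_sheaf X x) V\<^esub> g \<in> carrier (sec (point_ideal_sheaf X x) V)"
    unfolding ideal_ops by (rule m[OF fg])
next
  fix g assume "g \<in> carrier (sec (point_ideal_sheaf X x) V)"
  then have g: "g \<in> hol V" unfolding ideal_carrier by simp
  show "\<one>\<^bsub>structure_sheaf X V\<^esub> \<odot>\<^bsub>sec (point_ideal_sheaf X x) V\<^esub> g = g"
    unfolding ideal_ops structure_sheaf_ops
    by (rule hol_ext[OF hol_mult[OF hol_const g] g]) simp
qed (unfold ideal_ops structure_sheaf_ops, (rule restrict_ext, simp add: algebra_simps)+)

lemma ideal_presheaf: "module_presheaf X (point_ideal_sheaf X x)"
  unfolding module_presheaf_def
proof (intro conjI allI impI, rule ideal_module)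
  fix V W assume "open_in X V \<and> open_in X W \<and> W \<subseteq> V"
  then have VW: "W \<subseteq> V" by simp
  show "res (point_ideal_sheaf X x) V W
      \<in> carrier (sec (point_ideal_sheaf X x) V) \<rightarrow> carrier (sec (point_ideal_sheaf X x) W)"
    unfolding Pi_iff ideal_carrier ideal_ops
  proof (intro ballI conjI)
    fix f assume "f \<in> carrier (sec (point_ideal_sheaf X x) V)"
    then have f: "f \<in> hol V" "x \<in> V \<longrightarrow> f x = 0" unfolding ideal_carrier by auto
    show "restrict f W \<in> hol W" by (rule hol_restrict[OF f(1) VW])
    show "x \<in> W \<longrightarrow> restrict f W x = 0" using f(2) VW by auto
  qed
  show "\<forall>f\<in>carrier (sec (point_ideal_sheaf X x) V). \<forall>g\<in>carrier (sec (point_ideal_sheaf X x) V).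
      res (point_ideal_sheaf X x) V W (f \<oplus>\<^bsub>sec (point_ideal_sheaf X x) V\<^esub> g)
      = res (point_ideal_sheaf X x) V W f \<oplus>\<^bsub>sec (point_ideal_sheaf X x) W\<^esub> res (point_ideal_sheaf X x) V W g"
    "\<forall>f\<in>hol V. \<forall>g\<in>carrier (sec (point_ideal_sheaf X x) V).
      res (point_ideal_sheaf X x) V W (f \<odot>\<^bsub>sec (point_ideal_sheaf X x) V\<^esub> g)
      = restrict f W \<odot>\<^bsub>sec (point_ideal_sheaf X x) W\<^esub> res (point_ideal_sheaf X x) V W g"
    unfolding ideal_ops using VW by (auto simp: restrict_def fun_eq_iff)
next
  fix V show "\<forall>f\<in>carrier (sec (point_ideal_sheaf X x) V). res (point_ideal_sheaf X x) V V f = f"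
    unfolding ideal_ops ideal_carrier Ball_def by simp
next
  fix V W Y assume "open_in X V \<and> open_in X W \<and> open_in X Y \<and> Y \<subseteq> W \<and> W \<subseteq> V"
  then have "Y \<subseteq> W" by simp
  then show "\<forall>f\<in>carrier (sec (point_ideal_sheaf X x) V).
      res (point_ideal_sheaf X x) W Y (res (point_ideal_sheaf X x) V W f) = res (point_ideal_sheaf X x) V Y f"
    unfolding ideal_ops by (simp add: Int_absorb1)
qed

end

lemma nat_0_less_1: "(0::nat) < 1"
  by simp

text \<open>The frame near \<open>x\<close> serves to state the vanishing condition; that
  \<open>M\<close> is a bundle everywhere is assumed as well, since sections of the twist must be
  constructed near every point.\<close>

locale point_twist = framed X M 1 U l
  for X :: "'x surface" and M :: "('x, 'm) msheaf" and U :: "'x set" and l :: "nat \<Rightarrow> 'm" +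
  fixes x :: 'x
  assumes x_in: "x \<in> U" and M_bundle: "vector_bundle X 1 M"
begin

abbreviation "I \<equiv> point_ideal_sheaf X x"
abbreviation "scaling V m f \<equiv> f \<odot>\<^bsub>sec M V\<^esub> m"

lemma scale_bilinear: "bilinear_to_sheaf X M I M scaling"
proof -
  interpret I: presheaf X I by unfold_locales (rule ideal_presheaf)
  show ?thesis
  proof unfold_locales
    fix V m f assume V: "open_in X V" and m: "m \<in> carrier (sec M V)" and f: "f \<in> carrier (sec I V)"
    interpret V: Module.module "structure_sheaf X V" "sec M V" by (rule sec_module[OF V])
    have fh: "f \<in> hol V" using f unfolding ideal_carrier by simp
    show "scaling V m f \<in> carrier (sec M V)" by (rule V.smult_closed[OF fh m])
    show "scaling V (m \<oplus>\<^bsub>sec M V\<^esub> m') f = scaling V m f \<oplus>\<^bsub>sec M V\<^esub> scaling V m' f" if "m' \<in> carrier (sec M V)" for m'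
      by (rule V.smult_r_distr[OF fh m that])
    show "scaling V m (f \<oplus>\<^bsub>sec I V\<^esub> f') = scaling V m f \<oplus>\<^bsub>sec M V\<^esub> scaling V m f'" if "f' \<in> carrier (sec I V)" for f'
      using V.smult_l_distr[OF fh _ m, of f'] that unfolding ideal_ops ideal_carrier by simp
    show "scaling V (g \<odot>\<^bsub>sec M V\<^esub> m) f = g \<odot>\<^bsub>sec M V\<^esub> scaling V m f" if g: "g \<in> hol V" for g
      using V.smult_assoc1[OF fh g m] V.smult_assoc1[OF g fh m] V.R.m_comm[OF fh g] by (simp del: structure_sheaf_ops)
    show "scaling V m (g \<odot>\<^bsub>sec I V\<^esub> f) = g \<odot>\<^bsub>sec M V\<^esub> scaling V m f" if g: "g \<in> hol V" for g
      using V.smult_assoc1[OF g fh m] unfolding ideal_ops by simp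
    show "scaling W (res M V W m) (res I V W f) = res M V W (scaling V m f)" if "open_in X W" "W \<subseteq> V" for W
      unfolding res_smult[OF V that fh m] ideal_ops by (rule refl)
  qed
qed

sublocale T: bilinear_to_sheaf X M "point_ideal_sheaf X x" M "\<lambda>V m f. f \<odot>\<^bsub>sec M V\<^esub> m"
  by (rule scale_bilinear)

text \<open>Both sides have the same single coordinate. Written this way, the coefficient can be
  moved across a tensor sign.\<close>

lemma framed_section:
  assumes fr: "framed X M 1 N l'" and V: "open_in X V" "V \<subseteq> N" and m: "m \<in> carrier (sec M V)"
  shows "(\<lambda>y\<in>V. framed.val X M 1 N l' y V m 0) \<in> hol V"
    and "m = (\<lambda>y\<in>V. framed.val X M 1 N l' y V m 0) \<odot>\<^bsub>sec M V\<^esub> res M N V (l' 0)"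
proof -
  interpret L: framed X M 1 N l' by fact
  show h: "(\<lambda>y\<in>V. L.val y V m 0) \<in> hol V" by (rule L.val_hol[OF V m]) simp
  have r: "res M N V (l' 0) \<in> carrier (sec M V)" by (rule L.res_e_closed[OF V]) simp
  show "m = (\<lambda>y\<in>V. L.val y V m 0) \<odot>\<^bsub>sec M V\<^esub> res M N V (l' 0)"
  proof (rule L.val_separates[OF V m sec_smult_closed[OF V(1) h r]])
    fix y and i :: nat assume y: "y \<in> V" and i: "i < 1"
    have yN: "y \<in> N" using y V by auto
    show "L.val y V m i = L.val y V ((\<lambda>y\<in>V. L.val y V m 0) \<odot>\<^bsub>sec M V\<^esub> res M N V (l' 0)) i"
      unfolding L.val_smult[OF V(1) y yN r i h] L.val_e[OF V y nat_0_less_1 i] using i y by simp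
  qed
qed

text \<open>Since \<open>f\<close> is determined by \<open>f \<odot> l'\<close>, this makes \<open>M \<otimes> \<O>(-x) \<rightarrow> M\<close> injective on all open
  sets in the domain of the frame.\<close>

lemma tensor_eq_pure:
  assumes fr: "framed X M 1 N l'" and V: "open_in X V" "V \<subseteq> N" and C: "C \<in> carrier (sec T.TP V)"
  shows "\<exists>f\<in>carrier (sec I V). C = T.tpure V (res M N V (l' 0)) f"
proof -
  interpret L: framed X M 1 N l' by fact
  interpret V: tensor_pair "structure_sheaf X V" "sec M V" "sec I V" by (rule T.tensor_pair[OF V(1)])
  interpret TV: Module.module "structure_sheaf X V" V.T by (rule V.T_module)
  define m where "m = res M N V (l' 0)"
  have m: "m \<in> carrier (sec M V)" unfolding m_def by (rule L.res_e_closed[OF V]) simp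
  have pc: "V.pure m f \<in> carrier V.T" if "f \<in> carrier (sec I V)" for f
    by (rule V.pure_carrier[OF m that])
  have "\<exists>f\<in>carrier (sec I V). C = V.pure m f"
    using V(1) C
  proof (induction rule: T.TP_induct)
    case zero
    \<comment> \<open>A pure tensor with second factor zero equals its own double, hence is
      zero.\<close>
    have "V.pure m \<zero>\<^bsub>sec I V\<^esub> \<oplus>\<^bsub>V.T\<^esub> V.pure m \<zero>\<^bsub>sec I V\<^esub> = V.pure m \<zero>\<^bsub>sec I V\<^esub>"
      using V.pure_add_right[OF m V.N.M.zero_closed V.N.M.zero_closed] by simp
    then have "V.pure m \<zero>\<^bsub>sec I V\<^esub> = \<zero>\<^bsub>V.T\<^esub>"
      using TV.M.add.r_cancel_one[OF pc[OF V.N.M.zero_closed] pc[OF V.N.M.zero_closed]] by blast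
    then show ?case unfolding V.T_zero by (intro bexI[OF _ V.N.M.zero_closed]) simp
  next
    case (pure s f)
    let ?g = "\<lambda>y\<in>V. L.val y V s 0"
    note g = framed_section[OF fr V pure(1), folded m_def]
    have "V.pure s f = V.pure (?g \<odot>\<^bsub>sec M V\<^esub> m) f" using g(2) by simp
    \<comment> \<open>The coefficient of \<open>s\<close> is moved into the ideal factor, which
      leaves the frame member as the common first factor of all pure tensors and makes their sums
      pure again.\<close>
    also have "\<dots> = V.pure m (?g \<odot>\<^bsub>sec I V\<^esub> f)" by (rule V.pure_smult_swap[OF g(1) m pure(2)])
    finally show ?case using V.N.smult_closed[OF g(1) pure(2)] by blast
  next
    case (diff c d)
    from diff(3) obtain f where f: "f \<in> carrier (sec I V)" "V.cls c = V.pure m f" by blast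
    from diff(4) obtain f' where f': "f' \<in> carrier (sec I V)" "V.cls d = V.pure m f'" by blast
    let ?h = "f \<ominus>\<^bsub>sec I V\<^esub> f'"
    have h: "?h \<in> carrier (sec I V)" by (rule V.N.M.minus_closed[OF f(1) f'(1)])
    have "?h \<oplus>\<^bsub>sec I V\<^esub> f' = f"
      using f(1) f'(1) by (simp add: V.N.M.minus_eq V.N.M.a_assoc V.N.M.l_neg)
    then have eq: "V.pure m ?h \<oplus>\<^bsub>V.T\<^esub> V.pure m f' = V.cls (c - d) \<oplus>\<^bsub>V.T\<^esub> V.pure m f'"
      using V.pure_add_right[OF m h f'(1)] unfolding f'(2)[symmetric] V.T_add by (simp add: f(2))
    have cd: "V.cls (c - d) \<in> carrier V.T"
      unfolding V.T_carrier by (rule imageI) (rule V.formal_diff[OF diff(1,2)])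
    have "V.pure m ?h = V.cls (c - d)"
      using TV.M.add.right_cancel[of "V.pure m f'" "V.pure m ?h" "V.cls (c - d)"] eq pc[OF h] pc[OF f'(1)] cd by simp
    then show ?case using h by (intro bexI[of _ ?h]) simp_all
  qed
  then show ?thesis unfolding m_def .
qed

lemma presheaf_hom_inj:
  assumes fr: "framed X M 1 N l'" and V: "open_in X V" "V \<subseteq> N"
  shows "inj_on (T.presheaf_hom V) (carrier (sec T.TP V))"
proof (rule inj_onI)
  interpret L: framed X M 1 N l' by fact
  fix C D assume C: "C \<in> carrier (sec T.TP V)" and D: "D \<in> carrier (sec T.TP V)"
    and eq: "T.presheaf_hom V C = T.presheaf_hom V D"
  define m where "m = res M N V (l' 0)"
  have m: "m \<in> carrier (sec M V)" unfolding m_def by (rule L.res_e_closed[OF V]) simp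
  obtain f where f: "f \<in> carrier (sec I V)" "C = T.tpure V m f"
    using tensor_eq_pure[OF fr V C] unfolding m_def by blast
  obtain g where g: "g \<in> carrier (sec I V)" "D = T.tpure V m g"
    using tensor_eq_pure[OF fr V D] unfolding m_def by blast
  have h: "f \<in> hol V" "g \<in> hol V" using f(1) g(1) unfolding ideal_carrier by auto
  have "f \<odot>\<^bsub>sec M V\<^esub> m = g \<odot>\<^bsub>sec M V\<^esub> m"
    using eq unfolding f(2) g(2) T.presheaf_hom(2)[OF V(1) m f(1)] T.presheaf_hom(2)[OF V(1) m g(1)] .
  have "f y = g y" if y: "y \<in> V" for y
  proof -
    have yN: "y \<in> N" using y V by auto
    have v: "L.val y V (k \<odot>\<^bsub>sec M V\<^esub> m) 0 = k y" if "k \<in> hol V" for k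
      using L.val_smult[OF V(1) y yN m nat_0_less_1 that] L.val_e[OF V y nat_0_less_1 nat_0_less_1]
      unfolding m_def by simp
    show ?thesis using v[OF h(1)] v[OF h(2)] \<open>f \<odot>\<^bsub>sec M V\<^esub> m = g \<odot>\<^bsub>sec M V\<^esub> m\<close> by simp
  qed
  then show "C = D" unfolding f(2) g(2) using hol_ext[OF h] by simp
qed

text \<open>Injectivity is proved through frames, which exist only locally; this is the local form
  that \<open>lift_inj\<close> and \<open>lift_surj\<close> ask for.\<close>

lemma presheaf_hom_local_inj:
  assumes "y \<in> topspace (points X)"
  shows "\<exists>N. open_in X N \<and> y \<in> N \<and>
    (\<forall>V. open_in X V \<longrightarrow> V \<subseteq> N \<longrightarrow> inj_on (T.presheaf_hom V) (carrier (sec T.TP V)))"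
proof -
  obtain N l' where N: "y \<in> N" "framed X M 1 N l'" by (rule framed_at_point[OF M_bundle assms])
  show ?thesis
    by (intro exI[of _ N] conjI allI impI presheaf_hom_inj[OF N(2)])
      (use N framed.U_open[OF N(2)] in auto)
qed

lemma twist_eq: "twist X M x = sheafification X T.TP"
  unfolding twist_def T.tensor_sheaf_eq by (rule refl)

text \<open>Near \<open>x\<close> a section of the twist is represented by the frame member tensored
  with some \<open>f\<close> vanishing at \<open>x\<close>, so its image vanishes there. Conversely,
  a section of \<open>M\<close> that vanishes at \<open>x\<close> is locally its coordinate function
  times a frame member, and this function lies in the ideal; \<open>lift_surj\<close> assembles the
  local preimages.\<close>

lemma twist_image:
  assumes V: "open_in X V"
  shows "T.tensor_hom V ` carrier (sec (twist X M x) V)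
    = {s \<in> carrier (sec M V). x \<in> V \<longrightarrow> (\<forall>k\<in>{0}. val x V s k = 0)}"
proof (intro equalityI subsetI)
  fix s assume "s \<in> T.tensor_hom V ` carrier (sec (twist X M x) V)"
  then obtain \<sigma> where \<sigma>: "\<sigma> \<in> carrier (sec T.TP.PP V)" and s: "s = T.tensor_hom V \<sigma>"
    unfolding twist_eq by blast
  note sc = T.lift.lift_closed[OF V \<sigma>]
  have "val x V (T.tensor_hom V \<sigma>) 0 = 0" if xV: "x \<in> V"
  proof -
    obtain W C where W: "open_in X W" "x \<in> W" "W \<subseteq> V" "W \<subseteq> U" "T.TP.represents \<sigma> W C"
      by (rule T.TP.represents_at[OF \<sigma> xV U_open x_in])
    have C: "C \<in> carrier (sec T.TP W)"
      using W(5) unfolding T.TP.represents_def T.TP.section_over_def by simp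
    obtain f where f: "f \<in> carrier (sec I W)" "C = T.tpure W (res M U W (l 0)) f"
      using tensor_eq_pure[OF framed_axioms W(1,4) C] by blast
    have m: "res M U W (l 0) \<in> carrier (sec M W)" by (rule res_e_closed[OF W(1,4)]) simp
    have fh: "f \<in> hol W" "f x = 0" using f(1) W(2) unfolding ideal_carrier by auto
    have "val x V (T.tensor_hom V \<sigma>) 0 = val x W (res M V W (T.tensor_hom V \<sigma>)) 0"
      by (rule val_res[OF V xV x_in sc nat_0_less_1 W(1,3,2), symmetric])
    also have "res M V W (T.tensor_hom V \<sigma>) = f \<odot>\<^bsub>sec M W\<^esub> res M U W (l 0)"
      unfolding T.lift.lift_local[OF V \<sigma> W(3,5)] f(2) by (rule T.presheaf_hom(2)[OF W(1) m f(1)])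
    also have "val x W (f \<odot>\<^bsub>sec M W\<^esub> res M U W (l 0)) 0 = 0"
      unfolding val_smult[OF W(1,2) x_in m nat_0_less_1 fh(1)] fh(2) by simp
    finally show ?thesis .
  qed
  then show "s \<in> {s \<in> carrier (sec M V). x \<in> V \<longrightarrow> (\<forall>k\<in>{0}. val x V s k = 0)}"
    unfolding s using sc by simp
next
  fix s assume "s \<in> {s \<in> carrier (sec M V). x \<in> V \<longrightarrow> (\<forall>k\<in>{0}. val x V s k = 0)}"
  then have s: "s \<in> carrier (sec M V)" "x \<in> V \<Longrightarrow> val x V s 0 = 0" by auto
  have "\<exists>\<sigma>\<in>carrier (sec T.TP.PP V). T.tensor_hom V \<sigma> = s"
  proof (rule T.lift.lift_surj[OF presheaf_hom_local_inj V s(1)])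
    fix y assume y: "y \<in> V"
    then have yt: "y \<in> topspace (points X)" using openin_subset[OF V] by auto
    \<comment> \<open>The frame is chosen so that the coordinate of \<open>s\<close> lies in the
      ideal: at \<open>x\<close> the given frame works by hypothesis, elsewhere the domain is shrunk
      to omit \<open>x\<close> and the condition becomes void.\<close>
    have "\<exists>N l'. y \<in> N \<and> framed X M 1 N l' \<and>
        (x \<in> N \<inter> V \<longrightarrow> framed.val X M 1 N l' x (N \<inter> V) (res M V (N \<inter> V) s) 0 = 0)"
    proof (cases "y = x")
      case True
      have o: "open_in X (U \<inter> V)" using U_open V by (rule openin_Int)
      have "val x (U \<inter> V) (res M V (U \<inter> V) s) 0 = 0" if "x \<in> U \<inter> V"
        using val_res[OF V _ x_in s(1) nat_0_less_1 o _ that] s(2) that by simp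
      then show ?thesis using True x_in framed_axioms by blast
    next
      case False
      obtain N l' where N: "y \<in> N" "framed X M 1 N l'" by (rule framed_at_point[OF M_bundle yt])
      interpret L: framed X M 1 N l' by (rule N(2))
      have "framed X M 1 (N - {x}) (\<lambda>i. res M N (N - {x}) (l' i))"
        by (rule L.restrict_framed[OF open_in_delete[OF L.U_open]]) auto
      then show ?thesis using N(1) False
        by (intro exI[of _ "N - {x}"] exI[of _ "\<lambda>i. res M N (N - {x}) (l' i)"]) simp
    qed
    then obtain N l' where N: "y \<in> N" "framed X M 1 N l'"
      and z: "x \<in> N \<inter> V \<longrightarrow> framed.val X M 1 N l' x (N \<inter> V) (res M V (N \<inter> V) s) 0 = 0"
      by (elim exE conjE) (rule that)
    interpret L: framed X M 1 N l' by (rule N(2))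
    let ?W = "N \<inter> V"
    have W: "open_in X ?W" "?W \<subseteq> N" "?W \<subseteq> V" using L.U_open V by (auto intro: openin_Int)
    define f where "f = (\<lambda>y\<in>?W. L.val y ?W (res M V ?W s) 0)"
    note g = framed_section[OF N(2) W(1,2) res_closed[OF V W(1,3) s(1)], folded f_def]
    have f: "f \<in> carrier (sec I ?W)"
      unfolding ideal_carrier using g(1) z by (simp add: f_def del: restrict_hol_iff)
    have m: "res M N ?W (l' 0) \<in> carrier (sec M ?W)" by (rule L.res_e_closed[OF W(1,2)]) simp
    show "\<exists>W C. y \<in> W \<and> W \<subseteq> V \<and> T.TP.section_over W C \<and> res M V W s = T.presheaf_hom W C"
      by (rule exI[of _ ?W], rule exI[of _ "T.tpure ?W (res M N ?W (l' 0)) f"])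
        (use y N(1) T.tpure_section[OF W(1) m f] T.presheaf_hom(2)[OF W(1) m f] g(2) in simp)
  qed
  then show "s \<in> T.tensor_hom V ` carrier (sec (twist X M x) V)" unfolding twist_eq by blast
qed

lemma twist_modification: "modification X M 1 U l x {0} (twist X M x) T.tensor_hom"
proof (intro modification.intro framed_axioms modification_axioms.intro)
  show "x \<in> U" by (rule x_in)
  show "{0} \<subseteq> {..<1::nat}" by simp
  show "sheaf_hom X (twist X M x) M T.tensor_hom" unfolding twist_eq by (rule T.lift.lift_hom)
  fix V assume V: "open_in X V"
  show "\<zero>\<^bsub>sec (twist X M x) V\<^esub> \<in> carrier (sec (twist X M x) V)"
    unfolding twist_eq by (rule T.TP.PP_zero_closed[OF V])
  show "s \<oplus>\<^bsub>sec (twist X M x) V\<^esub> t \<in> carrier (sec (twist X M x) V)"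
    if "s \<in> carrier (sec (twist X M x) V)" "t \<in> carrier (sec (twist X M x) V)" for s t
    using that unfolding twist_eq by (rule T.TP.PP_add_closed[OF V])
  show "f \<odot>\<^bsub>sec (twist X M x) V\<^esub> s \<in> carrier (sec (twist X M x) V)"
    if "f \<in> hol V" "s \<in> carrier (sec (twist X M x) V)" for f s
    using that unfolding twist_eq by (rule T.TP.PP_smult_closed[OF V])
  show "res (twist X M x) V W s \<in> carrier (sec (twist X M x) W)"
    if "open_in X W" "W \<subseteq> V" "s \<in> carrier (sec (twist X M x) V)" for W s
    using that unfolding twist_eq by (rule T.TP.PP_res_closed)
  interpret TV: tensor_pair "structure_sheaf X V" "sec M V" "sec I V" by (rule T.tensor_pair[OF V])
  have "T.TP.section_over V \<zero>\<^bsub>sec T.TP V\<^esub>"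
    unfolding T.TP.section_over_def using V T.TP.sec_zero_closed by simp
  then show "T.tensor_hom V \<zero>\<^bsub>sec (twist X M x) V\<^esub> = \<zero>\<^bsub>sec M V\<^esub>"
    unfolding twist_eq T.TP.PP_ops using T.lift.lift_to_sheaf T.presheaf_hom_zero[OF V]
    by (simp add: T.TP_sec TV.T_zero)
  show "inj_on (T.tensor_hom V) (carrier (sec (twist X M x) V))"
    unfolding twist_eq
    by (rule inj_onI) (rule T.lift.lift_inj[OF presheaf_hom_local_inj V])
  show "T.tensor_hom V ` carrier (sec (twist X M x) V)
    = {s \<in> carrier (sec M V). x \<in> V \<longrightarrow> (\<forall>k\<in>{0}. val x V s k = 0)}"
    by (rule twist_image[OF V])
qed

lemma twist_inclusion: "twist_inclusion X M x T.tensor_hom"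
  unfolding twist_inclusion_def
proof (intro conjI allI impI ballI)
  show "sheaf_hom X (twist X M x) M T.tensor_hom" unfolding twist_eq by (rule T.lift.lift_hom)
qed (rule T.tensor_hom_pure)

end

section \<open>The Hecke transform\<close>

text \<open>The kernel sheaf shares the operations of \<open>F\<close> and differs only in its
  carriers, so \<open>j\<close> is the identity. The adapted frame translates membership of the
  fiber class in \<open>S\<close> into the vanishing of the coordinates with index at least
  \<open>n\<close>; over sets that miss \<open>x\<close> the skyscraper has only the zero
  section.\<close>

lemma (in framed) hecke_modification:
  assumes x: "x \<in> U" and n: "n \<le> r" and S: "subgroup S (add_monoid (fiber X F x))"
    and adapted: "\<And>V s. open_in X V \<Longrightarrow> x \<in> V \<Longrightarrow> s \<in> carrier (sec F V) \<Longrightarrow>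
      at_point X F x V s \<in> S \<longleftrightarrow> (\<forall>k\<in>{n..<r}. val x V s k = 0)"
  shows "modification X F r U e x {n..<r} (hecke_transform X F x S) (\<lambda>V s. s)"
proof -
  let ?E = "hecke_transform X F x S"
  have ops: "s \<oplus>\<^bsub>sec ?E V\<^esub> t = s \<oplus>\<^bsub>sec F V\<^esub> t" "\<zero>\<^bsub>sec ?E V\<^esub> = \<zero>\<^bsub>sec F V\<^esub>"
    "f \<odot>\<^bsub>sec ?E V\<^esub> s = f \<odot>\<^bsub>sec F V\<^esub> s" "res ?E = res F" for V s t f
    by (simp_all add: hecke_transform_def kernel_sheaf_def)
  have carrier: "s \<in> carrier (sec ?E V) \<longleftrightarrow> s \<in> carrier (sec F V) \<and> (x \<in> V \<longrightarrow> (\<forall>k\<in>{n..<r}. val x V s k = 0))"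
    if V: "open_in X V" for V s
  proof -
    have "fiber_projection X F x S V s = \<zero>\<^bsub>sec (fiber_quotient_sheaf X F x S) V\<^esub> \<longleftrightarrow>
        (x \<in> V \<longrightarrow> (\<forall>k\<in>{n..<r}. val x V s k = 0))" if s: "s \<in> carrier (sec F V)"
    proof (cases "x \<in> V")
      case True
      then show ?thesis using fiber_projection_zero_iff[OF x S V True s] adapted[OF V True s] by simp
    next
      case False
      then show ?thesis
        by (simp add: fiber_projection_def fiber_quotient_sheaf_def skyscraper_def make_module_def)
    qed
    then show ?thesis by (auto simp: hecke_transform_def kernel_sheaf_def)
  qed
  show ?thesis
  proof (intro modification.intro framed_axioms modification_axioms.intro, unfold ops)
    show "x \<in> U" by (rule x)
    show "{n..<r} \<subseteq> {..<r}" by auto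
    show "sheaf_hom X ?E F (\<lambda>V s. s)"
      by (rule sheaf_homI) (simp_all add: ops carrier)
    fix V assume V: "open_in X V"
    show "\<zero>\<^bsub>sec F V\<^esub> \<in> carrier (sec ?E V)"
      unfolding carrier[OF V] using sec_zero_closed[OF V] val_zero[OF V _ x] by simp
    show "s \<oplus>\<^bsub>sec F V\<^esub> t \<in> carrier (sec ?E V)" if "s \<in> carrier (sec ?E V)" "t \<in> carrier (sec ?E V)" for s t
      using that sec_add_closed[OF V] val_add[OF V _ x] unfolding carrier[OF V] by simp
    show "f \<odot>\<^bsub>sec F V\<^esub> s \<in> carrier (sec ?E V)" if "f \<in> hol V" "s \<in> carrier (sec ?E V)" for f s
      using that sec_smult_closed[OF V] val_smult[OF V _ x] unfolding carrier[OF V] by simp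
    show "res F V W s \<in> carrier (sec ?E W)"
      if W: "open_in X W" "W \<subseteq> V" and s: "s \<in> carrier (sec ?E V)" for W s
    proof -
      have s': "s \<in> carrier (sec F V)" using s unfolding carrier[OF V] by simp
      have "val x W (res F V W s) k = 0" if "x \<in> W" "k \<in> {n..<r}" for k
        using val_res[OF V _ x s' _ W that(1), of k] s that W(2) unfolding carrier[OF V] by auto
      then show ?thesis unfolding carrier[OF W(1)] using res_closed[OF V W s'] by simp
    qed
    show "(\<lambda>s. s) ` carrier (sec ?E V) = {s \<in> carrier (sec F V). x \<in> V \<longrightarrow> (\<forall>k\<in>{n..<r}. val x V s k = 0)}"
      using carrier[OF V] by auto
  qed (rule refl, simp)
qed

section \<open>The inherited orthogonal structure\<close>

lemma sum_split_lessThan: "(\<Sum>i<n + m. f i) = (\<Sum>i<n. f i) + (\<Sum>k<m. f (n + k :: nat) :: complex)"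
  by (induction m) (simp_all add: add.assoc)

lemma sum_double_delta:
  fixes h :: "nat \<Rightarrow> nat \<Rightarrow> complex"
  assumes "k < r" "l < r"
    and f: "\<And>a. a < r \<Longrightarrow> f a = (if a = k then c else 0)"
    and g: "\<And>b. b < r \<Longrightarrow> g b = (if b = l then d else 0)"
  shows "(\<Sum>a<r. \<Sum>b<r. f a * g b * h a b) = c * d * h k l"
proof -
  have "(\<Sum>a<r. \<Sum>b<r. f a * g b * h a b) = (\<Sum>a<r. if a = k then c * d * h k l else 0)"
  proof (rule sum.cong[OF refl])
    fix a assume "a \<in> {..<r}"
    then have a: "a < r" by simp
    have "(\<Sum>b<r. f a * g b * h a b) = (\<Sum>b<r. if b = l then f a * d * h a b else 0)"
      by (rule sum.cong[OF refl]) (simp add: g)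
    also have "\<dots> = f a * d * h a l" using assms(2) by simp
    finally show "(\<Sum>b<r. f a * g b * h a b) = (if a = k then c * d * h k l else 0)"
      using f[OF a] by simp
  qed
  then show ?thesis using assms(1) by simp
qed

text \<open>Has literally the shape of the right-hand side of \<open>nondegenerate_iff\<close>, so
  that the two can be exchanged by unfolding.\<close>

definition nondegenerate :: "nat \<Rightarrow> (nat \<Rightarrow> nat \<Rightarrow> complex) \<Rightarrow> bool" where
  "nondegenerate r G \<longleftrightarrow> (\<forall>a. (\<forall>j<r. (\<Sum>i<r. a i * G i j) = 0) \<longrightarrow> (\<forall>i<r. a i = 0))"

lemma nondegenerateD:
  "nondegenerate r G \<Longrightarrow> (\<And>j. j < r \<Longrightarrow> (\<Sum>i<r. a i * G i j) = 0) \<Longrightarrow> i < r \<Longrightarrow> a i = 0"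
  unfolding nondegenerate_def by simp

text \<open>In block form, \<open>G\<close> is [0 B; B' D] and \<open>H\<close> is [A B; B' 0], where B' is the transpose
  of B; both are nondegenerate exactly if B is invertible.\<close>

lemma nondegenerate_block:
  assumes nd: "nondegenerate (n + n) G"
    and sym: "\<And>i j. i < n + n \<Longrightarrow> j < n + n \<Longrightarrow> G i j = G j i"
    and iso: "\<And>i j. i < n \<Longrightarrow> j < n \<Longrightarrow> G i j = 0"
    and upper: "\<And>i k. i < n \<Longrightarrow> k < n \<Longrightarrow> H i (n + k) = G i (n + k)"
    and lower: "\<And>i k. i < n \<Longrightarrow> k < n \<Longrightarrow> H (n + k) i = G (n + k) i"
    and zero: "\<And>i k. i < n \<Longrightarrow> k < n \<Longrightarrow> H (n + i) (n + k) = 0"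
  shows "nondegenerate (n + n) H"
  unfolding nondegenerate_def
proof (intro allI impI)
  fix a m assume a: "\<forall>j<n + n. (\<Sum>i<n + n. a i * H i j) = 0" and m: "m < n + n"
  \<comment> \<open>A relation between the rows of B, padded by zeros, annihilates \<open>G\<close>
    from the left: in the first \<open>n\<close> columns because that block is zero, in the others
    by the relation itself.\<close>
  have B: "independent_rows n n (\<lambda>i k. G i (n + k))"
  proof (rule independent_rowsI)
    fix c i assume c: "\<And>k. k < n \<Longrightarrow> (\<Sum>i<n. c i * G i (n + k)) = 0" and i: "i < n"
    define c' where "c' i = (if i < n then c i else 0)" for i
    have c'_sum: "(\<Sum>i<n + n. c' i * G i j) = (\<Sum>i<n. c i * G i j)" for j
      unfolding sum_split_lessThan by (simp add: c'_def)
    have "c' i = 0"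
    proof (rule nondegenerateD[OF nd])
      fix j assume j: "j < n + n"
      show "(\<Sum>i<n + n. c' i * G i j) = 0"
      proof (cases "j < n")
        case True
        then show ?thesis unfolding c'_sum by (simp add: iso)
      next
        case False
        then have "j = n + (j - n)" "j - n < n" using j by auto
        then show ?thesis unfolding c'_sum using c[of "j - n"] by simp
      qed
    qed (use i in simp)
    then show "c i = 0" using i by (simp add: c'_def)
  qed
  \<comment> \<open>In the last \<open>n\<close> columns \<open>H\<close> has only the block B,
    because its lower right block is zero; this determines the upper half of
    \<open>a\<close>.\<close>
  have low: "a i = 0" if i: "i < n" for i
  proof (rule independent_rowsD[OF B _ i])
    fix k assume k: "k < n"
    have "(\<Sum>i<n. a i * G i (n + k)) = (\<Sum>i<n + n. a i * H i (n + k))"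
      unfolding sum_split_lessThan by (simp add: upper zero k)
    then show "(\<Sum>i<n. a i * G i (n + k)) = 0" using a k by simp
  qed
  \<comment> \<open>With the upper half of \<open>a\<close> gone, the first \<open>n\<close> columns
    see only the lower left block, the transpose of B by symmetry, so the lower half is a relation
    between the columns of B.\<close>
  have "a (n + k) = 0" if k: "k < n" for k
  proof (rule independent_rows_imp_independent_columns[OF B _ k])
    fix i assume i: "i < n"
    have "(\<Sum>k<n. G i (n + k) * a (n + k)) = (\<Sum>k<n. a (n + k) * H (n + k) i)"
      by (rule sum.cong[OF refl]) (use i sym[of i] in \<open>simp add: lower\<close>)
    also have "\<dots> = (\<Sum>m<n + n. a m * H m i)"
      unfolding sum_split_lessThan by (simp add: low)
    finally show "(\<Sum>k<n. G i (n + k) * a (n + k)) = 0" using a i by simp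
  qed
  from this[of "m - n"] show "a m = 0" using low[of m] m by (cases "m < n") auto
qed

text \<open>Frames of the two bundles come with different domains; both are restricted to the common
  part inside \<open>N\<close>.\<close>

lemma (in surface_charts) common_frames:
  assumes "vector_bundle X r F" "vector_bundle X q M" "y \<in> topspace (points X)"
    and N: "open_in X N" "y \<in> N"
  obtains U e l where "y \<in> U" "U \<subseteq> N" "framed X F r U e" "framed X M q U l"
proof -
  obtain U1 e1 where F: "y \<in> U1" "framed X F r U1 e1" by (rule framed_at_point[OF assms(1,3)])
  obtain U2 l2 where M: "y \<in> U2" "framed X M q U2 l2" by (rule framed_at_point[OF assms(2,3)])
  interpret F: framed X F r U1 e1 by (rule F(2))
  interpret M: framed X M q U2 l2 by (rule M(2))
  have o: "open_in X (N \<inter> (U1 \<inter> U2))" using N F.U_open M.U_open by (simp add: openin_Int)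
  show ?thesis
    by (rule that[OF _ _ F.restrict_framed[OF o] M.restrict_framed[OF o]]) (use F(1) M(1) N in auto)
qed

lemma (in surface_charts) framed_formI:
  assumes "framed X F r U e" "framed X M 1 U l" "sheaf_hom X (tensor_sheaf X F F) M \<psi>"
  shows "framed_form X F M \<psi> r U e l"
proof -
  interpret F: framed X F r U e by fact
  interpret M: framed X M 1 U l by fact
  interpret FF: presheaf_pair X F F by unfold_locales
  show ?thesis
    by (intro framed_form.intro assms(1,2) FF.bilinear_of_sheaf_hom assms(3) M.presheaf)
qed

text \<open>Here \<open>e\<close> is a frame of \<open>F\<close> whose first \<open>n\<close> members span \<open>S\<close> at \<open>x\<close>.\<close>

locale hecke_data = A: framed_form X F M \<psi> "n + n" U e l +
    ME: modification X F "n + n" U e x "{n..<n + n}" E "\<lambda>V s. s" +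
    Tw: point_twist X M U l x
  for X :: "'x surface" and F :: "('x, 'f) msheaf" and M :: "('x, 'm) msheaf"
    and \<psi> :: "'x set \<Rightarrow> ('x, 'f, 'f) tensor_section \<Rightarrow> 'm" and n :: nat
    and U :: "'x set" and e :: "nat \<Rightarrow> 'f" and l :: "nat \<Rightarrow> 'm" and x :: 'x and E :: "('x, 'f) msheaf" +
  assumes F_bundle: "vector_bundle X (n + n) F"
    and form_hom: "sheaf_hom X (tensor_sheaf X F F) M \<psi>"
    and form_sym: "\<And>V s t. open_in X V \<Longrightarrow> s \<in> carrier (sec F V) \<Longrightarrow> t \<in> carrier (sec F V)
      \<Longrightarrow> A.form V s t = A.form V t s"
    and form_nondegenerate: "\<And>y. y \<in> topspace (points X) \<Longrightarrow>
      \<forall>v\<in>carrier (fiber X F y). (\<forall>w\<in>carrier (fiber X F y). fiber_form X F M \<psi> y v w = \<zero>\<^bsub>fiber X M y\<^esub>)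
        \<longrightarrow> v = \<zero>\<^bsub>fiber X F y\<^esub>"
    and gram_isotropic: "\<And>i j. i < n \<Longrightarrow> j < n \<Longrightarrow> A.gram i j x = 0"
begin

abbreviation "L \<equiv> twist X M x"
abbreviation "j \<equiv> Tw.T.tensor_hom"

sublocale TL: modification X M 1 U l x "{0}" "twist X M x" "Tw.T.tensor_hom"
  by (rule Tw.twist_modification)

section \<open>The form on \<open>E\<close> and its factorization through
  \<open>M(-x)\<close>\<close>

lemma E_bilinear: "bilinear_to_sheaf X E E M A.form"
proof unfold_locales
  fix V s t assume V: "open_in X V" and s: "s \<in> carrier (sec E V)" and t: "t \<in> carrier (sec E V)"
  note s' = ME.j_closed[OF V s] and t' = ME.j_closed[OF V t]
  show "A.form V s t \<in> carrier (sec M V)" by (rule A.B.closed[OF V s' t'])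
  show "A.form V (s \<oplus>\<^bsub>sec E V\<^esub> s1) t = A.form V s t \<oplus>\<^bsub>sec M V\<^esub> A.form V s1 t" if "s1 \<in> carrier (sec E V)" for s1
    unfolding ME.j_add[OF V s that] by (rule A.B.add_left[OF V s' ME.j_closed[OF V that] t'])
  show "A.form V s (t \<oplus>\<^bsub>sec E V\<^esub> t1) = A.form V s t \<oplus>\<^bsub>sec M V\<^esub> A.form V s t1" if "t1 \<in> carrier (sec E V)" for t1
    unfolding ME.j_add[OF V t that] by (rule A.B.add_right[OF V s' t' ME.j_closed[OF V that]])
  fix f assume f: "f \<in> carrier (structure_sheaf X V)"
  show "A.form V (f \<odot>\<^bsub>sec E V\<^esub> s) t = f \<odot>\<^bsub>sec M V\<^esub> A.form V s t"
    unfolding ME.j_smult[OF V s f] by (rule A.B.smult_left[OF V f s' t'])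
  show "A.form V s (f \<odot>\<^bsub>sec E V\<^esub> t) = f \<odot>\<^bsub>sec M V\<^esub> A.form V s t"
    unfolding ME.j_smult[OF V t f] by (rule A.B.smult_right[OF V f s' t'])
next
  fix V W s t assume V: "open_in X V" "open_in X W" "W \<subseteq> V"
    and s: "s \<in> carrier (sec E V)" and t: "t \<in> carrier (sec E V)"
  show "A.form W (res E V W s) (res E V W t) = res M V W (A.form V s t)"
    unfolding ME.j_res[OF V(1) s V(2,3)] ME.j_res[OF V(1) t V(2,3)]
    by (rule A.B.restricts[OF V ME.j_closed[OF V(1) s] ME.j_closed[OF V(1) t]])
qed

sublocale EE: bilinear_to_sheaf X E E M "\<lambda>V s t. \<psi> V (pure_tensor X F F V s t)"
  by (rule E_bilinear)

text \<open>Every term of the Gram expansion vanishes at \<open>x\<close>: an index of at least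
  \<open>n\<close> makes a coordinate of a section of \<open>E\<close> zero, and two smaller indices
  meet the isotropic block.\<close>

lemma form_vanishes:
  assumes V: "open_in X V" "x \<in> V" and s: "s \<in> carrier (sec E V)" and t: "t \<in> carrier (sec E V)"
  shows "A.M.val x V (A.form V s t) 0 = 0"
  unfolding A.form_val[OF V ME.x ME.j_closed[OF V(1) s] ME.j_closed[OF V(1) t]]
proof (intro sum.neutral ballI)
  fix a b assume "a \<in> {..<n + n}" "b \<in> {..<n + n}"
  then show "A.F.val x V s a * A.F.val x V t b * A.gram a b x = 0"
    using ME.j_vanishes[OF V(1) s V(2), of a] ME.j_vanishes[OF V(1) t V(2), of b] gram_isotropic[of a b]
    by (cases "a < n"; cases "b < n") auto
qed

text \<open>A section of \<open>E \<otimes> E\<close> over \<open>V\<close> need not be a sum of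
  pure tensors, but near \<open>x\<close> it is represented by a class of formal sums, where
  induction reduces the claim to \<open>form_vanishes\<close>.\<close>

lemma tensor_form_vanishes:
  assumes V: "open_in X V" and \<sigma>: "\<sigma> \<in> carrier (sec (tensor_sheaf X E E) V)" and x: "x \<in> V"
  shows "A.M.val x V (EE.tensor_hom V \<sigma>) 0 = 0"
proof -
  note \<sigma>' = \<sigma>[unfolded EE.tensor_sheaf_eq]
  obtain W C where W: "open_in X W" "x \<in> W" "W \<subseteq> V" "W \<subseteq> V" "EE.TP.represents \<sigma> W C"
    by (rule EE.TP.represents_at[OF \<sigma>' x V x])
  have C: "C \<in> carrier (sec EE.TP W)"
    using W(5) unfolding EE.TP.represents_def EE.TP.section_over_def by simp
  have "A.M.val x W (EE.presheaf_hom W C) 0 = 0"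
    using W(1) C
  proof (induction rule: EE.TP_induct)
    case zero
    show ?case unfolding EE.presheaf_hom_zero[OF W(1)] by (rule A.M.val_zero[OF W(1,2) ME.x nat_0_less_1])
  next
    case (pure s t)
    show ?case unfolding EE.presheaf_hom(2)[OF W(1) pure] by (rule form_vanishes[OF W(1,2) pure])
  next
    case (diff c d)
    interpret EW: tensor_pair "structure_sheaf X W" "sec E W" "sec E W" by (rule EE.tensor_pair[OF W(1)])
    note cc = EE.presheaf_hom_closed[OF W(1) EE.TP_carrierI[OF W(1)]]
    have "A.M.val x W (EE.presheaf_hom W (EE.tcls W c)) 0
      = A.M.val x W (EE.presheaf_hom W (EE.tcls W (c - d))) 0 + A.M.val x W (EE.presheaf_hom W (EE.tcls W d)) 0"
      unfolding EE.presheaf_hom_diff[OF W(1) diff(1,2)]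
      by (rule A.M.val_add[OF W(1,2) ME.x cc[OF EW.formal_diff[OF diff(1,2)]] nat_0_less_1 cc[OF diff(2)]])
    then show ?case using diff(3,4) by simp
  qed
  then show ?thesis
    unfolding EE.lift.lift_local[OF V \<sigma>' W(3,5), symmetric]
      A.M.val_res[OF V x ME.x EE.lift.lift_closed[OF V \<sigma>'] nat_0_less_1 W(1,3,2)] .
qed

text \<open>The inverse of the injection of \<open>M(-x)\<close> into \<open>M\<close>, applied to
  the form on \<open>E\<close>. No frame or parameter enters, so there is nothing to glue.\<close>

definition \<phi> :: "'x set \<Rightarrow> ('x, 'f, 'f) tensor_section \<Rightarrow> ('x, 'm, 'x \<Rightarrow> complex) tensor_section" where
  "\<phi> V \<sigma> = inv_into (carrier (sec L V)) (j V) (EE.tensor_hom V \<sigma>)"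

lemma phi:
  assumes V: "open_in X V" and \<sigma>: "\<sigma> \<in> carrier (sec (tensor_sheaf X E E) V)"
  shows "\<phi> V \<sigma> \<in> carrier (sec L V)" "j V (\<phi> V \<sigma>) = EE.tensor_hom V \<sigma>"
proof -
  have "EE.tensor_hom V \<sigma> \<in> j V ` carrier (sec L V)"
    unfolding TL.j_image[OF V]
    using EE.lift.lift_closed[OF V \<sigma>[unfolded EE.tensor_sheaf_eq]] tensor_form_vanishes[OF V \<sigma>] by simp
  then show "\<phi> V \<sigma> \<in> carrier (sec L V)" "j V (\<phi> V \<sigma>) = EE.tensor_hom V \<sigma>"
    unfolding \<phi>_def by (rule inv_into_into, rule f_inv_into_f)
qed

text \<open>Each identity is checked after applying the injective morphism \<open>j\<close>, where
  it is the same property of the form with values in \<open>M\<close>.\<close>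

lemma phi_hom: "sheaf_hom X (tensor_sheaf X E E) L \<phi>"
proof (rule sheaf_homI)
  fix V \<sigma> assume V: "open_in X V" and \<sigma>: "\<sigma> \<in> carrier (sec (tensor_sheaf X E E) V)"
  note h = sheaf_homD[OF EE.tensor_hom V \<sigma>]
  show "\<phi> V \<sigma> \<in> carrier (sec L V)" by (rule phi(1)[OF V \<sigma>])
  show "\<phi> V (\<sigma> \<oplus>\<^bsub>sec (tensor_sheaf X E E) V\<^esub> \<tau>) = \<phi> V \<sigma> \<oplus>\<^bsub>sec L V\<^esub> \<phi> V \<tau>"
    if \<tau>: "\<tau> \<in> carrier (sec (tensor_sheaf X E E) V)" for \<tau>
  proof -
    have s: "\<sigma> \<oplus>\<^bsub>sec (tensor_sheaf X E E) V\<^esub> \<tau> \<in> carrier (sec (tensor_sheaf X E E) V)"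
      using \<sigma> \<tau> unfolding EE.tensor_sheaf_eq by (rule EE.TP.PP_add_closed[OF V])
    show ?thesis
      by (rule TL.j_eqD[OF V phi(1)[OF V s] TL.G_add[OF V phi(1)[OF V \<sigma>] phi(1)[OF V \<tau>]]])
        (unfold phi(2)[OF V s] TL.j_add[OF V phi(1)[OF V \<sigma>] phi(1)[OF V \<tau>]] phi(2)[OF V \<sigma>] phi(2)[OF V \<tau>],
          rule h(2)[OF \<tau>])
  qed
  show "\<phi> V (f \<odot>\<^bsub>sec (tensor_sheaf X E E) V\<^esub> \<sigma>) = f \<odot>\<^bsub>sec L V\<^esub> \<phi> V \<sigma>"
    if f: "f \<in> carrier (structure_sheaf X V)" for f
  proof -
    have s: "f \<odot>\<^bsub>sec (tensor_sheaf X E E) V\<^esub> \<sigma> \<in> carrier (sec (tensor_sheaf X E E) V)"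
      using f \<sigma> unfolding EE.tensor_sheaf_eq by (rule EE.TP.PP_smult_closed[OF V])
    show ?thesis
      by (rule TL.j_eqD[OF V phi(1)[OF V s] TL.G_smult[OF V f phi(1)[OF V \<sigma>]]])
        (unfold phi(2)[OF V s] TL.j_smult[OF V phi(1)[OF V \<sigma>] f] phi(2)[OF V \<sigma>], rule h(3)[OF f])
  qed
  fix W assume W: "open_in X W" "W \<subseteq> V"
  have s: "res (tensor_sheaf X E E) V W \<sigma> \<in> carrier (sec (tensor_sheaf X E E) W)"
    using \<sigma> unfolding EE.tensor_sheaf_eq by (rule EE.TP.PP_res_closed[OF W])
  show "\<phi> W (res (tensor_sheaf X E E) V W \<sigma>) = res L V W (\<phi> V \<sigma>)"
    by (rule TL.j_eqD[OF W(1) phi(1)[OF W(1) s] TL.G_res[OF V W phi(1)[OF V \<sigma>]]])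
      (unfold phi(2)[OF W(1) s] TL.j_res[OF V phi(1)[OF V \<sigma>] W] phi(2)[OF V \<sigma>], rule h(4)[OF W])
qed

lemma phi_pure:
  assumes V: "open_in X V" and s: "s \<in> carrier (sec E V)" and t: "t \<in> carrier (sec E V)"
  shows "\<phi> V (pure_tensor X E E V s t) \<in> carrier (sec L V)"
    and "j V (\<phi> V (pure_tensor X E E V s t)) = A.form V s t"
proof -
  have p: "pure_tensor X E E V s t \<in> carrier (sec (tensor_sheaf X E E) V)"
    unfolding EE.tensor_sheaf_eq EE.pure_tensor_eq
    by (rule EE.TP.to_sheaf_closed[OF EE.tpure_section[OF V s t]])
  show "\<phi> V (pure_tensor X E E V s t) \<in> carrier (sec L V)" by (rule phi(1)[OF V p])
  show "j V (\<phi> V (pure_tensor X E E V s t)) = A.form V s t"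
    unfolding phi(2)[OF V p] by (rule EE.tensor_hom_pure[OF V s t])
qed

lemma phi_symmetric:
  assumes V: "open_in X V" and s: "s \<in> carrier (sec E V)" and t: "t \<in> carrier (sec E V)"
  shows "\<phi> V (pure_tensor X E E V s t) = \<phi> V (pure_tensor X E E V t s)"
  by (rule TL.j_eqD[OF V phi_pure(1)[OF V s t] phi_pure(1)[OF V t s]])
    (unfold phi_pure(2)[OF V s t] phi_pure(2)[OF V t s],
      rule form_sym[OF V ME.j_closed[OF V s] ME.j_closed[OF V t]])

section \<open>Nondegeneracy of the induced form\<close>

lemma gram_nondegenerate:
  assumes "framed_form X F M \<psi> (n + n) U' e' l'" "y \<in> U'"
  shows "nondegenerate (n + n) (\<lambda>i k. framed_form.gram X F M \<psi> U' e' l' i k y)"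
proof -
  interpret Q: framed_form X F M \<psi> "n + n" U' e' l' by fact
  have "y \<in> topspace (points X)" using assms(2) openin_subset[OF Q.F.U_open] by auto
  from form_nondegenerate[OF this] show ?thesis
    unfolding nondegenerate_def Q.nondegenerate_iff[OF assms(2)] .
qed

lemma gram_sym: "i < n + n \<Longrightarrow> k < n + n \<Longrightarrow> A.gram i k y = A.gram k i y"
  unfolding A.gram_def using form_sym[OF A.F.U_open A.F.e_closed A.F.e_closed] by simp

text \<open>The old and new Gram matrices determine each other up to powers of \<zeta>. Holomorphy
  of both allows one factor \<zeta> to be cancelled on a neighbourhood; at \<open>x\<close> the
  off-diagonal blocks then coincide and the lower right block of the new matrix vanishes, which is
  the situation of \<open>nondegenerate_block\<close>. The upper left block of the new matrix needs
  no description.\<close>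

lemma phi_nondegenerate_center:
  shows "\<exists>W b b'. x \<in> W \<and> framed_form X E L \<phi> (n + n) W b b' \<and>
    nondegenerate (n + n) (\<lambda>i k. framed_form.gram X E L \<phi> W b b' i k x)"
proof -
  obtain W \<zeta> where W: "W \<subseteq> U" and \<zeta>: "A.F.local_parameter x W \<zeta>"
    by (rule A.F.local_parameter_exists[OF A.F.U_open ME.x])
  note oW = A.F.local_parameterD(1)[OF \<zeta>] and xW = A.F.local_parameterD(2)[OF \<zeta>]
    and zh = A.F.local_parameterD(3)[OF \<zeta>] and z0 = A.F.local_parameterD(4)[OF \<zeta>]
    and cancel = A.F.local_parameter_cancels[OF \<zeta> oW order_refl]
  \<comment> \<open>The multipliers that relate the frame of \<open>E\<close> to that of
    \<open>F\<close>.\<close>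
  define c where "c k y = (if k \<in> {n..<n + n} then \<zeta> y else 1)" for k y
  obtain b where b: "framed X E (n + n) W b"
    and b_val: "\<And>y k i. y \<in> W \<Longrightarrow> k < n + n \<Longrightarrow> i < n + n \<Longrightarrow>
      A.F.val y W (b k) i = (if i = k then if k \<in> {n..<n + n} then \<zeta> y else 1 else 0)"
    and b_closed: "\<And>k. k < n + n \<Longrightarrow> b k \<in> carrier (sec E W)"
  proof (rule ME.framed_at[OF W \<zeta>], goal_cases)
    case (1 b)
    show thesis by (rule that[OF 1(2)]) (rule 1(3), assumption+, rule 1(4), assumption)
  qed
  obtain b' where b': "framed X L 1 W b'"
    and b'_val: "\<And>y s i. y \<in> W \<Longrightarrow> s \<in> carrier (sec L W) \<Longrightarrow> i < 1 \<Longrightarrow>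
      A.M.val y W (j W s) i = framed.val X L 1 W b' y W s i * (if i \<in> {0} then \<zeta> y else 1)"
  proof (rule TL.framed_at[OF W \<zeta>], goal_cases)
    case (1 b)
    show thesis by (rule that[OF 1(2)]) (rule 1(5))
  qed
  have ff: "framed_form X E L \<phi> (n + n) W b b'"
    by (rule A.F.framed_formI[OF b b' phi_hom])
  interpret Q: framed_form X E L \<phi> "n + n" W b b' by (rule ff)
  \<comment> \<open>The left factor comes from the frame of \<open>M(-x)\<close>, whose member maps
    to \<zeta> times that of \<open>M\<close>; the right factors come from the two arguments in the
    frame of \<open>E\<close>.\<close>
  have key: "\<zeta> y * Q.gram i k y = c i y * c k y * A.gram i k y"
    if y: "y \<in> W" and ik: "i < n + n" "k < n + n" for y i k
  proof -
    have yU: "y \<in> U" using y W by auto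
    note bi = b_closed[OF ik(1)] and bk = b_closed[OF ik(2)]
    have "\<zeta> y * Q.gram i k y = A.M.val y W (j W (\<phi> W (pure_tensor X E E W (b i) (b k)))) 0"
      unfolding Q.gram_def b'_val[OF y phi_pure(1)[OF oW bi bk] nat_0_less_1] by simp
    also have "\<dots> = A.M.val y W (A.form W (b i) (b k)) 0" unfolding phi_pure(2)[OF oW bi bk] by (rule refl)
    also have "\<dots> = (\<Sum>p<n + n. \<Sum>q<n + n. A.F.val y W (b i) p * A.F.val y W (b k) q * A.gram p q y)"
      by (rule A.form_val[OF oW y yU ME.j_closed[OF oW bi] ME.j_closed[OF oW bk]])
    also have "\<dots> = c i y * c k y * A.gram i k y"
      by (rule sum_double_delta[OF ik]) (simp_all add: b_val[OF y ik(1)] b_val[OF y ik(2)] c_def)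
    finally show ?thesis .
  qed
  have Q_hol: "(\<lambda>y\<in>W. Q.gram i k y) \<in> A.F.hol W" if "i < n + n" "k < n + n" for i k
    unfolding Q.gram_def
    by (rule Q.M.val_hol[OF oW order_refl phi_pure(1)[OF oW b_closed[OF that(1)] b_closed[OF that(2)]] nat_0_less_1])
  have A_hol: "(\<lambda>y\<in>W. A.gram i k y) \<in> A.F.hol W" if "i < n + n" "k < n + n" for i k
  proof -
    have "restrict (\<lambda>y\<in>U. A.gram i k y) W \<in> A.F.hol W"
      unfolding A.gram_def
      by (rule A.F.hol_restrict[OF A.M.val_hol[OF A.F.U_open order_refl
            A.B.closed[OF A.F.U_open A.F.e_closed[OF that(1)] A.F.e_closed[OF that(2)]] nat_0_less_1] W])
    then show ?thesis using W by (simp add: Int_absorb1 del: A.F.restrict_hol_iff)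
  qed
  have nd: "nondegenerate (n + n) (\<lambda>i k. Q.gram i k x)"
  proof (rule nondegenerate_block)
    show "nondegenerate (n + n) (\<lambda>i k. A.gram i k x)"
      by (rule gram_nondegenerate[OF A.framed_form_axioms ME.x])
    show "A.gram i k x = A.gram k i x" if "i < n + n" "k < n + n" for i k
      by (rule gram_sym[OF that])
    show "A.gram i k x = 0" if "i < n" "k < n" for i k
      by (rule gram_isotropic[OF that])
    fix i k assume ik: "i < n" "k < n"
    then have r: "i < n + n" "n + i < n + n" "n + k < n + n" by auto
    \<comment> \<open>In an off-diagonal block exactly one of the two multipliers is \<zeta>,
      matching the factor on the left.\<close>
    have "\<forall>y\<in>W. \<zeta> y * (\<lambda>y\<in>W. Q.gram i (n + k) y) y = \<zeta> y * (\<lambda>y\<in>W. A.gram i (n + k) y) y"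
      using key[OF _ r(1,3)] ik by (simp add: c_def)
    from bspec[OF cancel[OF Q_hol[OF r(1,3)] A_hol[OF r(1,3)] this] xW]
    show "Q.gram i (n + k) x = A.gram i (n + k) x" using xW by simp
    have "\<forall>y\<in>W. \<zeta> y * (\<lambda>y\<in>W. Q.gram (n + k) i y) y = \<zeta> y * (\<lambda>y\<in>W. A.gram (n + k) i y) y"
      using key[OF _ r(3,1)] ik by (simp add: c_def)
    from bspec[OF cancel[OF Q_hol[OF r(3,1)] A_hol[OF r(3,1)] this] xW]
    show "Q.gram (n + k) i x = A.gram (n + k) i x" using xW by simp
    \<comment> \<open>Here both multipliers are \<zeta>, so after cancellation one factor \<zeta>
      survives and makes the entry vanish at \<open>x\<close>.\<close>
    have "\<forall>y\<in>W. \<zeta> y * (\<lambda>y\<in>W. Q.gram (n + i) (n + k) y) y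
        = \<zeta> y * (\<lambda>y\<in>W. \<zeta> y * (\<lambda>y\<in>W. A.gram (n + i) (n + k) y) y) y"
      using key[OF _ r(2,3)] ik by (simp add: c_def)
    from bspec[OF cancel[OF Q_hol[OF r(2,3)] A.F.hol_mult[OF zh A_hol[OF r(2,3)]] this] xW]
    show "Q.gram (n + i) (n + k) x = 0" using xW z0 by simp
  qed
  show ?thesis
    by (rule exI[of _ W], rule exI[of _ b], rule exI[of _ b'], intro conjI xW ff nd)
qed

text \<open>On an open set that misses \<open>x\<close> the frames of \<open>E\<close> and
  \<open>M(-x)\<close> are those of \<open>F\<close> and \<open>M\<close> carried over, so the two
  Gram matrices agree entry by entry.\<close>

lemma phi_nondegenerate_away:
  assumes y: "y \<in> topspace (points X)" and yx: "y \<noteq> x"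
  shows "\<exists>W b b'. y \<in> W \<and> framed_form X E L \<phi> (n + n) W b b' \<and>
    nondegenerate (n + n) (\<lambda>i k. framed_form.gram X E L \<phi> W b b' i k y)"
proof -
  have N: "open_in X (topspace (points X) - {x})" "y \<in> topspace (points X) - {x}"
    using A.F.open_in_delete[of "topspace (points X)"] y yx by auto
  obtain W e' l' where W: "y \<in> W" "W \<subseteq> topspace (points X) - {x}"
    and e': "framed X F (n + n) W e'" and l': "framed X M 1 W l'"
    by (rule A.F.common_frames[OF F_bundle Tw.M_bundle y N])
  have xW: "x \<notin> W" using W(2) by auto
  interpret A': framed_form X F M \<psi> "n + n" W e' l' by (rule A.F.framed_formI[OF e' l' form_hom])
  obtain b where b: "framed X E (n + n) W b"
    and b_eq: "\<And>k. k < n + n \<Longrightarrow> b k \<in> carrier (sec E W) \<and> b k = e' k"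
  proof (rule ME.framed_away[OF e' xW], goal_cases)
    case (1 b)
    show thesis by (rule that[OF 1(2)]) (rule 1(3))
  qed
  obtain b' where b': "framed X L 1 W b'"
    and b'_val: "\<And>y s i. y \<in> W \<Longrightarrow> s \<in> carrier (sec L W) \<Longrightarrow> i < 1 \<Longrightarrow>
      A'.M.val y W (j W s) i = framed.val X L 1 W b' y W s i"
  proof (rule TL.framed_away[OF l' xW], goal_cases)
    case (1 b)
    show thesis by (rule that[OF 1(2)]) (rule 1(4))
  qed
  have ff: "framed_form X E L \<phi> (n + n) W b b'" by (rule A.F.framed_formI[OF b b' phi_hom])
  interpret Q: framed_form X E L \<phi> "n + n" W b b' by (rule ff)
  note oW = A'.F.U_open
  have eq: "Q.gram i k y = A'.gram i k y" if ik: "i < n + n" "k < n + n" for i k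
  proof -
    note bi = conjunct1[OF b_eq[OF ik(1)]] and bk = conjunct1[OF b_eq[OF ik(2)]]
      and be = conjunct2[OF b_eq[OF ik(1)]] conjunct2[OF b_eq[OF ik(2)]]
    have "Q.gram i k y = A'.M.val y W (A.form W (b i) (b k)) 0"
      unfolding Q.gram_def b'_val[OF W(1) phi_pure(1)[OF oW bi bk] nat_0_less_1, symmetric]
        phi_pure(2)[OF oW bi bk] by (rule refl)
    then show ?thesis unfolding A'.gram_def be .
  qed
  have "nondegenerate (n + n) (\<lambda>i k. A'.gram i k y)"
    by (rule gram_nondegenerate[OF A'.framed_form_axioms W(1)])
  then have nd: "nondegenerate (n + n) (\<lambda>i k. Q.gram i k y)"
    unfolding nondegenerate_def by (simp add: eq)
  show ?thesis
    by (rule exI[of _ W], rule exI[of _ b], rule exI[of _ b'], intro conjI W(1) ff nd)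
qed

text \<open>Nondegeneracy on a fiber is intrinsic, so any pair of frames around the point may be
  used to test it: the modified ones at \<open>x\<close>, the carried-over ones elsewhere.\<close>

lemma phi_orthogonal: "orthogonal_structure X E L \<phi>"
  unfolding orthogonal_structure_def
proof (intro conjI allI impI ballI phi_hom phi_symmetric)
  fix y v assume y: "y \<in> topspace (points X)" and v: "v \<in> carrier (fiber X E y)"
    and z: "\<forall>w\<in>carrier (fiber X E y). fiber_form X E L \<phi> y v w = \<zero>\<^bsub>fiber X L y\<^esub>"
  have "\<exists>W b b'. y \<in> W \<and> framed_form X E L \<phi> (n + n) W b b' \<and>
      nondegenerate (n + n) (\<lambda>i k. framed_form.gram X E L \<phi> W b b' i k y)"
    using phi_nondegenerate_center phi_nondegenerate_away[OF y] by (cases "y = x") simp_all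
  then obtain W b b' where W: "y \<in> W" and ff: "framed_form X E L \<phi> (n + n) W b b'"
    and nd: "nondegenerate (n + n) (\<lambda>i k. framed_form.gram X E L \<phi> W b b' i k y)"
    by (elim exE conjE) (rule that)
  have "\<forall>v\<in>carrier (fiber X E y). (\<forall>w\<in>carrier (fiber X E y). fiber_form X E L \<phi> y v w = \<zero>\<^bsub>fiber X L y\<^esub>)
      \<longrightarrow> v = \<zero>\<^bsub>fiber X E y\<^esub>"
    unfolding framed_form.nondegenerate_iff[OF ff W] using nd unfolding nondegenerate_def .
  from mp[OF bspec[OF this v] z] show "v = \<zero>\<^bsub>fiber X E y\<^esub>" .
qed

lemma phi_inherited: "inherited_from X F E \<psi> j \<phi>"
  unfolding inherited_from_def by (intro allI impI ballI phi_pure(2))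

end

theorem proposition3p1:
  fixes X :: "'x surface" and x :: 'x and g n :: nat
    and F :: "('x, 'f) msheaf" and M :: "('x, 'm) msheaf"
    and \<psi> :: "'x set \<Rightarrow> ('x, 'f, 'f) tensor_section \<Rightarrow> 'm"
    and S :: "('x set \<times> 'f) set set"
    and E :: "('x, 'f) msheaf"
  assumes "riemann_surface X" "compact_space (points X)" "connected_space (points X)"
    and "has_genus X g" "g \<ge> 2"
    and "x \<in> topspace (points X)"
    and "orthogonal_bundle X (2 * n) F M \<psi>"
    and "submodule S complex_field (fiber X F x)"
    and "has_dimension complex_field (fiber X F x) S n"
    and "isotropic X F M \<psi> x S"
    and "E = hecke_transform X F x S"
  shows "\<exists>j \<phi>. twist_inclusion X M x j \<and>
           orthogonal_bundle X (2 * n) E (twist X M x) \<phi> \<and>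
           inherited_from X F E \<psi> j \<phi>"
proof -
  interpret surface_charts X by unfold_locales fact
  \<comment> \<open>The rank is written \<open>n + n\<close> from here on, in keeping with the block
    form of the Gram matrix.\<close>
  from assms(7) have F_bundle: "vector_bundle X (n + n) F" and M_bundle: "vector_bundle X 1 M"
    and orth: "orthogonal_structure X F M \<psi>"
    unfolding orthogonal_bundle_def mult_2 by simp_all
  have hom: "sheaf_hom X (tensor_sheaf X F F) M \<psi>"
    using orth unfolding orthogonal_structure_def by (elim conjE)
  have sym: "\<forall>V. open_in X V \<longrightarrow> (\<forall>s\<in>carrier (sec F V). \<forall>t\<in>carrier (sec F V).
        \<psi> V (pure_tensor X F F V s t) = \<psi> V (pure_tensor X F F V t s))"
    using orth unfolding orthogonal_structure_def by (elim conjE)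
  have nd: "\<forall>y\<in>topspace (points X). \<forall>v\<in>carrier (fiber X F y).
        (\<forall>w\<in>carrier (fiber X F y). fiber_form X F M \<psi> y v w = \<zero>\<^bsub>fiber X M y\<^esub>) \<longrightarrow> v = \<zero>\<^bsub>fiber X F y\<^esub>"
    using orth unfolding orthogonal_structure_def by (elim conjE)
  obtain U e0 l where xU: "x \<in> U" and "U \<subseteq> topspace (points X)"
    and e0: "framed X F (n + n) U e0" and l: "framed X M 1 U l"
    by (rule common_frames[OF F_bundle M_bundle assms(6) openin_topspace assms(6)])
  obtain e where e: "framed X F (n + n) U e"
    and adapted: "\<And>V s. open_in X V \<Longrightarrow> x \<in> V \<Longrightarrow> s \<in> carrier (sec F V) \<Longrightarrow>
      at_point X F x V s \<in> S \<longleftrightarrow> (\<forall>k\<in>{n..<n + n}. framed.val X F (n + n) U e x V s k = 0)"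
  proof (rule framed.adapted_frame[OF e0 xU le_add1 assms(8,9)], goal_cases)
    case (1 e)
    show thesis by (rule that[OF 1(2)]) (rule 1(3))
  qed
  interpret A: framed_form X F M \<psi> "n + n" U e l by (rule framed_formI[OF e l hom])
  have E: "modification X F (n + n) U e x {n..<n + n} E (\<lambda>V s. s)"
    unfolding assms(11)
    by (rule A.F.hecke_modification[OF xU le_add1 submodule.axioms(1)[OF assms(8)] adapted])
  \<comment> \<open>Isotropy is a statement about points of the fiber; evaluated on the classes of
    the first \<open>n\<close> frame members, whose coordinates are unit vectors, it says that the
    upper left block is zero at \<open>x\<close>.\<close>
  have "A.gram i k x = 0" if ik: "i < n" "k < n" for i k
  proof -
    have ik': "i < n + n" "k < n + n" using ik by auto
    \<comment> \<open>By the choice of the frame, membership in \<open>S\<close> is the vanishing of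
      the coordinates with index at least \<open>n\<close>, which holds for \<open>e a\<close> with
      \<open>a < n\<close>.\<close>
    have inS: "at_point X F x U (e a) \<in> S" if "a < n" for a
      unfolding adapted[OF A.F.U_open xU A.F.e_closed[OF trans_less_add1[OF that]]]
      using A.F.val_e'[OF xU trans_less_add1[OF that]] that by simp
    have c: "at_point X F x U (e a) \<in> carrier (fiber X F x)" if "a < n" for a
      by (rule A.F.fiber_carrierI[OF xU A.F.U_open xU A.F.e_closed[OF trans_less_add1[OF that]]])
    have fv: "A.F.fiber_val x (at_point X F x U (e a)) b = (if b = a then 1 else 0)"
      if "a < n" "b < n + n" for a b
      unfolding A.F.fiber_val[OF xU A.F.U_open xU A.F.e_closed[OF trans_less_add1[OF that(1)]] that(2)]
      by (rule A.F.val_e'[OF xU trans_less_add1[OF that(1)] that(2)])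
    have "fiber_form X F M \<psi> x (at_point X F x U (e i)) (at_point X F x U (e k)) = \<zero>\<^bsub>fiber X M x\<^esub>"
      using assms(10) inS ik unfolding isotropic_def by simp
    then have "(\<Sum>a<n + n. \<Sum>b<n + n. A.F.fiber_val x (at_point X F x U (e i)) a *
        A.F.fiber_val x (at_point X F x U (e k)) b * A.gram a b x) = 0"
      unfolding A.fiber_form_zero_iff[OF xU c[OF ik(1)] c[OF ik(2)]] .
    moreover have "(\<Sum>a<n + n. \<Sum>b<n + n. A.F.fiber_val x (at_point X F x U (e i)) a *
        A.F.fiber_val x (at_point X F x U (e k)) b * A.gram a b x) = 1 * 1 * A.gram i k x"
      by (rule sum_double_delta[OF ik']) (simp_all add: fv ik)
    ultimately show ?thesis by simp
  qed
  then interpret H: hecke_data X F M \<psi> n U e l x E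
    by (intro hecke_data.intro A.framed_form_axioms E point_twist.intro point_twist_axioms.intro
        l xU M_bundle hecke_data_axioms.intro F_bundle hom)
      (use sym nd in simp_all)
  have "orthogonal_bundle X (2 * n) E (twist X M x) H.\<phi>"
    unfolding orthogonal_bundle_def mult_2
    by (intro conjI H.ME.vector_bundle_G[OF F_bundle] H.TL.vector_bundle_G[OF M_bundle] H.phi_orthogonal)
  then show ?thesis using H.Tw.twist_inclusion H.phi_inherited by blast
qed

end
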